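(* Assume that Assumption (E) (defined in the context) holds true, let $\nu_{QSD}$, $\theta_0$ and $\eta$ be as in the context, and set $E'=\{x\in E:\eta(x)>0\}$. Then: (i) (Existence of the $Q$-process.) There exists a family $(\mathbb{Q}_x)_{x\in E'}$ of probability measures on $\Omega$ defined by $$\lim_{n\to+\infty}\mathbb{P}_x(A\mid n<\tau_\partial)=\mathbb{Q}_x(A)$$ for all $x\in E'$, all $\mathcal{F}_m$-measurable sets $A$ and all $m\ge0$. The process $(\Omega,(\mathcal{F}_n)_{n\in\mathbb{Z}_+},(X_n)_{n\in\mathbb{Z}_+},(\mathbb{Q}_x)_{x\in E'})$ is an $E'$-valued homogeneous Markov chain. (ii) (Semigroup.) The semigroup of the Markov process $X$ under $(\mathbb{Q}_x)_{x\in E'}$ is given, for all bounded measurable functions $\varphi$ on $E'$ and all $n\ge0$, by $$\widetilde P_n\varphi(x)=\frac{\theta_0^{-n}}{\eta(x)}\,P_n(\eta\varphi)(x).$$ (iii) (Exponential ergodicity.) The probability measure $\beta$ on $E'$ defined by $\beta(\mathrm dx)=\eta(x)\,\nu_{QSD}(\mathrm dx)$ is the unique invariant distribution of the Markov process $X$ under $(\mathbb{Q}_x)_{x\in E'}$. Moreover, there exist constants $C>0$ and $\alpha\in(0,1)$ such that, for all initial distributions $\mu$ on $E'$ such that $\mu(\varphi_1/\eta)<\infty$, $$\left\|\mu\widetilde P_n-\beta\right\|_{TV(\varphi_1/\eta)}\le C\alpha^n\,\mu(\varphi_1/\eta),\qquad\forall n\ge0.$$ In addition, for all initial distributions $\mu$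 on $E'$, $\left\|\mu\widetilde P_n-\beta\right\|_{TV}\to0$ as $n\to\infty$.
   Context: Setting. $E$ is a measurable space, $\partial\notin E$, $I$ is $\mathbb{R}_+$ or $\frac1k\mathbb{Z}_+$ for some $k\in\mathbb{N}=\{1,2,\ldots\}$, and $(X_t)_{t\in I}$ is a time-homogeneous Markov process in $E\cup\{\partial\}$, with law $\mathbb{P}_x$ when started from $x$, and $\mathbb{P}_\mu=\int\mathbb{P}_x\,\mu(\mathrm dx)$. The point $\partial$ is absorbing: $X_t=\partial$ for all $t\ge\tau_\partial:=\inf\{t\in I:X_t=\partial\}$ almost surely. For $n\in\mathbb{Z}_+$, $P_nf(x)=\mathbb{E}_x(f(X_n)\mathbf{1}_{n<\tau_\partial})$. Also $\mu(f)=\int f\,\mathrm d\mu$. Assumption (E). There exist a positive integer $n_1$, positive real constants $\theta_1,\theta_2,c_1,c_2,c_3$, two measurable functions $\varphi_1,\varphi_2:E\to\mathbb{R}_+$ and a probability measure $\nu$ on a measurable subset $K\subset E$ such that: - (E1) for all $x\in K$, $\mathbb{P}_x(X_{n_1}\in\cdot)\ge c_1\nu(\cdot\cap K)$. - (E2) $\theta_1<\theta_2$, $\inf_E\varphi_1\ge1$, $\sup_K\varphi_1<\infty$, $\inf_K\varphi_2>0$, $\sup_E\varphi_2\le1$, and for all $x\in E$, $P_1\varphi_1(x)\le\theta_1\varphi_1(x)+c_2\mathbf{1}_K(x)$ and $P_1\varphi_2(x)\ge\theta_2\varphi_2(x)$. - (E3) $\displaystyle\sup_{n\in\mathbb{Z}_+}\frac{\sup_{y\in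 K}\mathbb{P}_y(n<\tau_\partial)}{\inf_{y\in K}\mathbb{P}_y(n<\tau_\partial)}\le c_3$. - (E4) for all $x\in K$ there exists $n_4(x)$ such that $\mathbb{P}_x(X_n\in K)>0$ for all $n\ge n_4(x)$. Under Assumption (E), there is a unique probability measure $\nu_{QSD}$ on $E$ which is quasi-stationary, i.e. $\mathbb{P}_{\nu_{QSD}}(X_n\in\cdot\mid n<\tau_\partial)=\nu_{QSD}$ for all $n\in\mathbb{Z}_+$, and satisfies $\nu_{QSD}(\varphi_1)<\infty$ and $\nu_{QSD}(\varphi_2)>0$. The number $\theta_0\in(0,1]$ is defined by $\mathbb{P}_{\nu_{QSD}}(n<\tau_\partial)=\theta_0^n$ for all $n\in\mathbb{N}$. The limit $\eta(x)=\lim_{n\to+\infty}\theta_0^{-n}\mathbb{P}_x(n<\tau_\partial)\in[0,\infty)$ exists for every $x\in E$, $P_1\eta=\theta_0\eta$ and $\nu_{QSD}(\eta)=1$. $\Omega=E^{\mathbb{Z}_+}$ is the canonical state space of Markov chains on $E$, with coordinate process $(X_n)_{n\in\mathbb{Z}_+}$ and canonical filtration $(\mathcal{F}_n)_{n\in\mathbb{Z}_+}$; for $A\in\mathcal{F}_m$ and $n\ge m$, $\mathbb{P}_x(A\mid n<\tau_\partial)$ is the conditional probability that $(X_0,\ldots,X_m)$ lies in the subset of $E^{m+1}$ defining $A$. For a positive function $\psi$ on $E'$, $\|\mu_1-\mu_2\|_{TV(\psi)}=\sup\{|\mu_1(f)-\mu_2(f)|:f:E'\to\mathbb{R}\text{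 measurable},\ |f|\le\psi\}$, and $\|\cdot\|_{TV}=\|\cdot\|_{TV(1)}$. *)

theory Defs
  imports "HOL-Probability.Probability"
begin

definition natural_filtration ::
    "'i::linorder set \<Rightarrow> 's measure \<Rightarrow> 'w measure \<Rightarrow> ('i \<Rightarrow> 'w \<Rightarrow> 's) \<Rightarrow> 'i \<Rightarrow> 'w measure" where
  "natural_filtration T S \<Omega> X t =
     sigma (space \<Omega>) {X u -` A \<inter> space \<Omega> | u A. u \<in> T \<and> u \<le> t \<and> A \<in> sets S}"

text \<open>
  Time-homogeneous Markov process with values in the measurable subset \<open>D\<close> of the state
  space \<open>S\<close>; \<open>P x\<close> is the law when started from \<open>x \<in> D\<close>.  The maps \<open>X t\<close> may leave \<open>D\<close> on a
  null set (the coordinate process on a space of \<open>S\<close>-valued paths does), and \<open>P\<close> is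
  irrelevant outside \<open>D\<close>; hence the set integral in the Markov property runs over \<open>X s \<in> D\<close>.
\<close>
definition homogeneous_markov_process ::
    "'i::{linorder, monoid_add} set \<Rightarrow> 's measure \<Rightarrow> 's set \<Rightarrow> 'w measure \<Rightarrow> ('i \<Rightarrow> 'w \<Rightarrow> 's)
      \<Rightarrow> ('s \<Rightarrow> 'w measure) \<Rightarrow> bool" where
  "homogeneous_markov_process T S D \<Omega> X P \<longleftrightarrow>
     D \<in> sets S \<and>
     (\<forall>t\<in>T. X t \<in> \<Omega> \<rightarrow>\<^sub>M S) \<and>
     P \<in> restrict_space S D \<rightarrow>\<^sub>M prob_algebra \<Omega> \<and>
     (\<forall>x\<in>D. distr (P x) S (X 0) = return S x) \<and>
     (\<forall>x\<in>D. AE w in P x. \<forall>t\<in>T. X t w \<in> D) \<and>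
     (\<forall>x\<in>D. \<forall>s\<in>T. \<forall>t\<in>T. \<forall>B\<in>sets (natural_filtration T S \<Omega> X s). \<forall>A\<in>sets S.
        measure (P x) {w \<in> B. X (s + t) w \<in> A} =
        (LINT w:{w \<in> B. X s w \<in> D}|P x. measure (P (X s w)) {v \<in> space \<Omega>. X t v \<in> A}))"

definition transition_kernel ::
    "'s measure \<Rightarrow> 's set \<Rightarrow> ('i \<Rightarrow> 'w \<Rightarrow> 's) \<Rightarrow> ('s \<Rightarrow> 'w measure) \<Rightarrow> 'i \<Rightarrow> 's \<Rightarrow> 's measure" where
  "transition_kernel S D X P t x = restrict_space (distr (P x) S (X t)) D"

text \<open>The state space with the cemetery point adjoined: \<open>None\<close> is the cemetery.\<close>
definition cemetery_space :: "'a measure \<Rightarrow> 'a option measure" where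
  "cemetery_space M =
     sigma (insert None (Some ` space M)) (insert {None} ((`) Some ` sets M))"

definition absorption_time :: "real set \<Rightarrow> (real \<Rightarrow> 'w \<Rightarrow> 'a option) \<Rightarrow> 'w \<Rightarrow> ereal" where
  "absorption_time T X w = Inf (ereal ` {t \<in> T. X t w = None})"

definition absorbed_markov_process ::
    "real set \<Rightarrow> 'a measure \<Rightarrow> 'w measure \<Rightarrow> (real \<Rightarrow> 'w \<Rightarrow> 'a option)
      \<Rightarrow> ('a option \<Rightarrow> 'w measure) \<Rightarrow> bool" where
  "absorbed_markov_process T M \<Omega> X P \<longleftrightarrow>
     (T = {0..} \<or> (\<exists>k::nat. k \<ge> 1 \<and> T = range (\<lambda>j::nat. real j / real k))) \<and>
     homogeneous_markov_process T (cemetery_space M) (space (cemetery_space M)) \<Omega> X P \<and>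
     (\<forall>x\<in>space (cemetery_space M).
        AE w in P x. \<forall>t\<in>T. absorption_time T X w \<le> ereal t \<longrightarrow> X t w = None)"

definition alive :: "real set \<Rightarrow> 'w measure \<Rightarrow> (real \<Rightarrow> 'w \<Rightarrow> 'a option) \<Rightarrow> nat \<Rightarrow> 'w set" where
  "alive T \<Omega> X n = {w \<in> space \<Omega>. ereal (real n) < absorption_time T X w}"

definition visit :: "'w measure \<Rightarrow> (real \<Rightarrow> 'w \<Rightarrow> 'a option) \<Rightarrow> nat \<Rightarrow> 'a set \<Rightarrow> 'w set" where
  "visit \<Omega> X n A = {w \<in> space \<Omega>. X (real n) w \<in> Some ` A}"

text \<open>
  Probabilities and expectations of the absorbed process are taken in the completion of the
  law: over a continuum of times the absorption time need not be measurable, but almost sure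
  absorption makes \<open>n < absorption_time\<close> agree with \<open>X n \<noteq> None\<close> up to a null set.
\<close>
definition prob_from :: "('a option \<Rightarrow> 'w measure) \<Rightarrow> 'a \<Rightarrow> 'w set \<Rightarrow> real" where
  "prob_from P x B = measure (completion (P (Some x))) B"

definition prob_init :: "('a option \<Rightarrow> 'w measure) \<Rightarrow> 'a measure \<Rightarrow> 'w set \<Rightarrow> real" where
  "prob_init P \<mu> B = (LINT x|\<mu>. prob_from P x B)"

definition killed_value ::
    "real set \<Rightarrow> 'w measure \<Rightarrow> (real \<Rightarrow> 'w \<Rightarrow> 'a option) \<Rightarrow> nat \<Rightarrow> ('a \<Rightarrow> real) \<Rightarrow> 'w \<Rightarrow> real" where
  "killed_value T \<Omega> X n f w =
     (case X (real n) w of None \<Rightarrow> 0 | Some y \<Rightarrow> f y) * indicator (alive T \<Omega> X n) w"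

definition killed_integrable ::
    "real set \<Rightarrow> 'w measure \<Rightarrow> (real \<Rightarrow> 'w \<Rightarrow> 'a option) \<Rightarrow> ('a option \<Rightarrow> 'w measure)
      \<Rightarrow> nat \<Rightarrow> ('a \<Rightarrow> real) \<Rightarrow> 'a \<Rightarrow> bool" where
  "killed_integrable T \<Omega> X P n f x \<longleftrightarrow>
     integrable (completion (P (Some x))) (killed_value T \<Omega> X n f)"

definition killed_semigroup ::
    "real set \<Rightarrow> 'w measure \<Rightarrow> (real \<Rightarrow> 'w \<Rightarrow> 'a option) \<Rightarrow> ('a option \<Rightarrow> 'w measure)
      \<Rightarrow> nat \<Rightarrow> ('a \<Rightarrow> real) \<Rightarrow> 'a \<Rightarrow> real" where
  "killed_semigroup T \<Omega> X P n f x =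
     (LINT w|completion (P (Some x)). killed_value T \<Omega> X n f w)"

text \<open>
  The quotient of survival probabilities is taken in \<open>ennreal\<close>, so that an unbounded family of
  quotients, or a vanishing infimum under a positive supremum, violates the bound instead of
  producing a default value; survival probabilities on \<open>K\<close> are positive by the bounds on \<open>\<phi>2\<close>.
\<close>
definition assumption_E ::
    "real set \<Rightarrow> 'a measure \<Rightarrow> 'w measure \<Rightarrow> (real \<Rightarrow> 'w \<Rightarrow> 'a option) \<Rightarrow> ('a option \<Rightarrow> 'w measure)
      \<Rightarrow> nat \<Rightarrow> real \<Rightarrow> real \<Rightarrow> real \<Rightarrow> real \<Rightarrow> real \<Rightarrow> ('a \<Rightarrow> real) \<Rightarrow> ('a \<Rightarrow> real)
      \<Rightarrow> 'a set \<Rightarrow> 'a measure \<Rightarrow> bool" where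
  "assumption_E T M \<Omega> X P n1 \<theta>1 \<theta>2 c1 c2 c3 \<phi>1 \<phi>2 K \<nu> \<longleftrightarrow>
     0 < n1 \<and> 0 < \<theta>1 \<and> 0 < \<theta>2 \<and> 0 < c1 \<and> 0 < c2 \<and> 0 < c3 \<and>
     \<phi>1 \<in> borel_measurable M \<and> \<phi>2 \<in> borel_measurable M \<and>
     (\<forall>x\<in>space M. 0 \<le> \<phi>1 x \<and> 0 \<le> \<phi>2 x) \<and>
     K \<in> sets M \<and> prob_space \<nu> \<and> sets \<nu> = sets (restrict_space M K) \<and>
     (\<forall>x\<in>K. \<forall>A\<in>sets M. prob_from P x (visit \<Omega> X n1 A) \<ge> c1 * measure \<nu> (A \<inter> K)) \<and>
     \<theta>1 < \<theta>2 \<and>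
     (\<forall>x\<in>space M. 1 \<le> \<phi>1 x) \<and> bdd_above (\<phi>1 ` K) \<and>
     0 < (INF x\<in>K. \<phi>2 x) \<and> (\<forall>x\<in>space M. \<phi>2 x \<le> 1) \<and>
     (\<forall>x\<in>space M. killed_integrable T \<Omega> X P 1 \<phi>1 x \<and>
        killed_semigroup T \<Omega> X P 1 \<phi>1 x \<le> \<theta>1 * \<phi>1 x + c2 * indicator K x) \<and>
     (\<forall>x\<in>space M. killed_semigroup T \<Omega> X P 1 \<phi>2 x \<ge> \<theta>2 * \<phi>2 x) \<and>
     (SUP n. (SUP y\<in>K. ennreal (prob_from P y (alive T \<Omega> X n))) /
             (INF y\<in>K. ennreal (prob_from P y (alive T \<Omega> X n)))) \<le> ennreal c3 \<and>
     (\<forall>x\<in>K. \<exists>n4. \<forall>n\<ge>n4. prob_from P x (visit \<Omega> X n K) > 0)"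

definition quasi_stationary ::
    "real set \<Rightarrow> 'a measure \<Rightarrow> 'w measure \<Rightarrow> (real \<Rightarrow> 'w \<Rightarrow> 'a option) \<Rightarrow> ('a option \<Rightarrow> 'w measure)
      \<Rightarrow> 'a measure \<Rightarrow> bool" where
  "quasi_stationary T M \<Omega> X P \<mu> \<longleftrightarrow>
     prob_space \<mu> \<and> sets \<mu> = sets M \<and>
     (\<forall>n. \<forall>A\<in>sets M.
        prob_init P \<mu> (visit \<Omega> X n A \<inter> alive T \<Omega> X n) / prob_init P \<mu> (alive T \<Omega> X n)
        = measure \<mu> A)"

definition path_space :: "'a measure \<Rightarrow> (nat \<Rightarrow> 'a) measure" where
  "path_space M = PiM UNIV (\<lambda>_. M)"

definition coordinate :: "nat \<Rightarrow> (nat \<Rightarrow> 'a) \<Rightarrow> 'a" where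
  "coordinate n \<omega> = \<omega> n"

definition canonical_filtration :: "'a measure \<Rightarrow> nat \<Rightarrow> (nat \<Rightarrow> 'a) measure" where
  "canonical_filtration M = natural_filtration UNIV M (path_space M) coordinate"

text \<open>
  For \<open>A\<close> in the canonical \<open>\<sigma>\<close>-algebra of time \<open>m\<close>, membership in \<open>A\<close> depends on the first
  \<open>m + 1\<close> coordinates only; the event below says that the trajectory of \<open>X\<close> at the times
  \<open>0, \<dots>, m\<close> stays in the state space and lies in the set of finite paths defining \<open>A\<close>.
\<close>
definition trajectory_in ::
    "'w measure \<Rightarrow> (real \<Rightarrow> 'w \<Rightarrow> 'a option) \<Rightarrow> nat \<Rightarrow> (nat \<Rightarrow> 'a) set \<Rightarrow> 'w set" where
  "trajectory_in \<Omega> X m A = {w \<in> space \<Omega>. \<exists>\<omega>\<in>A. \<forall>k\<le>m. X (real k) w = Some (\<omega> k)}"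

definition conditional_path_prob ::
    "real set \<Rightarrow> 'w measure \<Rightarrow> (real \<Rightarrow> 'w \<Rightarrow> 'a option) \<Rightarrow> ('a option \<Rightarrow> 'w measure)
      \<Rightarrow> 'a \<Rightarrow> nat \<Rightarrow> (nat \<Rightarrow> 'a) set \<Rightarrow> nat \<Rightarrow> real" where
  "conditional_path_prob T \<Omega> X P x m A n =
     prob_from P x (trajectory_in \<Omega> X m A \<inter> alive T \<Omega> X n) / prob_from P x (alive T \<Omega> X n)"

definition distribution_on :: "'s measure \<Rightarrow> 's measure \<Rightarrow> bool" where
  "distribution_on N \<mu> \<longleftrightarrow> prob_space \<mu> \<and> sets \<mu> = sets N"

definition invariant_distribution ::
    "'s measure \<Rightarrow> (nat \<Rightarrow> 's \<Rightarrow> 's measure) \<Rightarrow> 's measure \<Rightarrow> bool" where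
  "invariant_distribution N \<kappa> \<mu> \<longleftrightarrow> distribution_on N \<mu> \<and> (\<forall>n. \<mu> \<bind> \<kappa> n = \<mu>)"

text \<open>
  Extended-valued.  If one of the two measures integrates \<open>\<psi>\<close>, finiteness of this supremum
  forces the other one to integrate \<open>\<psi>\<close> as well (test with truncations of \<open>\<psi>\<close>), so the
  default value of non-existing integrals cannot make a distance artificially small.
\<close>
definition weighted_TV ::
    "'s measure \<Rightarrow> ('s \<Rightarrow> real) \<Rightarrow> 's measure \<Rightarrow> 's measure \<Rightarrow> ennreal" where
  "weighted_TV N \<psi> \<mu>1 \<mu>2 =
     (SUP f\<in>{f \<in> borel_measurable N. \<forall>x\<in>space N. \<bar>f x\<bar> \<le> \<psi> x}.
        ennreal \<bar>(LINT x|\<mu>1. f x) - (LINT x|\<mu>2. f x)\<bar>)"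

end

theory Submission
  imports Defs
begin

text \<open>
The \<open>Q\<close>-process is a Doob transform.  For \<open>x\<close> in the state space let \<open>p n x\<close> be the law of
  \<open>X n\<close> under \<open>P (Some x)\<close> on the event of survival, a sub-Markov kernel, and let \<open>S n x\<close> be its mass.
  By the Markov property, conditioning an event \<open>A\<close> of the first \<open>m\<close> steps on survival up to time
  \<open>n\<close> gives \<open>E x [1 A * S (n - m) (X m)] / S n x\<close>.  Dividing both terms by \<open>\<theta>0 ^ n\<close> and letting
  \<open>n\<close> grow gives \<open>E x [1 A * \<eta> (X m)] / (\<theta>0 ^ m * \<eta> x)\<close>, provided that the normalised
  survival probabilities are dominated.  This limit is the law of the first steps of the Markov chain
  whose kernel has density \<open>\<eta> y / (\<theta>0 * \<eta> x)\<close> with respect to \<open>p 1 x\<close>; the kernel has mass one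
  because \<open>\<eta>\<close> is an eigenfunction for \<open>\<theta>0\<close>.  The extension from finite time horizons to
  a measure on infinite paths is the theorem of Ionescu-Tulcea, whose finite-dimensional recursion is
  exactly the Markov property of the absorbed process combined with the eigenvalue equation
  (\<open>qlaw_Suc\<close>).

  Everything about \<open>\<eta>\<close> follows from the one bound \<open>S n x \<le> c * \<theta>0 ^ n * \<phi>1 x\<close>
  (\<open>survival_bound\<close>).  On \<open>K\<close> it holds because the survival probabilities there are mutually
  comparable and their average under the quasi-stationary distribution, which charges \<open>K\<close>, is
  \<open>\<theta>0 ^ n\<close>.  Outside \<open>K\<close> it propagates by induction on \<open>n\<close>, since one step contracts \<open>\<phi>1\<close> by
  \<open>\<theta>1 < \<theta>0\<close>.  Dominated convergence then yields the eigenvalue equation and that \<open>\<eta>\<close> integrates to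
  one under the quasi-stationary distribution.  The same contraction shows that \<open>\<eta>\<close> cannot vanish
  on \<open>K\<close> without vanishing everywhere.

  For the ergodicity, \<open>V = \<phi>1 / \<eta>\<close> is a Lyapunov function of the tilted kernel: the tilt replaces
  the rate \<open>\<theta>1\<close> by \<open>\<theta>1 / \<theta>0 < 1\<close>, and \<open>V\<close> is bounded below by the domination.  So the
  tilted chain drifts geometrically towards \<open>K\<close>.  The set \<open>K\<close> is small for it and the chain is
  aperiodic, so every level set of \<open>V\<close> is small for a common iterate (\<open>level_set_small\<close>).
  The contraction argument of Hairer and Mattingly, in its dual form on oscillations of functions
  measured against \<open>2 + \<delta> * V x + \<delta> * V y\<close> (\<open>contraction_step\<close>), gives the exponential convergence.
  Uniqueness of the invariant distribution and the convergence in total variation from an arbitrary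
  initial law follow by integrating the pointwise estimate.
\<close>

section \<open>Geometric ergodicity from a drift towards a small set\<close>

lemma integral_dominates:
  fixes h :: "'s \<Rightarrow> real"
  assumes sets: "sets \<rho> = sets R" and le: "\<And>A. A \<in> sets R \<Longrightarrow> emeasure \<rho> A \<le> emeasure R A"
    and h: "integrable R h" and nn: "\<And>x. x \<in> space R \<Longrightarrow> 0 \<le> h x"
  shows "integrable \<rho> h" "(LINT x|\<rho>. h x) \<le> (LINT x|R. h x)"
proof -
  have sp: "space \<rho> = space R" using sets by (rule sets_eq_imp_space_eq)
  have hm: "h \<in> borel_measurable R" using h by auto
  have hm': "h \<in> borel_measurable \<rho>" using hm by (simp add: measurable_cong_sets[OF sets refl])
  have leN: "(\<integral>\<^sup>+x. ennreal (h x) \<partial>\<rho>) \<le> (\<integral>\<^sup>+x. ennreal (h x) \<partial>R)"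
    by (rule nn_integral_mono_measure[OF sets]) (use sets le sp in \<open>auto simp: le_measure\<close>)
  have aeR: "AE x in R. 0 \<le> h x" and aer: "AE x in \<rho>. 0 \<le> h x"
    using nn sp by auto
  have "(\<integral>\<^sup>+x. ennreal (h x) \<partial>R) < \<infinity>"
    using h aeR by (simp add: nn_integral_eq_integral)
  with leN have fin: "(\<integral>\<^sup>+x. ennreal (h x) \<partial>\<rho>) < \<infinity>" by (rule le_less_trans)
  show int: "integrable \<rho> h"
    by (rule integrableI_nonneg[OF hm' aer fin])
  show "(LINT x|\<rho>. h x) \<le> (LINT x|R. h x)"
    using leN nn_integral_eq_integral[OF int aer] nn_integral_eq_integral[OF h aeR]
    by (simp add: integral_nonneg_AE[OF aeR])
qed

text \<open>A weighted bound on all differences is a weighted bound on the distance to one constant.  This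
  makes a Lipschitz estimate accessible to bounds on integrals of single functions.\<close>

lemma weighted_oscillation_center:
  fixes f W :: "'s \<Rightarrow> real"
  assumes osc: "\<And>x y. x \<in> S \<Longrightarrow> y \<in> S \<Longrightarrow> \<bar>f x - f y\<bar> \<le> L * (W x + W y)"
  obtains c where "\<And>x. x \<in> S \<Longrightarrow> \<bar>f x - c\<bar> \<le> L * W x"
proof (cases "S = {}")
  case False
  define c where "c = (INF x\<in>S. f x + L * W x)"
  have *: "f y - L * W y \<le> f x + L * W x" if "x \<in> S" "y \<in> S" for x y
    using osc[OF that(2,1)] by (auto simp: abs_le_iff algebra_simps)
  have "\<bar>f y - c\<bar> \<le> L * W y" if y: "y \<in> S" for y
  proof -
    have "f y - L * W y \<le> c" unfolding c_def
      by (rule cINF_greatest) (use False * y in auto)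
    moreover have "c \<le> f y + L * W y" unfolding c_def
      by (rule cINF_lower) (use * y in \<open>auto intro!: bdd_belowI2\<close>)
    ultimately show ?thesis by (simp add: abs_le_iff)
  qed
  then show ?thesis by (rule that)
qed (use that in auto)

text \<open>Hairer and Mattingly's contraction, on the side of functions.  If \<open>V x + V y\<close> is large, the drift
  alone shrinks the weight \<open>2 + \<delta> * V x + \<delta> * V y\<close>, since the loss \<open>2 * \<delta> * b\<close> is less than the gain
  \<open>\<delta> * (1 - \<gamma>) * r\<close>.  If \<open>V x + V y\<close> is at most \<open>r\<close>, both laws dominate \<open>\<rho>\<close>.  The part of mass \<open>e\<close> that they share
  then cancels in the difference of the integrals, and \<open>\<delta>\<close> is chosen so small that the gain \<open>2 * e\<close> exceeds
  the loss \<open>2 * \<delta> * b = e\<close>.\<close>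

lemma contraction_step:
  fixes R :: "'s \<Rightarrow> 's measure" and V :: "'s \<Rightarrow> real"
  assumes R: "\<And>x. x \<in> space N \<Longrightarrow> prob_space (R x)" "\<And>x. x \<in> space N \<Longrightarrow> sets (R x) = sets N"
    and V: "V \<in> borel_measurable N" "\<And>x. x \<in> space N \<Longrightarrow> 0 \<le> V x"
    and drift: "\<And>x. x \<in> space N \<Longrightarrow> (\<integral>\<^sup>+y. ennreal (V y) \<partial>R x) \<le> ennreal (\<gamma> * V x + b)"
    and const: "0 \<le> \<gamma>" "\<gamma> < 1" "0 < b" "2 * b < (1 - \<gamma>) * r"
    and \<rho>: "sets \<rho> = sets N" "finite_measure \<rho>" "0 < measure \<rho> (space N)"
    and small: "\<And>x A. x \<in> space N \<Longrightarrow> V x \<le> r \<Longrightarrow> A \<in> sets N \<Longrightarrow> emeasure \<rho> A \<le> emeasure (R x) A"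
  obtains \<delta> \<alpha> where "0 < \<delta>" "0 < \<alpha>" "\<alpha> < 1"
    "\<And>f L. f \<in> borel_measurable N \<Longrightarrow> 0 \<le> L \<Longrightarrow>
      (\<And>x y. x \<in> space N \<Longrightarrow> y \<in> space N \<Longrightarrow> \<bar>f x - f y\<bar> \<le> L * (2 + \<delta> * V x + \<delta> * V y)) \<Longrightarrow>
      (\<forall>x\<in>space N. \<forall>y\<in>space N.
        \<bar>(LINT z|R x. f z) - (LINT z|R y. f z)\<bar> \<le> \<alpha> * L * (2 + \<delta> * V x + \<delta> * V y))"
proof -
  define e where "e = measure \<rho> (space N)"
  define \<delta> where "\<delta> = e / (2 * b)"
  define d where "d = (1 - \<gamma>) * r - 2 * b"
  define \<alpha> where "\<alpha> = max (max \<gamma> (1 / 2)) (max (1 - e / 2) (1 - \<delta> * d / (2 + \<delta> * r)))"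
  have e: "0 < e" using \<rho> by (simp add: e_def)
  have \<delta>: "0 < \<delta>" "2 * \<delta> * b = e" using e const by (auto simp: \<delta>_def)
  have d: "0 < d" using const by (simp add: d_def)
  have r: "0 < r"
  proof (rule ccontr)
    assume "\<not> 0 < r"
    then have "(1 - \<gamma>) * r \<le> 0" using const by (simp add: mult_nonneg_nonpos)
    with const show False by simp
  qed
  have \<alpha>: "0 < \<alpha>" "\<alpha> < 1" "\<gamma> \<le> \<alpha>" "1 - e / 2 \<le> \<alpha>" "1 - \<delta> * d / (2 + \<delta> * r) \<le> \<alpha>"
    unfolding \<alpha>_def using const e d \<delta>(1) r by (auto intro!: divide_pos_pos add_pos_pos)
  define W where "W x = 1 + \<delta> * V x" for x
  have Wm: "W \<in> borel_measurable N" unfolding W_def using V(1) by measurable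
  have W1: "1 \<le> W x" if "x \<in> space N" for x using V(2)[OF that] \<delta> by (simp add: W_def)
  have sp: "space (R x) = space N" if "x \<in> space N" for x
    using R(2)[OF that] by (rule sets_eq_imp_space_eq)
  have spr: "space \<rho> = space N" using \<rho>(1) by (rule sets_eq_imp_space_eq)
  have Vint: "integrable (R x) V \<and> (LINT z|R x. V z) \<le> \<gamma> * V x + b" if x: "x \<in> space N" for x
  proof
    have m: "V \<in> borel_measurable (R x)" using V(1) by (simp add: measurable_cong_sets[OF R(2)[OF x] refl])
    have ae: "AE z in R x. 0 \<le> V z" using V(2) sp[OF x] by auto
    show i: "integrable (R x) V"
      by (rule integrableI_nonneg[OF m ae]) (use drift[OF x] in \<open>auto intro: le_less_trans\<close>)
    have "ennreal (LINT z|R x. V z) \<le> ennreal (\<gamma> * V x + b)"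
      using drift[OF x] nn_integral_eq_integral[OF i ae] by simp
    then show "(LINT z|R x. V z) \<le> \<gamma> * V x + b"
      using V(2)[OF x] const by (subst (asm) ennreal_le_iff) auto
  qed
  have Wint: "integrable (R x) W" "(LINT z|R x. W z) \<le> 1 + \<delta> * (\<gamma> * V x + b)"
    if x: "x \<in> space N" for x
  proof -
    interpret prob_space "R x" by (rule R(1)[OF x])
    have i: "integrable (R x) V" and l: "(LINT z|R x. V z) \<le> \<gamma> * V x + b" using Vint[OF x] by auto
    show "integrable (R x) W" unfolding W_def using i by auto
    have "(LINT z|R x. W z) = 1 + \<delta> * (LINT z|R x. V z)"
      unfolding W_def using i by (simp add: prob_space)
    then show "(LINT z|R x. W z) \<le> 1 + \<delta> * (\<gamma> * V x + b)"
      using l \<delta> by simp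
  qed
  show thesis
  proof (rule that[OF \<delta>(1) \<alpha>(1,2)], intro ballI)
    fix f :: "'s \<Rightarrow> real" and L :: real and x y
    assume fm: "f \<in> borel_measurable N" and L: "0 \<le> L" and x: "x \<in> space N" and y: "y \<in> space N"
      and osc: "\<And>x y. x \<in> space N \<Longrightarrow> y \<in> space N \<Longrightarrow> \<bar>f x - f y\<bar> \<le> L * (2 + \<delta> * V x + \<delta> * V y)"
    obtain c where c: "\<And>z. z \<in> space N \<Longrightarrow> \<bar>f z - c\<bar> \<le> L * W z"
    proof (rule weighted_oscillation_center[of "space N" f L W])
      show "\<bar>f u - f v\<bar> \<le> L * (W u + W v)" if "u \<in> space N" "v \<in> space N" for u v
        using osc[OF that] by (simp add: W_def algebra_simps)
    qed blast
    define g where "g z = f z - c" for z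
    have gm: "g \<in> borel_measurable N" unfolding g_def using fm by measurable
    have gW: "\<bar>g z\<bar> \<le> L * W z" if "z \<in> space N" for z using c[OF that] by (simp add: g_def)
    have gW': "\<bar>g z\<bar> \<le> L * \<bar>W z\<bar>" if "z \<in> space N" for z using gW[OF that] W1[OF that] by simp
    have gint: "integrable (R u) g" "(LINT z|R u. f z) = (LINT z|R u. g z) + c" if u: "u \<in> space N" for u
    proof -
      interpret prob_space "R u" by (rule R(1)[OF u])
      have "integrable (R u) (\<lambda>z. L * W z)" using Wint(1)[OF u] by auto
      then show i: "integrable (R u) g"
        by (rule Bochner_Integration.integrable_bound)
           (use gm gW' L sp[OF u] in \<open>auto simp: measurable_cong_sets[OF R(2)[OF u] refl] abs_mult\<close>)
      have "(LINT z|R u. f z) = (LINT z|R u. g z + c)" by (simp add: g_def)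
      also have "\<dots> = (LINT z|R u. g z) + c" using i by (simp add: prob_space)
      finally show "(LINT z|R u. f z) = (LINT z|R u. g z) + c" .
    qed
    have up: "(LINT z|R u. L * W z - s * g z) \<ge> 0"
             "(LINT z|R u. L * W z - s * g z) = L * (LINT z|R u. W z) - s * (LINT z|R u. g z)"
             "integrable (R u) (\<lambda>z. L * W z - s * g z)"
             "\<And>z. z \<in> space N \<Longrightarrow> 0 \<le> L * W z - s * g z"
      if u: "u \<in> space N" and s: "s = 1 \<or> s = - 1" for u s
    proof -
      show nn: "\<And>z. z \<in> space N \<Longrightarrow> 0 \<le> L * W z - s * g z"
        using gW s by (force simp: abs_le_iff)
      show "(LINT z|R u. L * W z - s * g z) \<ge> 0"
        by (rule integral_nonneg_AE) (use nn sp[OF u] in auto)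
      show "(LINT z|R u. L * W z - s * g z) = L * (LINT z|R u. W z) - s * (LINT z|R u. g z)"
        "integrable (R u) (\<lambda>z. L * W z - s * g z)"
        using Wint(1)[OF u] gint(1)[OF u] by auto
    qed
    let ?D = "(LINT z|R x. f z) - (LINT z|R y. f z)"
    have D: "?D = (LINT z|R x. g z) - (LINT z|R y. g z)" using gint(2)[OF x] gint(2)[OF y] by simp
    have Wxy: "(LINT z|R x. W z) + (LINT z|R y. W z) \<le> 2 + \<delta> * \<gamma> * (V x + V y) + e"
      using Wint(2)[OF x] Wint(2)[OF y] \<delta>(2) by (simp add: algebra_simps)
    show "\<bar>?D\<bar> \<le> \<alpha> * L * (2 + \<delta> * V x + \<delta> * V y)"
    proof (cases "V x + V y \<le> r")
      case False
      have "\<bar>?D\<bar> \<le> L * ((LINT z|R x. W z) + (LINT z|R y. W z))"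
        using up(1,2)[OF x, of 1] up(1,2)[OF y, of 1] up(1,2)[OF x, of "-1"] up(1,2)[OF y, of "-1"]
        unfolding D by (simp add: abs_le_iff algebra_simps)
      also have "\<dots> \<le> L * (2 + \<delta> * \<gamma> * (V x + V y) + e)"
        using Wxy L by (rule mult_left_mono)
      also have "\<dots> \<le> L * (\<alpha> * (2 + \<delta> * (V x + V y)))"
      proof (rule mult_left_mono[OF _ L])
        have p: "0 < 2 + \<delta> * r" using \<delta>(1) r by (simp add: add_pos_pos)
        have "(1 - \<alpha>) * (2 + \<delta> * r) \<le> \<delta> * d"
          using \<alpha>(5) p by (simp add: field_simps)
        then have 1: "2 * (1 - \<alpha>) + e \<le> \<delta> * (\<alpha> - \<gamma>) * r"
          using \<delta>(2) unfolding d_def by (simp add: algebra_simps)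
        also have "\<dots> \<le> \<delta> * (\<alpha> - \<gamma>) * (V x + V y)"
          using False \<delta>(1) \<alpha>(3) by (intro mult_left_mono) auto
        finally show "2 + \<delta> * \<gamma> * (V x + V y) + e \<le> \<alpha> * (2 + \<delta> * (V x + V y))"
          by (simp add: algebra_simps)
      qed
      finally show ?thesis by (simp add: algebra_simps)
    next
      case True
      have Vr: "V x \<le> r" "V y \<le> r" using True V(2)[OF x] V(2)[OF y] by auto
      have dom: "integrable \<rho> h" "(LINT z|\<rho>. h z) \<le> (LINT z|R u. h z)"
        if u: "u \<in> space N" "V u \<le> r" and h: "integrable (R u) h" "\<And>z. z \<in> space N \<Longrightarrow> 0 \<le> h z"
        for u and h :: "'s \<Rightarrow> real"
        using integral_dominates[of \<rho> "R u" h] \<rho>(1) R(2)[OF u(1)] small[OF u] h sp[OF u(1)] by auto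
      have iW: "integrable \<rho> W" using dom(1)[OF x Vr(1) Wint(1)[OF x]] W1 by force
      have eW: "e \<le> (LINT z|\<rho>. W z)"
      proof -
        interpret r: finite_measure \<rho> by (rule \<rho>(2))
        have "e = (LINT z|\<rho>. 1)" by (simp add: e_def spr)
        also have "\<dots> \<le> (LINT z|\<rho>. W z)"
          by (rule integral_mono_AE) (use iW W1 spr in auto)
        finally show ?thesis .
      qed
      have ig: "integrable \<rho> g"
        by (rule Bochner_Integration.integrable_bound[where f="\<lambda>z. L * W z"])
           (use iW gm gW' L spr in \<open>auto simp: measurable_cong_sets[OF \<rho>(1) refl] abs_mult\<close>)
      \<comment> \<open>For \<open>s = 1\<close> and \<open>s = -1\<close> this bounds the difference of the integrals from both sides: \<open>L * W - s * g\<close> and \<open>L * W + s * g\<close> are nonnegative, so their integrals under \<open>R x\<close> and \<open>R y\<close> dominate those under \<open>\<rho>\<close>, which add up to \<open>2 * L\<close> times the integral of \<open>W\<close>.\<close>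
      have key: "s * (LINT z|R x. g z) - s * (LINT z|R y. g z)
          \<le> L * ((LINT z|R x. W z) + (LINT z|R y. W z)) - 2 * L * e" if s: "s = 1 \<or> s = -1" for s
      proof -
        have s': "- s = 1 \<or> - s = -1" using s by auto
        have a: "L * (LINT z|\<rho>. W z) - s * (LINT z|\<rho>. g z) \<le> L * (LINT z|R x. W z) - s * (LINT z|R x. g z)"
          using dom(2)[OF x Vr(1) up(3)[OF x s] up(4)[OF x s]] up(2)[OF x s] iW ig by simp
        have b: "L * (LINT z|\<rho>. W z) + s * (LINT z|\<rho>. g z) \<le> L * (LINT z|R y. W z) + s * (LINT z|R y. g z)"
          using dom(2)[OF y Vr(2) up(3)[OF y s'] up(4)[OF y s']] up(2)[OF y s'] iW ig by simp
        have "L * e \<le> L * (LINT z|\<rho>. W z)" using eW L by (rule mult_left_mono)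
        with a b show ?thesis by (simp add: algebra_simps)
      qed
      have "\<bar>?D\<bar> \<le> L * ((LINT z|R x. W z) + (LINT z|R y. W z)) - 2 * L * e"
        unfolding D using key[of 1] key[of "-1"] by (simp add: abs_le_iff)
      also have "\<dots> \<le> L * (2 + \<delta> * \<gamma> * (V x + V y) + e) - 2 * L * e"
        using mult_left_mono[OF Wxy L] by simp
      also have "\<dots> = L * (2 - e + \<delta> * \<gamma> * (V x + V y))" by (simp add: algebra_simps)
      also have "\<dots> \<le> L * (\<alpha> * (2 + \<delta> * (V x + V y)))"
      proof (rule mult_left_mono[OF _ L])
        have "\<gamma> * (\<delta> * (V x + V y)) \<le> \<alpha> * (\<delta> * (V x + V y))"
          using \<alpha>(3) \<delta>(1) V(2)[OF x] V(2)[OF y] by (intro mult_right_mono) auto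
        then show "2 - e + \<delta> * \<gamma> * (V x + V y) \<le> \<alpha> * (2 + \<delta> * (V x + V y))"
          using \<alpha>(4) by (simp add: algebra_simps)
      qed
      finally show ?thesis by (simp add: algebra_simps)
    qed
  qed
qed

text \<open>For integrands that need not be bounded, splitting into positive and negative parts reduces the Bochner
  integral of a mixture to nonnegative integrals.\<close>

lemma integral_bind_kernel:
  fixes f :: "'b \<Rightarrow> real"
  assumes ker: "\<kappa> \<in> M \<rightarrow>\<^sub>M subprob_algebra N" and f: "f \<in> borel_measurable N"
    and fin: "(\<integral>\<^sup>+x. \<integral>\<^sup>+y. ennreal \<bar>f y\<bar> \<partial>\<kappa> x \<partial>M) < \<infinity>"
    and int: "\<And>x. x \<in> space M \<Longrightarrow> integrable (\<kappa> x) f"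
  shows "integrable (M \<bind> \<kappa>) f" "integrable M (\<lambda>x. LINT y|\<kappa> x. f y)"
    "(LINT y|(M \<bind> \<kappa>). f y) = (LINT x|M. LINT y|\<kappa> x. f y)"
proof -
  have nb: "(\<integral>\<^sup>+y. h y \<partial>(M \<bind> \<kappa>)) = (\<integral>\<^sup>+x. \<integral>\<^sup>+y. h y \<partial>\<kappa> x \<partial>M)"
    if "h \<in> borel_measurable N" for h :: "'b \<Rightarrow> ennreal"
    by (rule nn_integral_bind[OF that ker])
  show bi: "integrable (M \<bind> \<kappa>) f"
  proof (cases "space M = {}")
    case True
    then have e: "M \<bind> \<kappa> = count_space {}" by (simp add: bind_empty)
    show ?thesis unfolding e by (simp add: integrable_count_space)
  next
    case False
    have s: "sets (M \<bind> \<kappa>) = sets N" using sets_bind[OF subprob_measurableD(2)[OF ker] False] by simp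
    show ?thesis
      by (rule integrableI_bounded) (use f fin nb[of "\<lambda>y. ennreal \<bar>f y\<bar>"] in \<open>auto simp: measurable_cong_sets[OF s refl]\<close>)
  qed
  define Fp where "Fp x = (\<integral>\<^sup>+y. ennreal (f y) \<partial>\<kappa> x)" for x
  define Fm where "Fm x = (\<integral>\<^sup>+y. ennreal (- f y) \<partial>\<kappa> x)" for x
  have [measurable]: "Fp \<in> borel_measurable M" "Fm \<in> borel_measurable M"
    unfolding Fp_def Fm_def using f
    by (auto intro!: measurable_compose[OF ker nn_integral_measurable_subprob_algebra])
  have le: "Fp x \<le> (\<integral>\<^sup>+y. ennreal \<bar>f y\<bar> \<partial>\<kappa> x)" "Fm x \<le> (\<integral>\<^sup>+y. ennreal \<bar>f y\<bar> \<partial>\<kappa> x)" for x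
    unfolding Fp_def Fm_def by (auto intro!: nn_integral_mono ennreal_leI)
  have finp: "(\<integral>\<^sup>+x. Fp x \<partial>M) < \<infinity>" "(\<integral>\<^sup>+x. Fm x \<partial>M) < \<infinity>"
    using le_less_trans[OF nn_integral_mono[OF le(1)] fin] le_less_trans[OF nn_integral_mono[OF le(2)] fin] by auto
  have F: "Fp x < \<infinity>" "Fm x < \<infinity>" "(LINT y|\<kappa> x. f y) = enn2real (Fp x) - enn2real (Fm x)"
    if x: "x \<in> space M" for x
  proof -
    have "(\<integral>\<^sup>+y. ennreal \<bar>f y\<bar> \<partial>\<kappa> x) < \<infinity>" using int[OF x] by (simp add: integrable_iff_bounded)
    then show "Fp x < \<infinity>" "Fm x < \<infinity>" using le[of x] by (auto intro: le_less_trans)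
    show "(LINT y|\<kappa> x. f y) = enn2real (Fp x) - enn2real (Fm x)"
      unfolding Fp_def Fm_def by (rule real_lebesgue_integral_def[OF int[OF x]])
  qed
  have I: "integrable M (\<lambda>x. enn2real (H x)) \<and> (LINT x|M. enn2real (H x)) = enn2real (\<integral>\<^sup>+x. H x \<partial>M)"
    if H: "H \<in> borel_measurable M" "(\<integral>\<^sup>+x. H x \<partial>M) < \<infinity>" "\<And>x. x \<in> space M \<Longrightarrow> H x < \<infinity>" for H
  proof -
    have e: "(\<integral>\<^sup>+x. ennreal (enn2real (H x)) \<partial>M) = (\<integral>\<^sup>+x. H x \<partial>M)"
      by (rule nn_integral_cong) (use H(3) in \<open>simp add: less_top\<close>)
    have "integrable M (\<lambda>x. enn2real (H x))"
      by (rule integrableI_nonneg) (use H e in auto)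
    moreover have "(LINT x|M. enn2real (H x)) = enn2real (\<integral>\<^sup>+x. H x \<partial>M)"
      using e H(1) by (subst integral_eq_nn_integral) auto
    ultimately show ?thesis by simp
  qed
  have Ip: "integrable M (\<lambda>x. enn2real (Fp x))" "(LINT x|M. enn2real (Fp x)) = enn2real (\<integral>\<^sup>+x. Fp x \<partial>M)"
    and Im: "integrable M (\<lambda>x. enn2real (Fm x))" "(LINT x|M. enn2real (Fm x)) = enn2real (\<integral>\<^sup>+x. Fm x \<partial>M)"
    using I[of Fp] I[of Fm] finp F by auto
  have "integrable M (\<lambda>x. enn2real (Fp x) - enn2real (Fm x))" using Ip Im by auto
  then show "integrable M (\<lambda>x. LINT y|\<kappa> x. f y)"
    using F(3) by (simp cong: Bochner_Integration.integrable_cong)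
  have "(LINT y|(M \<bind> \<kappa>). f y) = enn2real (\<integral>\<^sup>+x. Fp x \<partial>M) - enn2real (\<integral>\<^sup>+x. Fm x \<partial>M)"
    unfolding real_lebesgue_integral_def[OF bi] Fp_def Fm_def
    using f by (simp add: nb)
  also have "\<dots> = (LINT x|M. enn2real (Fp x) - enn2real (Fm x))"
    using Ip Im by simp
  also have "\<dots> = (LINT x|M. LINT y|\<kappa> x. f y)"
    using F(3) by (simp cong: Bochner_Integration.integral_cong)
  finally show "(LINT y|(M \<bind> \<kappa>). f y) = (LINT x|M. LINT y|\<kappa> x. f y)" .
qed

locale kernel_semigroup =
  fixes M :: "'a measure" and p :: "nat \<Rightarrow> 'a \<Rightarrow> 'a measure"
  assumes kernel: "p n \<in> M \<rightarrow>\<^sub>M subprob_algebra M"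
    and init: "x \<in> space M \<Longrightarrow> p 0 x = return M x"
    and semigroup: "x \<in> space M \<Longrightarrow> p (m + n) x = p m x \<bind> p n"
begin

lemma kernel_sets: "x \<in> space M \<Longrightarrow> sets (p n x) = sets M"
  by (rule subprob_measurableD(2)[OF kernel])

lemma kernel_space: "x \<in> space M \<Longrightarrow> space (p n x) = space M"
  by (rule subprob_measurableD(1)[OF kernel])

lemma kernel_subprob: "x \<in> space M \<Longrightarrow> subprob_space (p n x)"
  by (rule subprob_space_kernel[OF kernel])

lemma kernel_emeasure: "x \<in> space M \<Longrightarrow> emeasure (p n x) A = ennreal (measure (p n x) A)"
  by (rule finite_measure.emeasure_eq_measure[OF subprob_space.axioms(1)[OF kernel_subprob]])

lemma nn_semigroup:
  assumes "f \<in> borel_measurable M" "x \<in> space M"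
  shows "(\<integral>\<^sup>+y. f y \<partial>p (m + n) x) = (\<integral>\<^sup>+y. \<integral>\<^sup>+z. f z \<partial>p n y \<partial>p m x)"
  unfolding semigroup[OF assms(2)]
  by (rule nn_integral_bind[where B=M])
     (use assms kernel in \<open>auto simp: measurable_cong_sets[OF kernel_sets[OF assms(2)] refl]\<close>)

lemma nn_measurable:
  assumes "f \<in> borel_measurable M"
  shows "(\<lambda>x. \<integral>\<^sup>+y. f y \<partial>p n x) \<in> borel_measurable M"
  by (rule measurable_compose[OF kernel nn_integral_measurable_subprob_algebra[OF assms]])

lemma emeasure_measurable: "A \<in> sets M \<Longrightarrow> (\<lambda>x. emeasure (p n x) A) \<in> borel_measurable M"
  by (rule measurable_compose[OF kernel]) auto

lemma emeasure_semigroup: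
  assumes [measurable]: "A \<in> sets M" and x: "x \<in> space M"
  shows "emeasure (p (m + n) x) A = (\<integral>\<^sup>+y. emeasure (p n y) A \<partial>p m x)"
proof -
  have "emeasure (p (m + n) x) A = (\<integral>\<^sup>+y. indicator A y \<partial>p (m + n) x)"
    using kernel_sets[OF x] by simp
  also have "\<dots> = (\<integral>\<^sup>+y. \<integral>\<^sup>+z. indicator A z \<partial>p n y \<partial>p m x)"
    by (rule nn_semigroup) (use x in auto)
  also have "\<dots> = (\<integral>\<^sup>+y. emeasure (p n y) A \<partial>p m x)"
    by (rule nn_integral_cong) (use kernel_space[OF x] kernel_sets in auto)
  finally show ?thesis .
qed

lemma nn_init: "x \<in> space M \<Longrightarrow> f \<in> borel_measurable M \<Longrightarrow> (\<integral>\<^sup>+y. f y \<partial>p 0 x) = f x"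
  by (simp add: init nn_integral_return)

text \<open>Applied to \<open>\<phi>2 \<le> 1\<close>, this gives the lower bound on the survival probabilities that makes the
  comparison of survival probabilities on \<open>K\<close> meaningful.\<close>

lemma subharmonic_iterate:
  assumes \<phi>: "\<phi> \<in> borel_measurable M" "\<And>x. x \<in> space M \<Longrightarrow> 0 \<le> \<phi> x" and \<theta>: "0 \<le> \<theta>"
    and sub: "\<And>x. x \<in> space M \<Longrightarrow> ennreal (\<theta> * \<phi> x) \<le> (\<integral>\<^sup>+y. ennreal (\<phi> y) \<partial>p 1 x)"
    and x: "x \<in> space M"
  shows "ennreal (\<theta> ^ n * \<phi> x) \<le> (\<integral>\<^sup>+y. ennreal (\<phi> y) \<partial>p n x)"
  using x
proof (induction n arbitrary: x)
  case (Suc n)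
  note [measurable_cong] = kernel_sets[OF Suc.prems]
  note \<phi>(1)[measurable]
  have "ennreal (\<theta> ^ Suc n * \<phi> x) = ennreal (\<theta> ^ n) * ennreal (\<theta> * \<phi> x)"
    using \<theta> \<phi>(2)[OF Suc.prems] by (simp add: ennreal_mult[symmetric] ac_simps)
  also have "\<dots> \<le> ennreal (\<theta> ^ n) * (\<integral>\<^sup>+y. ennreal (\<phi> y) \<partial>p 1 x)"
    by (intro mult_left_mono sub Suc.prems) simp
  also have "\<dots> = (\<integral>\<^sup>+y. ennreal (\<theta> ^ n * \<phi> y) \<partial>p 1 x)"
    using \<theta> by (simp add: ennreal_mult' nn_integral_cmult)
  also have "\<dots> \<le> (\<integral>\<^sup>+y. \<integral>\<^sup>+z. ennreal (\<phi> z) \<partial>p n y \<partial>p 1 x)"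
    by (rule nn_integral_mono) (use Suc.IH kernel_space[OF Suc.prems] in auto)
  also have "\<dots> = (\<integral>\<^sup>+y. ennreal (\<phi> y) \<partial>p (1 + n) x)"
    by (rule nn_semigroup[symmetric]) (use Suc.prems in auto)
  finally show ?case by simp
qed (use \<phi> nn_init in simp)

end

text \<open>The setting of Harris' theorem with the drift condition phrased relative to a set \<open>K\<close> that is small
  for the time \<open>n1\<close>, instead of a level set of \<open>V\<close>.  In the aperiodicity condition the time from
  which returns to \<open>K\<close> are possible may depend on the starting point.
  The minorizing measure \<open>\<rho>\<close> carries the constant and is not normalised.\<close>

locale harris_chain = kernel_semigroup N \<kappa>
  for N :: "'s measure" and \<kappa> :: "nat \<Rightarrow> 's \<Rightarrow> 's measure" +
  fixes V :: "'s \<Rightarrow> real" and \<gamma> b v :: real and K :: "'s set" and n1 :: nat and \<rho> \<pi> :: "'s measure"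
  assumes kernel_prob: "x \<in> space N \<Longrightarrow> prob_space (\<kappa> n x)"
    and V_meas[measurable]: "V \<in> borel_measurable N" and V_ge: "0 < v" "x \<in> space N \<Longrightarrow> v \<le> V x"
    and rate: "0 \<le> \<gamma>" "\<gamma> < 1" "0 < b"
    and drift: "x \<in> space N \<Longrightarrow> (\<integral>\<^sup>+y. ennreal (V y) \<partial>\<kappa> 1 x) \<le> ennreal (\<gamma> * V x + b * indicator K x)"
    and K_sets[measurable]: "K \<in> sets N"
    and \<rho>_sets: "sets \<rho> = sets N" and \<rho>_K: "0 < emeasure \<rho> K"
    and minorization: "x \<in> K \<Longrightarrow> A \<in> sets N \<Longrightarrow> emeasure \<rho> A \<le> emeasure (\<kappa> n1 x) A"
    and aperiodic: "x \<in> K \<Longrightarrow> \<exists>m. \<forall>n\<ge>m. 0 < emeasure (\<kappa> n x) K"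
    and \<pi>_prob: "prob_space \<pi>" and \<pi>_sets: "sets \<pi> = sets N"
    and \<pi>_inv: "\<pi> \<bind> \<kappa> n = \<pi>" and \<pi>_V: "(\<integral>\<^sup>+x. ennreal (V x) \<partial>\<pi>) < \<infinity>"
begin

lemma drift_step:
  assumes x: "x \<in> space N"
  shows "(\<integral>\<^sup>+y. ennreal (V y) \<partial>\<kappa> (Suc n) x)
     \<le> ennreal \<gamma> * (\<integral>\<^sup>+y. ennreal (V y) \<partial>\<kappa> n x) + ennreal (b * measure (\<kappa> n x) K)"
proof -
  interpret prob_space "\<kappa> n x" by (rule kernel_prob[OF x])
  note [measurable_cong] = kernel_sets[OF x]
  have "(\<integral>\<^sup>+y. ennreal (V y) \<partial>\<kappa> (Suc n) x) = (\<integral>\<^sup>+y. \<integral>\<^sup>+z. ennreal (V z) \<partial>\<kappa> 1 y \<partial>\<kappa> n x)"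
    using nn_semigroup[of "\<lambda>y. ennreal (V y)" x n 1] x by simp
  also have "\<dots> \<le> (\<integral>\<^sup>+y. ennreal \<gamma> * ennreal (V y) + ennreal b * indicator K y \<partial>\<kappa> n x)"
  proof (rule nn_integral_mono)
    fix y assume "y \<in> space (\<kappa> n x)"
    then have y: "y \<in> space N" using kernel_space[OF x] by simp
    have "ennreal (\<gamma> * V y + b * indicator K y) = ennreal \<gamma> * ennreal (V y) + ennreal b * indicator K y"
      using rate V_ge(1) V_ge(2)[OF y] by (auto simp: ennreal_mult ennreal_plus split: split_indicator)
    then show "(\<integral>\<^sup>+z. ennreal (V z) \<partial>\<kappa> 1 y) \<le> ennreal \<gamma> * ennreal (V y) + ennreal b * indicator K y"
      using drift[OF y] by simp
  qed
  also have "\<dots> = ennreal \<gamma> * (\<integral>\<^sup>+y. ennreal (V y) \<partial>\<kappa> n x) + ennreal b * emeasure (\<kappa> n x) K"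
    by (simp add: nn_integral_add nn_integral_cmult nn_integral_cmult_indicator)
  also have "ennreal b * emeasure (\<kappa> n x) K = ennreal (b * measure (\<kappa> n x) K)"
    using rate by (simp add: emeasure_eq_measure ennreal_mult)
  finally show ?thesis .
qed

lemma V_nonneg: "x \<in> space N \<Longrightarrow> 0 \<le> V x"
  using V_ge by force

lemma drift_step_real:
  assumes x: "x \<in> space N" and c: "0 \<le> c" "(\<integral>\<^sup>+y. ennreal (V y) \<partial>\<kappa> n x) \<le> ennreal c"
  shows "(\<integral>\<^sup>+y. ennreal (V y) \<partial>\<kappa> (Suc n) x) \<le> ennreal (\<gamma> * c + b * measure (\<kappa> n x) K)"
proof -
  have "(\<integral>\<^sup>+y. ennreal (V y) \<partial>\<kappa> (Suc n) x) \<le> ennreal \<gamma> * ennreal c + ennreal (b * measure (\<kappa> n x) K)"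
    by (rule order_trans[OF drift_step[OF x]]) (intro add_right_mono mult_left_mono c, simp)
  also have "\<dots> = ennreal (\<gamma> * c + b * measure (\<kappa> n x) K)"
    using c rate by (simp add: ennreal_mult ennreal_plus)
  finally show ?thesis .
qed

lemma V_init: "x \<in> space N \<Longrightarrow> (\<integral>\<^sup>+y. ennreal (V y) \<partial>\<kappa> 0 x) = ennreal (V x)"
  by (simp add: init nn_integral_return)

text \<open>Keeping the visits to \<open>K\<close> in the iterated drift inequality, instead of bounding their number by the
  elapsed time, turns the lower bound of \<open>V\<close> into a lower bound on the expected number of visits.\<close>

lemma drift_occupation:
  assumes x: "x \<in> space N"
  shows "(\<integral>\<^sup>+y. ennreal (V y) \<partial>\<kappa> n x) \<le> ennreal (\<gamma> ^ n * V x + b * (\<Sum>k<n. measure (\<kappa> k x) K))"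
proof (induction n)
  case (Suc n)
  let ?s = "\<Sum>k<n. measure (\<kappa> k x) K"
  have s: "0 \<le> ?s" by (intro sum_nonneg) auto
  have "(\<integral>\<^sup>+y. ennreal (V y) \<partial>\<kappa> (Suc n) x) \<le> ennreal (\<gamma> * (\<gamma> ^ n * V x + b * ?s) + b * measure (\<kappa> n x) K)"
    by (rule drift_step_real[OF x _ Suc]) (use rate V_nonneg[OF x] s in auto)
  also have "\<dots> \<le> ennreal (\<gamma> ^ Suc n * V x + b * (\<Sum>k<Suc n. measure (\<kappa> k x) K))"
  proof (rule ennreal_leI)
    have "\<gamma> * (b * ?s) \<le> 1 * (b * ?s)" using rate s by (intro mult_right_mono) auto
    then show "\<gamma> * (\<gamma> ^ n * V x + b * ?s) + b * measure (\<kappa> n x) K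
        \<le> \<gamma> ^ Suc n * V x + b * (\<Sum>k<Suc n. measure (\<kappa> k x) K)"
      by (simp add: algebra_simps)
  qed
  finally show ?case .
qed (use x V_init in simp)

text \<open>The level around which the drift keeps the expectation of \<open>V\<close>; it is the fixed point of
  \<open>c \<mapsto> \<gamma> * c + b\<close>.\<close>

definition drift_const where "drift_const = b / (1 - \<gamma>)"

lemma drift_const_pos: "0 < drift_const" using rate by (simp add: drift_const_def)

lemma drift_iterate:
  assumes x: "x \<in> space N"
  shows "(\<integral>\<^sup>+y. ennreal (V y) \<partial>\<kappa> n x) \<le> ennreal (\<gamma> ^ n * V x + drift_const)"
proof (induction n)
  case 0
  then show ?case using V_init[OF x] drift_const_pos by (auto intro!: ennreal_leI)
next
  case (Suc n)
  interpret prob_space "\<kappa> n x" by (rule kernel_prob[OF x])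
  have "(\<integral>\<^sup>+y. ennreal (V y) \<partial>\<kappa> (Suc n) x) \<le> ennreal (\<gamma> * (\<gamma> ^ n * V x + drift_const) + b * measure (\<kappa> n x) K)"
    by (rule drift_step_real[OF x _ Suc]) (use rate V_nonneg[OF x] drift_const_pos in auto)
  also have "\<dots> \<le> ennreal (\<gamma> ^ Suc n * V x + drift_const)"
  proof (rule ennreal_leI)
    have "b * measure (\<kappa> n x) K \<le> b * 1" using rate by (intro mult_left_mono) auto
    moreover have "\<gamma> * drift_const + b = drift_const" using rate by (simp add: drift_const_def field_simps)
    ultimately show "\<gamma> * (\<gamma> ^ n * V x + drift_const) + b * measure (\<kappa> n x) K \<le> \<gamma> ^ Suc n * V x + drift_const"
      by (simp add: algebra_simps)
  qed
  finally show ?case .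
qed

text \<open>\<open>V\<close> is at least \<open>v\<close>, so its expectation cannot decay below \<open>v\<close>; once the initial value is forgotten, the
  missing half has to come from visits to \<open>K\<close>.\<close>

lemma occupation_lower:
  assumes x: "x \<in> space N" and n: "\<gamma> ^ n * V x \<le> v / 2"
  shows "v / (2 * b) \<le> (\<Sum>k<n. measure (\<kappa> k x) K)"
proof -
  interpret prob_space "\<kappa> n x" by (rule kernel_prob[OF x])
  let ?s = "\<Sum>k<n. measure (\<kappa> k x) K"
  have s: "0 \<le> ?s" by (intro sum_nonneg) auto
  have "ennreal v = (\<integral>\<^sup>+y. ennreal v \<partial>\<kappa> n x)" by (simp add: emeasure_space_1)
  also have "\<dots> \<le> (\<integral>\<^sup>+y. ennreal (V y) \<partial>\<kappa> n x)"
    by (rule nn_integral_mono) (use V_ge(2) kernel_space[OF x] in \<open>auto intro!: ennreal_leI\<close>)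
  also have "\<dots> \<le> ennreal (\<gamma> ^ n * V x + b * ?s)" by (rule drift_occupation[OF x])
  finally have "v \<le> \<gamma> ^ n * V x + b * ?s"
    using rate V_nonneg[OF x] s by (subst (asm) ennreal_le_iff) auto
  with n have "v / 2 \<le> b * ?s" by simp
  then show ?thesis using rate by (simp add: field_simps)
qed

lemma K_space: "x \<in> K \<Longrightarrow> x \<in> space N"
  using sets.sets_into_space[OF K_sets] by auto

lemma K_nonempty: "\<exists>x. x \<in> K"
  using \<rho>_K by (cases "K = {}") auto

lemma \<rho>_finite: "finite_measure \<rho>"
proof -
  obtain x where x: "x \<in> K" using K_nonempty by blast
  interpret prob_space "\<kappa> n1 x" by (rule kernel_prob[OF K_space[OF x]])
  have "emeasure \<rho> (space N) \<le> 1"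
    using minorization[OF x sets.top] emeasure_le_1 by (meson order_trans)
  then show ?thesis
    by (intro finite_measureI) (auto simp: sets_eq_imp_space_eq[OF \<rho>_sets] top_unique)
qed

text \<open>The thresholds of the aperiodicity condition depend on the point, but the points of \<open>K\<close> whose threshold
  is at most \<open>m\<close> exhaust \<open>K\<close>, hence have positive \<open>\<rho>\<close>-measure for some \<open>m\<close>.\<close>

lemma eventual_return:
  obtains m where "\<And>j. m \<le> j \<Longrightarrow> 0 < (\<integral>\<^sup>+y. emeasure (\<kappa> j y) K \<partial>\<rho>)"
proof -
  have em[measurable]: "(\<lambda>y. emeasure (\<kappa> j y) K) \<in> borel_measurable N" for j
    by (rule measurable_compose[OF kernel]) auto
  define G where "G m = {x\<in>K. \<forall>j\<in>{m..}. 0 < emeasure (\<kappa> j x) K}" for m :: nat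
  have G_eq: "G m = {x\<in>space N. x \<in> K \<and> (\<forall>j\<in>{m..}. 0 < emeasure (\<kappa> j x) K)}" for m
    unfolding G_def using K_space by blast
  have [measurable]: "G m \<in> sets N" for m
    unfolding G_eq by measurable
  have "(\<Union>m. G m) = K" using aperiodic unfolding G_def by fastforce
  then have "\<exists>m. emeasure \<rho> (G m) \<noteq> 0"
    using \<rho>_K emeasure_UN_eq_0[of \<rho> G] \<rho>_sets by fastforce
  then obtain m where m: "emeasure \<rho> (G m) \<noteq> 0" by blast
  show thesis
  proof (rule that)
    fix j assume j: "m \<le> j"
    show "0 < (\<integral>\<^sup>+y. emeasure (\<kappa> j y) K \<partial>\<rho>)"
    proof (rule ccontr)
      assume "\<not> ?thesis"
      then have "(\<integral>\<^sup>+y. emeasure (\<kappa> j y) K \<partial>\<rho>) = 0" by simp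
      then have "AE y in \<rho>. emeasure (\<kappa> j y) K = 0"
        using em[of j] by (subst (asm) nn_integral_0_iff_AE) (auto simp: measurable_cong_sets[OF \<rho>_sets refl])
      then have "AE y in \<rho>. y \<notin> G m"
        by eventually_elim (use j in \<open>auto simp: G_def\<close>)
      then have "G m \<in> null_sets \<rho>"
        using AE_iff_null_sets[of "G m" \<rho>] \<rho>_sets by simp
      with m show False by auto
    qed
  qed
qed

text \<open>A path of length \<open>n1 + j + n1\<close> that first regenerates, returns to \<open>K\<close> after \<open>j\<close> further steps and regenerates
  again.  The lower bound does not depend on the starting point in \<open>K\<close>.\<close>

lemma minorization_from_K:
  assumes x: "x \<in> K" and [measurable]: "A \<in> sets N"
  shows "(\<integral>\<^sup>+y. emeasure (\<kappa> j y) K \<partial>\<rho>) * emeasure \<rho> A \<le> emeasure (\<kappa> (n1 + j + n1) x) A"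
proof -
  note xs = K_space[OF x]
  have em: "(\<lambda>y. emeasure (\<kappa> j y) K) \<in> borel_measurable N" for j
    by (rule measurable_compose[OF kernel]) auto
  have "(\<integral>\<^sup>+y. emeasure (\<kappa> j y) K \<partial>\<rho>) \<le> (\<integral>\<^sup>+y. emeasure (\<kappa> j y) K \<partial>\<kappa> n1 x)"
    by (rule nn_integral_mono_measure)
       (use minorization[OF x] \<rho>_sets kernel_sets[OF xs] in \<open>auto simp: le_measure\<close>)
  also have "\<dots> = emeasure (\<kappa> (n1 + j) x) K"
    by (rule emeasure_semigroup[symmetric]) (use xs in auto)
  finally have "(\<integral>\<^sup>+y. emeasure (\<kappa> j y) K \<partial>\<rho>) * emeasure \<rho> A \<le> emeasure (\<kappa> (n1 + j) x) K * emeasure \<rho> A"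
    by (rule mult_right_mono) simp
  also have "\<dots> = (\<integral>\<^sup>+y. emeasure \<rho> A * indicator K y \<partial>\<kappa> (n1 + j) x)"
    by (subst nn_integral_cmult_indicator) (use kernel_sets[OF xs] in \<open>auto simp: mult.commute\<close>)
  also have "\<dots> \<le> (\<integral>\<^sup>+y. emeasure (\<kappa> n1 y) A \<partial>\<kappa> (n1 + j) x)"
    by (rule nn_integral_mono) (auto simp: minorization split: split_indicator)
  also have "\<dots> = emeasure (\<kappa> (n1 + j + n1) x) A"
    by (rule emeasure_semigroup[symmetric]) (use xs in auto)
  finally show ?thesis .
qed

text \<open>Chains started from the level set visit \<open>K\<close> within a bounded time with probability bounded below.
  From a visit at time \<open>k\<close>, the remaining time to a common horizon \<open>l\<close> is long enough for
  the minorization from \<open>K\<close>, so that averaging over \<open>k\<close> gives one minorization at time \<open>l\<close>.\<close>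

lemma level_set_small:
  obtains \<epsilon> :: real and l :: nat where "0 < \<epsilon>" "0 < l"
    "\<And>x A. x \<in> space N \<Longrightarrow> V x \<le> r \<Longrightarrow> A \<in> sets N \<Longrightarrow> ennreal \<epsilon> * emeasure \<rho> A \<le> emeasure (\<kappa> l x) A"
proof -
  obtain m where m: "\<And>j. m \<le> j \<Longrightarrow> 0 < (\<integral>\<^sup>+y. emeasure (\<kappa> j y) K \<partial>\<rho>)" (is "\<And>j. _ \<Longrightarrow> 0 < ?w j")
    using eventual_return by blast
  have "(\<lambda>n. \<gamma> ^ n * \<bar>r\<bar>) \<longlonglongrightarrow> 0 * \<bar>r\<bar>"
    using rate by (intro tendsto_mult LIMSEQ_power_zero) auto
  then have "\<forall>\<^sub>F n in sequentially. \<gamma> ^ n * \<bar>r\<bar> < v / 2"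
    using V_ge(1) by (intro order_tendstoD(2)) auto
  then obtain n where n: "\<gamma> ^ n * \<bar>r\<bar> < v / 2" by (auto simp: eventually_sequentially)
  define l where "l = n + m + 2 * n1 + 1"
  \<comment> \<open>After a visit to \<open>K\<close> at time \<open>k < n\<close> and two regenerations, the time \<open>l - k - 2 * n1\<close> left lies in \<open>{m..m + n + 1}\<close>; \<open>w\<close> is the smallest of the return probabilities for these finitely many times.\<close>
  define w where "w = Min (?w ` {m..m + n + 1})"
  have w: "0 < w" "\<And>j. j \<in> {m..m + n + 1} \<Longrightarrow> w \<le> ?w j"
    unfolding w_def using m by (auto simp: Min_gr_iff)
  define w' where "w' = enn2real (min w 1)"
  have w': "0 < w'" "ennreal w' \<le> w"
  proof -
    have "min w 1 < \<top>" by (rule le_less_trans[of _ 1]) auto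
    then have "ennreal w' = min w 1" unfolding w'_def by simp
    moreover have "0 < min w 1" using w(1) by simp
    ultimately show "0 < w'" "ennreal w' \<le> w" by (simp_all flip: ennreal_less_zero_iff)
  qed
  define \<epsilon> where "\<epsilon> = w' * v / (2 * b) / real (Suc n)"
  show thesis
  proof (rule that)
    show "0 < \<epsilon>" using w' V_ge(1) rate by (simp add: \<epsilon>_def)
    show "0 < l" by (simp add: l_def)
    fix x A assume x: "x \<in> space N" and Vr: "V x \<le> r" and [measurable]: "A \<in> sets N"
    have step: "emeasure (\<kappa> k x) K * (ennreal w' * emeasure \<rho> A) \<le> emeasure (\<kappa> l x) A" if k: "k < n" for k
    proof -
      define j where "j = n + m + 1 - k"
      have l: "l = k + (n1 + j + n1)" and j: "j \<in> {m..m + n + 1}" using k by (auto simp: l_def j_def)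
      have "emeasure (\<kappa> k x) K * (ennreal w' * emeasure \<rho> A) = (\<integral>\<^sup>+y. ennreal w' * emeasure \<rho> A * indicator K y \<partial>\<kappa> k x)"
        by (subst nn_integral_cmult_indicator) (use kernel_sets[OF x] in \<open>auto simp: mult.commute\<close>)
      also have "\<dots> \<le> (\<integral>\<^sup>+y. emeasure (\<kappa> (n1 + j + n1) y) A \<partial>\<kappa> k x)"
      proof (rule nn_integral_mono)
        fix y
        have "ennreal w' * emeasure \<rho> A \<le> emeasure (\<kappa> (n1 + j + n1) y) A" if "y \<in> K"
          by (rule order_trans[OF mult_right_mono[OF order_trans[OF w'(2) w(2)[OF j]]] minorization_from_K[OF that]]) auto
        then show "ennreal w' * emeasure \<rho> A * indicator K y \<le> emeasure (\<kappa> (n1 + j + n1) y) A"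
          by (auto split: split_indicator)
      qed
      also have "\<dots> = emeasure (\<kappa> l x) A"
        unfolding l by (rule emeasure_semigroup[symmetric]) (use x in auto)
      finally show ?thesis .
    qed
    have "\<gamma> ^ n * V x \<le> \<gamma> ^ n * \<bar>r\<bar>" using rate Vr by (intro mult_left_mono) auto
    then have occ: "v / (2 * b) \<le> (\<Sum>k<n. measure (\<kappa> k x) K)"
      using n by (intro occupation_lower[OF x]) auto
    interpret \<rho>: finite_measure \<rho> by (rule \<rho>_finite)
    interpret l: prob_space "\<kappa> l x" by (rule kernel_prob[OF x])
    have "v / (2 * b) * (w' * measure \<rho> A) \<le> (\<Sum>k<n. measure (\<kappa> k x) K) * (w' * measure \<rho> A)"
      using occ w' by (intro mult_right_mono) auto
    also have "\<dots> = (\<Sum>k<n. measure (\<kappa> k x) K * (w' * measure \<rho> A))" by (rule sum_distrib_right)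
    also have "\<dots> \<le> (\<Sum>k<n. measure (\<kappa> l x) A)"
    proof (rule sum_mono)
      fix k assume "k \<in> {..<n}"
      interpret k: prob_space "\<kappa> k x" by (rule kernel_prob[OF x])
      show "measure (\<kappa> k x) K * (w' * measure \<rho> A) \<le> measure (\<kappa> l x) A"
        using step[of k] \<open>k \<in> {..<n}\<close> w'(1)
        by (simp add: k.emeasure_eq_measure l.emeasure_eq_measure \<rho>.emeasure_eq_measure ennreal_mult[symmetric])
    qed
    also have "\<dots> \<le> real (Suc n) * measure (\<kappa> l x) A"
      by (simp add: mult_right_mono)
    finally have "v / (2 * b) * (w' * measure \<rho> A) / real (Suc n) \<le> measure (\<kappa> l x) A"
      by (subst pos_divide_le_eq) (simp_all add: mult.commute del: of_nat_Suc)
    then have "\<epsilon> * measure \<rho> A \<le> measure (\<kappa> l x) A"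
      unfolding \<epsilon>_def by (simp add: mult_ac)
    then show "ennreal \<epsilon> * emeasure \<rho> A \<le> emeasure (\<kappa> l x) A"
      using \<open>0 < \<epsilon>\<close> by (simp add: l.emeasure_eq_measure \<rho>.emeasure_eq_measure ennreal_mult[symmetric])
  qed
qed


lemma V_integral:
  assumes x: "x \<in> space N"
  shows "integrable (\<kappa> n x) V" "(LINT y|\<kappa> n x. V y) \<le> \<gamma> ^ n * V x + drift_const"
proof -
  have ae: "AE y in \<kappa> n x. 0 \<le> V y" using V_nonneg kernel_space[OF x] by auto
  show i: "integrable (\<kappa> n x) V"
    by (rule integrableI_nonneg[OF _ ae])
       (use drift_iterate[OF x, of n] in \<open>auto simp: measurable_cong_sets[OF kernel_sets[OF x] refl] intro: le_less_trans\<close>)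
  have "ennreal (LINT y|\<kappa> n x. V y) \<le> ennreal (\<gamma> ^ n * V x + drift_const)"
    using drift_iterate[OF x, of n] nn_integral_eq_integral[OF i ae] by simp
  then show "(LINT y|\<kappa> n x. V y) \<le> \<gamma> ^ n * V x + drift_const"
    using V_nonneg[OF x] rate drift_const_pos by (subst (asm) ennreal_le_iff) auto
qed

lemma dominated_integral:
  assumes f: "f \<in> borel_measurable N" "\<And>y. y \<in> space N \<Longrightarrow> \<bar>f y\<bar> \<le> V y" and x: "x \<in> space N"
  shows "integrable (\<kappa> n x) f" "\<bar>LINT y|\<kappa> n x. f y\<bar> \<le> V x + drift_const"
proof -
  show i: "integrable (\<kappa> n x) f"
    by (rule Bochner_Integration.integrable_bound[OF V_integral(1)[OF x]])
       (use f kernel_space[OF x] V_nonneg in \<open>auto simp: measurable_cong_sets[OF kernel_sets[OF x] refl]\<close>)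
  have "\<bar>LINT y|\<kappa> n x. f y\<bar> \<le> (LINT y|\<kappa> n x. \<bar>f y\<bar>)" by (rule integral_abs_bound)
  also have "\<dots> \<le> (LINT y|\<kappa> n x. V y)"
    by (rule integral_mono_AE) (use i V_integral(1)[OF x] f kernel_space[OF x] in auto)
  also have "\<dots> \<le> \<gamma> ^ n * V x + drift_const" by (rule V_integral(2)[OF x])
  also have "\<dots> \<le> 1 * V x + drift_const"
    using rate V_nonneg[OF x] by (intro add_right_mono mult_right_mono) (auto intro: power_le_one)
  finally show "\<bar>LINT y|\<kappa> n x. f y\<bar> \<le> V x + drift_const" by simp
qed

lemma integral_meas:
  assumes f[measurable]: "f \<in> borel_measurable N"
  shows "(\<lambda>x. LINT y|\<kappa> n x. f y :: real) \<in> borel_measurable N"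
  by (rule measurable_compose[OF kernel integral_measurable_subprob_algebra]) fact

lemma abs_nn_bound:
  assumes f: "f \<in> borel_measurable N" "\<And>y. y \<in> space N \<Longrightarrow> \<bar>f y\<bar> \<le> V y" and x: "x \<in> space N"
  shows "(\<integral>\<^sup>+y. ennreal \<bar>f y\<bar> \<partial>\<kappa> n x) \<le> ennreal (V x) + ennreal drift_const"
proof -
  have "(\<integral>\<^sup>+y. ennreal \<bar>f y\<bar> \<partial>\<kappa> n x) \<le> (\<integral>\<^sup>+y. ennreal (V y) \<partial>\<kappa> n x)"
    by (rule nn_integral_mono) (use f kernel_space[OF x] in \<open>auto intro!: ennreal_leI\<close>)
  also have "\<dots> \<le> ennreal (\<gamma> ^ n * V x + drift_const)" by (rule drift_iterate[OF x])
  also have "\<dots> \<le> ennreal (1 * V x + drift_const)"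
    using rate V_nonneg[OF x] by (intro ennreal_leI add_right_mono mult_right_mono) (auto intro: power_le_one)
  finally show ?thesis using V_nonneg[OF x] drift_const_pos by (simp add: ennreal_plus)
qed

lemma integral_semigroup:
  assumes f: "f \<in> borel_measurable N" "\<And>y. y \<in> space N \<Longrightarrow> \<bar>f y\<bar> \<le> V y" and x: "x \<in> space N"
  shows "(LINT y|\<kappa> (m + n) x. f y) = (LINT y|\<kappa> m x. LINT z|\<kappa> n y. f z)"
  unfolding semigroup[OF x]
proof (rule integral_bind_kernel(3)[where N=N])
  interpret prob_space "\<kappa> m x" by (rule kernel_prob[OF x])
  note [measurable_cong] = kernel_sets[OF x]
  show "\<kappa> n \<in> \<kappa> m x \<rightarrow>\<^sub>M subprob_algebra N"
    using kernel by (simp add: measurable_cong_sets[OF kernel_sets[OF x] refl])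
  show "integrable (\<kappa> n y) f" if "y \<in> space (\<kappa> m x)" for y
    using dominated_integral(1)[OF f, of y n] that kernel_space[OF x] by simp
  have "(\<integral>\<^sup>+y. \<integral>\<^sup>+z. ennreal \<bar>f z\<bar> \<partial>\<kappa> n y \<partial>\<kappa> m x) \<le> (\<integral>\<^sup>+y. ennreal (V y) + ennreal drift_const \<partial>\<kappa> m x)"
    by (rule nn_integral_mono) (use abs_nn_bound[OF f] kernel_space[OF x] in auto)
  also have "\<dots> = (\<integral>\<^sup>+y. ennreal (V y) \<partial>\<kappa> m x) + ennreal drift_const"
    by (simp add: nn_integral_add emeasure_space_1)
  also have "\<dots> < \<infinity>"
    using drift_iterate[OF x, of m] by (auto intro: le_less_trans simp: ennreal_add_eq_top less_top[symmetric] top_unique)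
  finally show "(\<integral>\<^sup>+y. \<integral>\<^sup>+z. ennreal \<bar>f z\<bar> \<partial>\<kappa> n y \<partial>\<kappa> m x) < \<infinity>" .
qed (use f in auto)

text \<open>The contraction applies to the iterate of order \<open>l\<close>, for which the level set \<open>{V \<le> r}\<close> is small; the level
  \<open>r\<close> is fixed before \<open>l\<close> which is possible because one drift inequality holds for all iterates.
  Times that are not multiples of \<open>l\<close> cost a constant factor.\<close>

lemma oscillation_decay:
  obtains C a where "0 < C" "0 < a" "a < 1"
    "\<And>f n x y. f \<in> borel_measurable N \<Longrightarrow> (\<And>y. y \<in> space N \<Longrightarrow> \<bar>f y\<bar> \<le> V y) \<Longrightarrow>
      x \<in> space N \<Longrightarrow> y \<in> space N \<Longrightarrow>
      \<bar>(LINT z|\<kappa> n x. f z) - (LINT z|\<kappa> n y. f z)\<bar> \<le> C * a ^ n * (2 + V x + V y)"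
proof -
  define r where "r = (2 * drift_const + 1) / (1 - \<gamma>)"
  obtain \<epsilon> l where l: "0 < \<epsilon>" "0 < l"
    "\<And>x A. x \<in> space N \<Longrightarrow> V x \<le> r \<Longrightarrow> A \<in> sets N \<Longrightarrow> ennreal \<epsilon> * emeasure \<rho> A \<le> emeasure (\<kappa> l x) A"
    using level_set_small[of r] by blast
  interpret \<rho>: finite_measure \<rho> by (rule \<rho>_finite)
  define \<rho>' where "\<rho>' = scale_measure (ennreal \<epsilon>) \<rho>"
  obtain \<delta> \<alpha> where \<delta>: "0 < \<delta>" and \<alpha>: "0 < \<alpha>" "\<alpha> < 1" and contr:
    "\<And>f L x y. f \<in> borel_measurable N \<Longrightarrow> 0 \<le> L \<Longrightarrow>
      (\<And>x y. x \<in> space N \<Longrightarrow> y \<in> space N \<Longrightarrow> \<bar>f x - f y\<bar> \<le> L * (2 + \<delta> * V x + \<delta> * V y)) \<Longrightarrow>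
      x \<in> space N \<Longrightarrow> y \<in> space N \<Longrightarrow>
        \<bar>(LINT z|\<kappa> l x. f z) - (LINT z|\<kappa> l y. f z)\<bar> \<le> \<alpha> * L * (2 + \<delta> * V x + \<delta> * V y)"
  proof (rule contraction_step[where N=N and R="\<kappa> l" and V=V and \<gamma>=\<gamma> and b=drift_const and r=r and \<rho>=\<rho>'])
    fix x assume x: "x \<in> space N"
    have "\<gamma> ^ l * V x + drift_const \<le> \<gamma> ^ 1 * V x + drift_const"
      using rate V_nonneg[OF x] l(2) by (intro add_right_mono mult_right_mono power_decreasing) auto
    then show "(\<integral>\<^sup>+y. ennreal (V y) \<partial>\<kappa> l x) \<le> ennreal (\<gamma> * V x + drift_const)"
      by (intro order_trans[OF drift_iterate[OF x, of l] ennreal_leI]) simp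
  next
    show "2 * drift_const < (1 - \<gamma>) * r" using rate by (simp add: r_def)
    show "finite_measure \<rho>'"
      by (rule finite_measureI) (auto simp: \<rho>'_def ennreal_mult_eq_top_iff space_scale_measure)
    have "emeasure \<rho> K \<le> emeasure \<rho> (space N)"
      using \<rho>_sets by (intro emeasure_mono K_sets[THEN sets.sets_into_space]) auto
    then have "0 < measure \<rho> (space N)"
      using \<rho>_K by (simp add: \<rho>.emeasure_eq_measure)
    then show "0 < measure \<rho>' (space N)" using l(1) by (simp add: \<rho>'_def)
    show "sets \<rho>' = sets N" by (simp add: \<rho>'_def \<rho>_sets)
    show "emeasure \<rho>' A \<le> emeasure (\<kappa> l x) A" if "x \<in> space N" "V x \<le> r" "A \<in> sets N" for x A
      using l(3)[OF that] by (simp add: \<rho>'_def)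
  next
    fix \<delta> \<alpha> :: real
    assume d: "0 < \<delta>" "0 < \<alpha>" "\<alpha> < 1" and contr: "\<And>f L. f \<in> borel_measurable N \<Longrightarrow> 0 \<le> L \<Longrightarrow>
      (\<And>x y. x \<in> space N \<Longrightarrow> y \<in> space N \<Longrightarrow> \<bar>f x - f y\<bar> \<le> L * (2 + \<delta> * V x + \<delta> * V y)) \<Longrightarrow>
      (\<forall>x\<in>space N. \<forall>y\<in>space N.
        \<bar>(LINT z|\<kappa> l x. f z) - (LINT z|\<kappa> l y. f z)\<bar> \<le> \<alpha> * L * (2 + \<delta> * V x + \<delta> * V y))"
    show thesis
      by (rule that[OF d]) (rule contr[THEN bspec, THEN bspec])
  qed (use kernel_prob kernel_sets V_nonneg rate drift_const_pos V_meas in simp_all)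
  \<comment> \<open>With this constant the bound \<open>V x + V y + 2 * drift_const\<close>, valid at all times, is at most \<open>L * (2 + \<delta> * V x + \<delta> * V y)\<close>.\<close>
  define L where "L = 1 / \<delta> + drift_const"
  have L: "0 < L" using \<delta> drift_const_pos by (simp add: L_def add_pos_pos)
  have osc: "\<bar>(LINT z|\<kappa> n x. f z) - (LINT z|\<kappa> n y. f z)\<bar> \<le> \<alpha> ^ (n div l) * L * (2 + \<delta> * V x + \<delta> * V y)"
    if f: "f \<in> borel_measurable N" "\<And>y. y \<in> space N \<Longrightarrow> \<bar>f y\<bar> \<le> V y" and xy: "x \<in> space N" "y \<in> space N"
    for f n x y
    using xy
  proof (induction n arbitrary: x y rule: less_induct)
    case (less n)
    show ?case
    proof (cases "n < l")
      case True
      have "\<bar>(LINT z|\<kappa> n x. f z) - (LINT z|\<kappa> n y. f z)\<bar> \<le> (V x + drift_const) + (V y + drift_const)"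
        using dominated_integral(2)[OF f less.prems(1), of n] dominated_integral(2)[OF f less.prems(2), of n] by simp
      also have "\<dots> \<le> L * (2 + \<delta> * V x + \<delta> * V y)"
      proof -
        have "L * (2 + \<delta> * V x + \<delta> * V y) = 2 / \<delta> + V x + V y + 2 * drift_const + drift_const * (\<delta> * V x + \<delta> * V y)"
          using \<delta> by (simp add: L_def field_simps)
        moreover have "0 \<le> drift_const * (\<delta> * V x + \<delta> * V y)" "0 \<le> 2 / \<delta>"
          using \<delta> drift_const_pos V_nonneg[OF less.prems(1)] V_nonneg[OF less.prems(2)] by auto
        ultimately show ?thesis by simp
      qed
      finally show ?thesis using True by simp
    next
      case False
      define j where "j = n - l"
      have n: "n = l + j" "j < n" using False l(2) by (auto simp: j_def)
      have d: "n div l = Suc (j div l)" using l(2) unfolding n(1) by simp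
      have "\<bar>(LINT z|\<kappa> l x. LINT w|\<kappa> j z. f w) - (LINT z|\<kappa> l y. LINT w|\<kappa> j z. f w)\<bar>
          \<le> \<alpha> * (\<alpha> ^ (j div l) * L) * (2 + \<delta> * V x + \<delta> * V y)"
        by (rule contr) (use integral_meas[OF f(1)] less.IH[OF n(2)] \<alpha> L less.prems in auto)
      then show ?thesis
        using integral_semigroup[OF f less.prems(1), of l j] integral_semigroup[OF f less.prems(2), of l j] d n(1)
        by (simp add: mult.assoc)
    qed
  qed
  define a where "a = root l \<alpha>"
  have a: "0 < a" "a < 1" "a ^ l = \<alpha>" using \<alpha> l(2) by (auto simp: a_def)
  define C where "C = (1 + \<delta>) * L / \<alpha>"
  show thesis
  proof (rule that)
    show "0 < C" "0 < a" "a < 1" using a \<alpha> L \<delta> by (auto simp: C_def)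
    fix f n x y assume f: "f \<in> borel_measurable N" "\<And>y. y \<in> space N \<Longrightarrow> \<bar>f y\<bar> \<le> V y"
      and x: "x \<in> space N" and y: "y \<in> space N"
    have "\<alpha> ^ (n div l) * \<alpha> = a ^ (l * (n div l) + l)"
      by (simp add: power_add power_mult a(3))
    also have "\<dots> \<le> a ^ n"
    proof (rule power_decreasing)
      show "n \<le> l * (n div l) + l"
        using mult_div_mod_eq[of l n] mod_less_divisor[OF l(2), of n] by linarith
    qed (use a in auto)
    finally have p: "\<alpha> ^ (n div l) \<le> a ^ n / \<alpha>" using \<alpha> by (simp add: field_simps)
    have V: "0 \<le> V x" "0 \<le> V y" using V_nonneg x y by auto
    have w: "2 + \<delta> * V x + \<delta> * V y \<le> (1 + \<delta>) * (2 + V x + V y)"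
      using V \<delta> by (simp add: algebra_simps)
    have "\<bar>(LINT z|\<kappa> n x. f z) - (LINT z|\<kappa> n y. f z)\<bar> \<le> \<alpha> ^ (n div l) * L * (2 + \<delta> * V x + \<delta> * V y)"
      by (rule osc[OF f x y])
    also have "\<dots> \<le> (a ^ n / \<alpha>) * L * ((1 + \<delta>) * (2 + V x + V y))"
      using p w L V \<delta> \<alpha> a by (intro mult_mono) auto
    also have "\<dots> = C * a ^ n * (2 + V x + V y)" by (simp add: C_def)
    finally show "\<bar>(LINT z|\<kappa> n x. f z) - (LINT z|\<kappa> n y. f z)\<bar> \<le> C * a ^ n * (2 + V x + V y)" .
  qed
qed

lemma \<pi>_dominated:
  assumes f: "f \<in> borel_measurable N" "\<And>y. y \<in> space N \<Longrightarrow> \<bar>f y\<bar> \<le> c + d * V y" and cd: "0 \<le> c" "0 \<le> d"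
  shows "integrable \<pi> f"
proof -
  interpret prob_space \<pi> by (rule \<pi>_prob)
  have sp: "space \<pi> = space N" by (rule sets_eq_imp_space_eq[OF \<pi>_sets])
  have "integrable \<pi> V"
    by (rule integrableI_nonneg) (use \<pi>_V V_nonneg sp in \<open>auto simp: measurable_cong_sets[OF \<pi>_sets refl]\<close>)
  then have i: "integrable \<pi> (\<lambda>y. c + d * V y)" by auto
  have *: "\<bar>f y\<bar> \<le> \<bar>c + d * V y\<bar>" if "y \<in> space N" for y using f(2)[OF that] by simp
  show ?thesis
    by (rule Bochner_Integration.integrable_bound[OF i])
       (use f * sp in \<open>auto simp: measurable_cong_sets[OF \<pi>_sets refl]\<close>)
qed

lemma \<pi>_invariant_integral:
  assumes f: "f \<in> borel_measurable N" "\<And>y. y \<in> space N \<Longrightarrow> \<bar>f y\<bar> \<le> V y"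
  shows "(LINT y|\<pi>. LINT z|\<kappa> n y. f z) = (LINT y|\<pi>. f y)"
proof -
  interpret prob_space \<pi> by (rule \<pi>_prob)
  have sp: "space \<pi> = space N" by (rule sets_eq_imp_space_eq[OF \<pi>_sets])
  note [measurable_cong] = \<pi>_sets
  have "(LINT y|(\<pi> \<bind> \<kappa> n). f y) = (LINT y|\<pi>. LINT z|\<kappa> n y. f z)"
  proof (rule integral_bind_kernel(3)[where N=N])
    show "\<kappa> n \<in> \<pi> \<rightarrow>\<^sub>M subprob_algebra N"
      using kernel by (simp add: measurable_cong_sets[OF \<pi>_sets refl])
    show "integrable (\<kappa> n y) f" if "y \<in> space \<pi>" for y
      using dominated_integral(1)[OF f, of y n] that sp by simp
    have "(\<integral>\<^sup>+y. \<integral>\<^sup>+z. ennreal \<bar>f z\<bar> \<partial>\<kappa> n y \<partial>\<pi>) \<le> (\<integral>\<^sup>+y. ennreal (V y) + ennreal drift_const \<partial>\<pi>)"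
      by (rule nn_integral_mono) (use abs_nn_bound[OF f] sp in auto)
    also have "\<dots> = (\<integral>\<^sup>+y. ennreal (V y) \<partial>\<pi>) + ennreal drift_const"
      by (simp add: nn_integral_add emeasure_space_1)
    also have "\<dots> < \<infinity>" using \<pi>_V by (simp add: ennreal_add_eq_top less_top[symmetric])
    finally show "(\<integral>\<^sup>+y. \<integral>\<^sup>+z. ennreal \<bar>f z\<bar> \<partial>\<kappa> n y \<partial>\<pi>) < \<infinity>" .
  qed (use f in auto)
  then show ?thesis by (simp add: \<pi>_inv)
qed

text \<open>Averaging the oscillation bound over the second point with respect to the invariant distribution replaces
  the second transition law by \<open>\<pi>\<close>.\<close>

theorem geometric_ergodicity:
  obtains C a where "0 < C" "0 < a" "a < 1"
    "\<And>f n x. f \<in> borel_measurable N \<Longrightarrow> (\<And>y. y \<in> space N \<Longrightarrow> \<bar>f y\<bar> \<le> V y) \<Longrightarrow> x \<in> space N \<Longrightarrow>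
      \<bar>(LINT z|\<kappa> n x. f z) - (LINT z|\<pi>. f z)\<bar> \<le> C * a ^ n * V x"
proof -
  obtain C a where C: "0 < C" "0 < a" "a < 1" and osc:
    "\<And>f n x y. f \<in> borel_measurable N \<Longrightarrow> (\<And>y. y \<in> space N \<Longrightarrow> \<bar>f y\<bar> \<le> V y) \<Longrightarrow>
      x \<in> space N \<Longrightarrow> y \<in> space N \<Longrightarrow>
      \<bar>(LINT z|\<kappa> n x. f z) - (LINT z|\<kappa> n y. f z)\<bar> \<le> C * a ^ n * (2 + V x + V y)"
    using oscillation_decay by blast
  interpret prob_space \<pi> by (rule \<pi>_prob)
  have sp: "space \<pi> = space N" by (rule sets_eq_imp_space_eq[OF \<pi>_sets])
  define m where "m = (LINT y|\<pi>. V y)"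
  have Vi: "integrable \<pi> V" by (rule \<pi>_dominated[where c=0 and d=1]) (use V_nonneg in auto)
  have m: "0 \<le> m" unfolding m_def by (rule integral_nonneg_AE) (use V_nonneg sp in auto)
  define C' where "C' = C * ((2 + m) / v + 1)"
  show thesis
  proof (rule that)
    show "0 < C'" "0 < a" "a < 1" using C m V_ge(1) by (auto simp: C'_def intro!: mult_pos_pos add_nonneg_pos)
    fix f n x assume f: "f \<in> borel_measurable N" "\<And>y. y \<in> space N \<Longrightarrow> \<bar>f y\<bar> \<le> V y" and x: "x \<in> space N"
    let ?g = "\<lambda>y. LINT z|\<kappa> n y. f z"
    have gi: "integrable \<pi> ?g"
      by (rule \<pi>_dominated[where c=drift_const and d=1])
         (use integral_meas[OF f(1)] dominated_integral(2)[OF f] drift_const_pos in \<open>auto simp: add.commute\<close>)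
    have "\<bar>?g x - (LINT z|\<pi>. f z)\<bar> = \<bar>LINT y|\<pi>. ?g x - ?g y\<bar>"
      using gi \<pi>_invariant_integral[OF f, of n] by (simp add: prob_space)
    also have "\<dots> \<le> (LINT y|\<pi>. \<bar>?g x - ?g y\<bar>)" by (rule integral_abs_bound)
    also have "\<dots> \<le> (LINT y|\<pi>. C * a ^ n * (2 + V x + V y))"
      by (rule integral_mono_AE) (use gi Vi osc[OF f x] sp in auto)
    also have "\<dots> = C * a ^ n * (2 + V x + m)" using Vi by (simp add: prob_space m_def)
    also have "\<dots> \<le> C * a ^ n * (((2 + m) / v + 1) * V x)"
    proof (intro mult_left_mono)
      have "(2 + m) / v * v \<le> (2 + m) / v * V x" using V_ge m x by (intro mult_left_mono) auto
      moreover have "(2 + m) / v * v = 2 + m" using V_ge(1) by simp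
      ultimately show "2 + V x + m \<le> ((2 + m) / v + 1) * V x" by (simp only: distrib_right)
    qed (use C in auto)
    also have "\<dots> = C' * a ^ n * V x" by (simp add: C'_def)
    finally show "\<bar>?g x - (LINT z|\<pi>. f z)\<bar> \<le> C' * a ^ n * V x" .
  qed
qed

text \<open>Convergence from an initial law is controlled by the average over that law of the pointwise distances.\<close>

lemma bind_distance:
  assumes \<mu>: "distribution_on N \<mu>" and f: "f \<in> borel_measurable N"
    and int: "\<And>x. x \<in> space N \<Longrightarrow> integrable (\<kappa> n x) f"
    and fin: "(\<integral>\<^sup>+x. \<integral>\<^sup>+y. ennreal \<bar>f y\<bar> \<partial>\<kappa> n x \<partial>\<mu>) < \<infinity>"
  shows "ennreal \<bar>(LINT y|(\<mu> \<bind> \<kappa> n). f y) - c\<bar>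
    \<le> (\<integral>\<^sup>+x. ennreal \<bar>(LINT y|\<kappa> n x. f y) - c\<bar> \<partial>\<mu>)"
proof -
  interpret prob_space \<mu> using \<mu> by (simp add: distribution_on_def)
  have s: "sets \<mu> = sets N" using \<mu> by (simp add: distribution_on_def)
  have sp: "space \<mu> = space N" by (rule sets_eq_imp_space_eq[OF s])
  have k: "\<kappa> n \<in> \<mu> \<rightarrow>\<^sub>M subprob_algebra N"
    using kernel by (simp add: measurable_cong_sets[OF s refl])
  have i: "integrable \<mu> (\<lambda>x. LINT y|\<kappa> n x. f y)"
    and e: "(LINT y|(\<mu> \<bind> \<kappa> n). f y) = (LINT x|\<mu>. LINT y|\<kappa> n x. f y)"
    by (rule integral_bind_kernel[OF k f fin]; use int sp in simp)+
  have "\<bar>(LINT y|(\<mu> \<bind> \<kappa> n). f y) - c\<bar> = \<bar>LINT x|\<mu>. (LINT y|\<kappa> n x. f y) - c\<bar>"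
    unfolding e using i by (simp add: prob_space)
  also have "ennreal \<dots> \<le> (\<integral>\<^sup>+x. ennreal \<bar>(LINT y|\<kappa> n x. f y) - c\<bar> \<partial>\<mu>)"
    using integral_norm_bound_ennreal[of \<mu> "\<lambda>x. (LINT y|\<kappa> n x. f y) - c"] i by simp
  finally show ?thesis .
qed

lemma weighted_convergence:
  obtains C a where "0 < C" "0 < a" "a < 1"
    "\<And>\<mu> n. distribution_on N \<mu> \<Longrightarrow> (\<integral>\<^sup>+x. ennreal (V x) \<partial>\<mu>) < \<infinity> \<Longrightarrow>
      weighted_TV N V (\<mu> \<bind> \<kappa> n) \<pi> \<le> ennreal (C * a ^ n) * (\<integral>\<^sup>+x. ennreal (V x) \<partial>\<mu>)"
proof -
  obtain C a where C: "0 < C" "0 < a" "a < 1" and erg: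
    "\<And>f n x. f \<in> borel_measurable N \<Longrightarrow> (\<And>y. y \<in> space N \<Longrightarrow> \<bar>f y\<bar> \<le> V y) \<Longrightarrow> x \<in> space N \<Longrightarrow>
      \<bar>(LINT z|\<kappa> n x. f z) - (LINT z|\<pi>. f z)\<bar> \<le> C * a ^ n * V x"
    using geometric_ergodicity by blast
  show thesis
  proof (rule that[OF C])
    fix \<mu> n assume \<mu>: "distribution_on N \<mu>" and V: "(\<integral>\<^sup>+x. ennreal (V x) \<partial>\<mu>) < \<infinity>"
    interpret prob_space \<mu> using \<mu> by (simp add: distribution_on_def)
    have s[measurable_cong]: "sets \<mu> = sets N" using \<mu> by (simp add: distribution_on_def)
    have sp: "space \<mu> = space N" by (rule sets_eq_imp_space_eq[OF s])
    show "weighted_TV N V (\<mu> \<bind> \<kappa> n) \<pi> \<le> ennreal (C * a ^ n) * (\<integral>\<^sup>+x. ennreal (V x) \<partial>\<mu>)"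
      unfolding weighted_TV_def
    proof (rule SUP_least, elim CollectE conjE)
      fix f assume fm: "f \<in> borel_measurable N" and fV: "\<forall>x\<in>space N. \<bar>f x\<bar> \<le> V x"
      have f: "\<And>y. y \<in> space N \<Longrightarrow> \<bar>f y\<bar> \<le> V y" using fV by auto
      have "(\<integral>\<^sup>+x. \<integral>\<^sup>+y. ennreal \<bar>f y\<bar> \<partial>\<kappa> n x \<partial>\<mu>) \<le> (\<integral>\<^sup>+x. ennreal (V x) + ennreal drift_const \<partial>\<mu>)"
        by (rule nn_integral_mono) (use abs_nn_bound[OF fm f] sp in auto)
      also have "\<dots> = (\<integral>\<^sup>+x. ennreal (V x) \<partial>\<mu>) + ennreal drift_const"
        by (simp add: nn_integral_add emeasure_space_1)
      also have "\<dots> < \<infinity>" using V by (simp add: ennreal_add_eq_top less_top[symmetric])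
      finally have fin: "(\<integral>\<^sup>+x. \<integral>\<^sup>+y. ennreal \<bar>f y\<bar> \<partial>\<kappa> n x \<partial>\<mu>) < \<infinity>" .
      have "ennreal \<bar>(LINT y|(\<mu> \<bind> \<kappa> n). f y) - (LINT y|\<pi>. f y)\<bar>
          \<le> (\<integral>\<^sup>+x. ennreal \<bar>(LINT y|\<kappa> n x. f y) - (LINT y|\<pi>. f y)\<bar> \<partial>\<mu>)"
        by (rule bind_distance[OF \<mu> fm dominated_integral(1)[OF fm f] fin])
      also have "\<dots> \<le> (\<integral>\<^sup>+x. ennreal (C * a ^ n) * ennreal (V x) \<partial>\<mu>)"
        by (rule nn_integral_mono)
           (use erg[OF fm f] sp C V_nonneg in \<open>auto simp: ennreal_mult[symmetric] intro!: ennreal_leI\<close>)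
      also have "\<dots> = ennreal (C * a ^ n) * (\<integral>\<^sup>+x. ennreal (V x) \<partial>\<mu>)"
        by (rule nn_integral_cmult) measurable
      finally show "ennreal \<bar>(LINT y|(\<mu> \<bind> \<kappa> n). f y) - (LINT y|\<pi>. f y)\<bar>
          \<le> ennreal (C * a ^ n) * (\<integral>\<^sup>+x. ennreal (V x) \<partial>\<mu>)" .
    qed
  qed
qed

text \<open>The pointwise distances are bounded by two and tend to zero at every point, so their average tends to zero
  even if \<open>V\<close> is not integrable.\<close>

lemma total_variation_convergence:
  assumes \<mu>: "distribution_on N \<mu>"
  shows "(\<lambda>n. weighted_TV N (\<lambda>_. 1) (\<mu> \<bind> \<kappa> n) \<pi>) \<longlonglongrightarrow> 0"
proof -
  obtain C a where C: "0 < C" "0 < a" "a < 1" and erg: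
    "\<And>f n x. f \<in> borel_measurable N \<Longrightarrow> (\<And>y. y \<in> space N \<Longrightarrow> \<bar>f y\<bar> \<le> V y) \<Longrightarrow> x \<in> space N \<Longrightarrow>
      \<bar>(LINT z|\<kappa> n x. f z) - (LINT z|\<pi>. f z)\<bar> \<le> C * a ^ n * V x"
    using geometric_ergodicity by blast
  interpret prob_space \<mu> using \<mu> by (simp add: distribution_on_def)
  have s[measurable_cong]: "sets \<mu> = sets N" using \<mu> by (simp add: distribution_on_def)
  have sp: "space \<mu> = space N" by (rule sets_eq_imp_space_eq[OF s])
  interpret \<pi>: prob_space \<pi> by (rule \<pi>_prob)
  have sp\<pi>: "space \<pi> = space N" by (rule sets_eq_imp_space_eq[OF \<pi>_sets])
  define G where "G n x = min 2 (C * a ^ n * V x / v)" for n x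
  have "(\<lambda>n. \<integral>\<^sup>+x. ennreal (G n x) \<partial>\<mu>) \<longlonglongrightarrow> (\<integral>\<^sup>+x. 0 \<partial>\<mu>)"
  proof (rule nn_integral_dominated_convergence[where w="\<lambda>_. 2"])
    show "(\<lambda>x. ennreal (G n x)) \<in> borel_measurable \<mu>" for n unfolding G_def by measurable
    show "(\<integral>\<^sup>+x. 2 \<partial>\<mu>) < \<infinity>" by (simp add: emeasure_space_1)
    show "AE x in \<mu>. ennreal (G n x) \<le> 2" for n
    proof (rule AE_I2)
      fix x
      have "ennreal (G n x) \<le> ennreal 2" unfolding G_def by (rule ennreal_leI) simp
      then show "ennreal (G n x) \<le> 2" by simp
    qed
    show "AE x in \<mu>. (\<lambda>n. ennreal (G n x)) \<longlonglongrightarrow> 0"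
    proof (rule AE_I2)
      fix x
      have "(\<lambda>n. min 2 (C * a ^ n * V x / v)) \<longlonglongrightarrow> min 2 (C * 0 * V x / v)"
        using C V_ge(1) by (intro tendsto_intros LIMSEQ_power_zero) auto
      then have "(\<lambda>n. ennreal (G n x)) \<longlonglongrightarrow> ennreal 0"
        unfolding G_def by (intro tendsto_ennrealI) simp
      then show "(\<lambda>n. ennreal (G n x)) \<longlonglongrightarrow> 0" by simp
    qed
  qed auto
  then have lim: "(\<lambda>n. \<integral>\<^sup>+x. ennreal (G n x) \<partial>\<mu>) \<longlonglongrightarrow> 0" by simp
  have bound: "weighted_TV N (\<lambda>_. 1) (\<mu> \<bind> \<kappa> n) \<pi> \<le> (\<integral>\<^sup>+x. ennreal (G n x) \<partial>\<mu>)" for n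
    unfolding weighted_TV_def
  proof (rule SUP_least, elim CollectE conjE)
    fix f :: "'s \<Rightarrow> real" assume fm: "f \<in> borel_measurable N" and f1: "\<forall>x\<in>space N. \<bar>f x\<bar> \<le> 1"
    have int: "integrable (\<kappa> n x) f" "\<bar>LINT y|\<kappa> n x. f y\<bar> \<le> 1" if x: "x \<in> space N" for x
    proof -
      interpret k: prob_space "\<kappa> n x" by (rule kernel_prob[OF x])
      show i: "integrable (\<kappa> n x) f"
        by (rule k.integrable_const_bound[where B=1])
           (use fm f1 kernel_space[OF x] in \<open>auto simp: measurable_cong_sets[OF kernel_sets[OF x] refl]\<close>)
      have "\<bar>LINT y|\<kappa> n x. f y\<bar> \<le> (LINT y|\<kappa> n x. \<bar>f y\<bar>)" by (rule integral_abs_bound)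
      also have "\<dots> \<le> (LINT y|\<kappa> n x. 1)"
        by (rule integral_mono_AE) (use i f1 kernel_space[OF x] in auto)
      finally show "\<bar>LINT y|\<kappa> n x. f y\<bar> \<le> 1" by (simp add: k.prob_space)
    qed
    have \<pi>1: "\<bar>LINT y|\<pi>. f y\<bar> \<le> 1"
    proof -
      have i: "integrable \<pi> f"
        by (rule \<pi>_dominated[where c=1 and d=0]) (use fm f1 in auto)
      have "\<bar>LINT y|\<pi>. f y\<bar> \<le> (LINT y|\<pi>. \<bar>f y\<bar>)" by (rule integral_abs_bound)
      also have "\<dots> \<le> (LINT y|\<pi>. 1)"
        by (rule integral_mono_AE) (use i f1 sp\<pi> in auto)
      finally show ?thesis by (simp add: \<pi>.prob_space)
    qed
    have fin: "(\<integral>\<^sup>+x. \<integral>\<^sup>+y. ennreal \<bar>f y\<bar> \<partial>\<kappa> n x \<partial>\<mu>) < \<infinity>"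
    proof -
      have "(\<integral>\<^sup>+x. \<integral>\<^sup>+y. ennreal \<bar>f y\<bar> \<partial>\<kappa> n x \<partial>\<mu>) \<le> (\<integral>\<^sup>+x. 1 \<partial>\<mu>)"
      proof (rule nn_integral_mono)
        fix x assume "x \<in> space \<mu>"
        then have x: "x \<in> space N" using sp by simp
        interpret k: prob_space "\<kappa> n x" by (rule kernel_prob[OF x])
        have "(\<integral>\<^sup>+y. ennreal \<bar>f y\<bar> \<partial>\<kappa> n x) \<le> (\<integral>\<^sup>+y. 1 \<partial>\<kappa> n x)"
          by (rule nn_integral_mono) (use f1 kernel_space[OF x] in auto)
        then show "(\<integral>\<^sup>+y. ennreal \<bar>f y\<bar> \<partial>\<kappa> n x) \<le> 1" by (simp add: k.emeasure_space_1)
      qed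
      then show ?thesis by (rule le_less_trans) (simp add: emeasure_space_1)
    qed
    have "ennreal \<bar>(LINT y|(\<mu> \<bind> \<kappa> n). f y) - (LINT y|\<pi>. f y)\<bar>
        \<le> (\<integral>\<^sup>+x. ennreal \<bar>(LINT y|\<kappa> n x. f y) - (LINT y|\<pi>. f y)\<bar> \<partial>\<mu>)"
      by (rule bind_distance[OF \<mu> fm int(1) fin])
    also have "\<dots> \<le> (\<integral>\<^sup>+x. ennreal (G n x) \<partial>\<mu>)"
    proof (rule nn_integral_mono, rule ennreal_leI)
      fix x assume "x \<in> space \<mu>"
      then have x: "x \<in> space N" using sp by simp
      have vf: "(\<lambda>y. v * f y) \<in> borel_measurable N" using fm by measurable
      have "\<bar>v * f y\<bar> \<le> V y" if "y \<in> space N" for y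
      proof -
        have "\<bar>v * f y\<bar> \<le> v * 1" using f1 that V_ge(1) by (auto simp: abs_mult intro!: mult_left_mono)
        with V_ge(2)[OF that] show ?thesis by simp
      qed
      then have "\<bar>(LINT y|\<kappa> n x. v * f y) - (LINT y|\<pi>. v * f y)\<bar> \<le> C * a ^ n * V x"
        by (rule erg[OF vf _ x])
      moreover have "(LINT y|\<kappa> n x. v * f y) - (LINT y|\<pi>. v * f y)
          = v * ((LINT y|\<kappa> n x. f y) - (LINT y|\<pi>. f y))" by (simp add: right_diff_distrib)
      ultimately have "v * \<bar>(LINT y|\<kappa> n x. f y) - (LINT y|\<pi>. f y)\<bar> \<le> C * a ^ n * V x"
        using V_ge(1) by (simp add: abs_mult)
      then have "\<bar>(LINT y|\<kappa> n x. f y) - (LINT y|\<pi>. f y)\<bar> \<le> C * a ^ n * V x / v"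
        using V_ge(1) by (simp add: field_simps)
      then show "\<bar>(LINT y|\<kappa> n x. f y) - (LINT y|\<pi>. f y)\<bar> \<le> G n x"
        using int(2)[OF x] \<pi>1 by (auto simp: G_def)
    qed
    finally show "ennreal \<bar>(LINT y|(\<mu> \<bind> \<kappa> n). f y) - (LINT y|\<pi>. f y)\<bar> \<le> (\<integral>\<^sup>+x. ennreal (G n x) \<partial>\<mu>)" .
  qed
  show ?thesis
    by (rule tendsto_sandwich[OF _ _ tendsto_const lim]) (use bound in auto)
qed

lemma invariant_unique:
  assumes \<mu>: "invariant_distribution N \<kappa> \<mu>"
  shows "\<mu> = \<pi>"
proof -
  have d: "distribution_on N \<mu>" and inv: "\<And>n. \<mu> \<bind> \<kappa> n = \<mu>"
    using \<mu> by (auto simp: invariant_distribution_def)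
  have s: "sets \<mu> = sets N" and pm: "prob_space \<mu>" using d by (auto simp: distribution_on_def)
  interpret prob_space \<mu> by (rule pm)
  interpret \<pi>: prob_space \<pi> by (rule \<pi>_prob)
  have "weighted_TV N (\<lambda>_. 1) \<mu> \<pi> = 0"
    using total_variation_convergence[OF d] unfolding inv by (simp add: LIMSEQ_const_iff)
  show ?thesis
  proof (rule measure_eqI)
    fix A assume "A \<in> sets \<mu>"
    then have A: "A \<in> sets N" using s by simp
    have "ennreal \<bar>(LINT x|\<mu>. indicator A x :: real) - (LINT x|\<pi>. indicator A x)\<bar>
        \<le> weighted_TV N (\<lambda>_. 1) \<mu> \<pi>"
      unfolding weighted_TV_def by (rule SUP_upper) (use A in \<open>auto split: split_indicator\<close>)
    with \<open>weighted_TV N (\<lambda>_. 1) \<mu> \<pi> = 0\<close> have "measure \<mu> A = measure \<pi> A"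
      using A s \<pi>_sets sets.sets_into_space[OF A] sets_eq_imp_space_eq[OF s] sets_eq_imp_space_eq[OF \<pi>_sets]
      by (simp add: Int_absorb1 Int_absorb2)
    then show "emeasure \<mu> A = emeasure \<pi> A" by (simp add: emeasure_eq_measure \<pi>.emeasure_eq_measure)
  qed (simp add: s \<pi>_sets)
qed

end

section \<open>Survival probabilities and their eigenfunction for a killed kernel\<close>

text \<open>The hypotheses of the theorem, transferred from the process to its killed kernel \<open>p\<close>.  The comparison
  \<open>harnack\<close> of survival probabilities on \<open>K\<close> is the ratio bound without the quotient; \<open>\<pi>\<close> is the
  quasi-stationary distribution and \<open>\<eta>\<close> the limit of the normalised survival probabilities.\<close>

locale qsd_chain = kernel_semigroup M p
  for M :: "'a measure" and p :: "nat \<Rightarrow> 'a \<Rightarrow> 'a measure" +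
  fixes n1 :: nat and \<theta>0 \<theta>1 \<theta>2 c1 c2 c3 h1 :: real and \<phi>1 \<phi>2 \<eta> :: "'a \<Rightarrow> real"
    and K :: "'a set" and \<nu> \<pi> :: "'a measure"
  assumes const: "0 < \<theta>1" "\<theta>1 < \<theta>2" "0 < c1" "0 < c2" "0 < c3" "0 < \<theta>0"
    and \<phi>1_meas[measurable]: "\<phi>1 \<in> borel_measurable M" and \<phi>1_ge: "x \<in> space M \<Longrightarrow> 1 \<le> \<phi>1 x"
    and \<phi>1_K: "x \<in> K \<Longrightarrow> \<phi>1 x \<le> h1"
    and \<phi>2_meas[measurable]: "\<phi>2 \<in> borel_measurable M"
    and \<phi>2_range: "x \<in> space M \<Longrightarrow> 0 \<le> \<phi>2 x" "x \<in> space M \<Longrightarrow> \<phi>2 x \<le> 1"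
    and K_sets[measurable]: "K \<in> sets M"
    and lyapunov: "x \<in> space M \<Longrightarrow> (\<integral>\<^sup>+y. ennreal (\<phi>1 y) \<partial>p 1 x) \<le> ennreal (\<theta>1 * \<phi>1 x + c2 * indicator K x)"
    and \<phi>2_growth: "x \<in> space M \<Longrightarrow> ennreal (\<theta>2 * \<phi>2 x) \<le> (\<integral>\<^sup>+y. ennreal (\<phi>2 y) \<partial>p 1 x)"
    and harnack: "x \<in> K \<Longrightarrow> y \<in> K \<Longrightarrow> measure (p n x) (space M) \<le> c3 * measure (p n y) (space M)"
    and \<nu>_prob: "prob_space \<nu>" and \<nu>_sets: "sets \<nu> = sets (restrict_space M K)"
    and minorization: "x \<in> K \<Longrightarrow> A \<in> sets M \<Longrightarrow> c1 * measure \<nu> (A \<inter> K) \<le> measure (p n1 x) A"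
    and aperiodic: "x \<in> K \<Longrightarrow> \<exists>m. \<forall>n\<ge>m. 0 < measure (p n x) K"
    and \<pi>_prob: "prob_space \<pi>" and \<pi>_sets[measurable_cong]: "sets \<pi> = sets M"
    and \<pi>_qsd: "A \<in> sets M \<Longrightarrow> (LINT x|\<pi>. measure (p n x) A) = \<theta>0 ^ n * measure \<pi> A"
    and \<pi>_\<phi>1: "(\<integral>\<^sup>+x. ennreal (\<phi>1 x) \<partial>\<pi>) < \<infinity>" and \<pi>_\<phi>2: "0 < (LINT x|\<pi>. \<phi>2 x)"
    and eta_lim: "x \<in> space M \<Longrightarrow> (\<lambda>n. measure (p n x) (space M) / \<theta>0 ^ n) \<longlonglongrightarrow> \<eta> x"
begin

sublocale \<pi>: prob_space \<pi> by (rule \<pi>_prob)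

lemma \<pi>_space: "space \<pi> = space M"
  by (rule sets_eq_imp_space_eq[OF \<pi>_sets])

lemma K_space: "x \<in> K \<Longrightarrow> x \<in> space M"
  using sets.sets_into_space[OF K_sets] by auto

lemma \<phi>1_pos: "x \<in> space M \<Longrightarrow> 0 < \<phi>1 x"
  using \<phi>1_ge by force

lemma measure_measurable: "A \<in> sets M \<Longrightarrow> (\<lambda>x. measure (p n x) A) \<in> borel_measurable M"
  by (rule measurable_compose[OF kernel]) auto

lemma qsd_nn:
  assumes f: "f \<in> borel_measurable M"
  shows "(\<integral>\<^sup>+x. \<integral>\<^sup>+y. f y \<partial>p n x \<partial>\<pi>) = ennreal (\<theta>0 ^ n) * (\<integral>\<^sup>+x. f x \<partial>\<pi>)"
proof -
  have k: "p n \<in> \<pi> \<rightarrow>\<^sub>M subprob_algebra M"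
    using kernel by (simp add: measurable_cong_sets[OF \<pi>_sets refl])
  have "\<pi> \<bind> p n = scale_measure (ennreal (\<theta>0 ^ n)) \<pi>"
  proof (rule measure_eqI)
    show s: "sets (\<pi> \<bind> p n) = sets (scale_measure (ennreal (\<theta>0 ^ n)) \<pi>)"
      using sets_bind[OF subprob_measurableD(2)[OF k] \<pi>.not_empty] by (simp add: \<pi>_sets)
    fix A assume "A \<in> sets (\<pi> \<bind> p n)"
    then have A: "A \<in> sets M" using s by (simp add: \<pi>_sets)
    have "emeasure (\<pi> \<bind> p n) A = (\<integral>\<^sup>+x. emeasure (p n x) A \<partial>\<pi>)"
      by (rule emeasure_bind[OF \<pi>.not_empty k A])
    also have "\<dots> = (\<integral>\<^sup>+x. ennreal (measure (p n x) A) \<partial>\<pi>)"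
      by (rule nn_integral_cong) (use kernel_emeasure \<pi>_space in auto)
    also have "\<dots> = ennreal (LINT x|\<pi>. measure (p n x) A)"
    proof (rule nn_integral_eq_integral)
      show "integrable \<pi> (\<lambda>x. measure (p n x) A)"
        by (rule \<pi>.integrable_const_bound[where B=1])
           (use measure_measurable[OF A] subprob_space.subprob_measure_le_1[OF kernel_subprob] \<pi>_space
             in \<open>auto simp: measurable_cong_sets[OF \<pi>_sets refl]\<close>)
    qed auto
    also have "\<dots> = emeasure (scale_measure (ennreal (\<theta>0 ^ n)) \<pi>) A"
      using const by (simp add: \<pi>_qsd[OF A] \<pi>.emeasure_eq_measure ennreal_mult)
    finally show "emeasure (\<pi> \<bind> p n) A = emeasure (scale_measure (ennreal (\<theta>0 ^ n)) \<pi>) A" .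
  qed
  then have "(\<integral>\<^sup>+x. \<integral>\<^sup>+y. f y \<partial>p n x \<partial>\<pi>) = (\<integral>\<^sup>+y. f y \<partial>scale_measure (ennreal (\<theta>0 ^ n)) \<pi>)"
    using nn_integral_bind[OF f k] by simp
  also have "\<dots> = ennreal (\<theta>0 ^ n) * (\<integral>\<^sup>+x. f x \<partial>\<pi>)"
    by (rule nn_integral_scale_measure) (use f in measurable)
  finally show ?thesis .
qed

text \<open>Integrating the growth of \<open>\<phi>2\<close> against \<open>\<pi>\<close> gives \<open>\<theta>2 \<le> \<theta>0\<close>, because \<open>\<pi>\<close> is multiplied by \<open>\<theta>0\<close> in one step.\<close>

lemma rate_less: "\<theta>1 < \<theta>0"
proof -
  have i: "integrable \<pi> \<phi>2"
    by (rule \<pi>.integrable_const_bound[where B=1]) (use \<phi>2_range \<pi>_space in auto)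
  have e: "(\<integral>\<^sup>+x. ennreal (\<phi>2 x) \<partial>\<pi>) = ennreal (LINT x|\<pi>. \<phi>2 x)"
    by (rule nn_integral_eq_integral[OF i]) (use \<phi>2_range \<pi>_space in auto)
  have "ennreal (\<theta>2 * (LINT x|\<pi>. \<phi>2 x)) = (\<integral>\<^sup>+x. ennreal (\<theta>2 * \<phi>2 x) \<partial>\<pi>)"
    using e const \<pi>_\<phi>2 by (simp add: ennreal_mult' nn_integral_cmult)
  also have "\<dots> \<le> (\<integral>\<^sup>+x. \<integral>\<^sup>+y. ennreal (\<phi>2 y) \<partial>p 1 x \<partial>\<pi>)"
    by (rule nn_integral_mono) (use \<phi>2_growth \<pi>_space in auto)
  also have "\<dots> = ennreal (\<theta>0 * (LINT x|\<pi>. \<phi>2 x))"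
    using e const by (subst qsd_nn) (auto simp: ennreal_mult')
  finally have "\<theta>2 * (LINT x|\<pi>. \<phi>2 x) \<le> \<theta>0 * (LINT x|\<pi>. \<phi>2 x)"
    using const \<pi>_\<phi>2 by (subst (asm) ennreal_le_iff) auto
  then show ?thesis using \<pi>_\<phi>2 const by simp
qed

lemma K_integrable: "integrable \<pi> (indicator K :: 'a \<Rightarrow> real)"
  by (rule \<pi>.integrable_const_bound[where B=1]) (auto split: split_indicator intro!: AE_I2 simp: \<pi>_sets)

text \<open>If \<open>\<pi>\<close> did not charge \<open>K\<close>, the drift would contract the integral of \<open>\<phi>1\<close> by \<open>\<theta>1\<close>, whereas quasi-stationarity
  multiplies it by \<open>\<theta>0\<close>.\<close>

lemma \<pi>_K: "0 < measure \<pi> K"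
proof -
  define m where "m = (LINT x|\<pi>. \<phi>1 x)"
  have ae: "AE x in \<pi>. 0 \<le> \<phi>1 x" using \<phi>1_pos \<pi>_space by (auto intro: less_imp_le)
  have i: "integrable \<pi> \<phi>1"
    by (rule integrableI_nonneg[OF _ ae]) (use \<pi>_\<phi>1 in auto)
  have e: "(\<integral>\<^sup>+x. ennreal (\<phi>1 x) \<partial>\<pi>) = ennreal m"
    unfolding m_def by (rule nn_integral_eq_integral[OF i ae])
  have "(LINT x|\<pi>. 1) \<le> m" unfolding m_def
    by (rule integral_mono_AE) (use i \<phi>1_ge \<pi>_space in auto)
  then have m: "1 \<le> m" by (simp add: \<pi>.prob_space)
  have "ennreal (\<theta>0 * m) = (\<integral>\<^sup>+x. \<integral>\<^sup>+y. ennreal (\<phi>1 y) \<partial>p 1 x \<partial>\<pi>)"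
    using e const by (subst qsd_nn) (auto simp: ennreal_mult')
  also have "\<dots> \<le> (\<integral>\<^sup>+x. ennreal (\<theta>1 * \<phi>1 x + c2 * indicator K x) \<partial>\<pi>)"
    by (rule nn_integral_mono) (use lyapunov \<pi>_space in auto)
  also have "\<dots> = ennreal (LINT x|\<pi>. \<theta>1 * \<phi>1 x + c2 * indicator K x)"
    by (rule nn_integral_eq_integral) (use i ae const K_integrable in auto)
  also have "(LINT x|\<pi>. \<theta>1 * \<phi>1 x + c2 * indicator K x) = \<theta>1 * m + c2 * measure \<pi> K"
    using i K_integrable by (simp add: m_def \<pi>_sets \<pi>_space K_sets[THEN sets.sets_into_space] Int_absorb2)
  finally have "\<theta>0 * m \<le> \<theta>1 * m + c2 * measure \<pi> K"
    using const m by (subst (asm) ennreal_le_iff) auto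
  moreover have "\<theta>1 * m < \<theta>0 * m" using rate_less m by simp
  ultimately have "0 < c2 * measure \<pi> K" by linarith
  then show ?thesis using const by (simp add: zero_less_mult_iff)
qed

definition surv_const where "surv_const = max 1 (c3 / measure \<pi> K)"

lemma surv_const_ge: "1 \<le> surv_const" "c3 / measure \<pi> K \<le> surv_const" by (auto simp: surv_const_def)

text \<open>The \<open>\<pi>\<close>-average of the survival probability at time \<open>n\<close> is \<open>\<theta>0 ^ n\<close>, and its part over \<open>K\<close> is comparable to
  the value at any point of \<open>K\<close>.\<close>

lemma survival_K:
  assumes x: "x \<in> K"
  shows "measure (p n x) (space M) \<le> c3 / measure \<pi> K * \<theta>0 ^ n"
proof -
  have i: "integrable \<pi> (\<lambda>x. measure (p n x) (space M))"
    by (rule \<pi>.integrable_const_bound[where B=1])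
       (use measure_measurable[OF sets.top] subprob_space.subprob_measure_le_1[OF kernel_subprob] \<pi>_space
         in \<open>auto simp: measurable_cong_sets[OF \<pi>_sets refl]\<close>)
  have "measure (p n x) (space M) * measure \<pi> K = (LINT y|\<pi>. measure (p n x) (space M) * indicator K y)"
    by (simp add: \<pi>_sets \<pi>_space K_sets[THEN sets.sets_into_space] Int_absorb2)
  also have "\<dots> \<le> (LINT y|\<pi>. c3 * measure (p n y) (space M))"
  proof (rule integral_mono_AE)
    show "AE y in \<pi>. measure (p n x) (space M) * indicator K y \<le> c3 * measure (p n y) (space M)"
      using harnack[OF x] const by (auto split: split_indicator)
  qed (use i K_integrable in auto)
  also have "\<dots> = c3 * \<theta>0 ^ n"
    using \<pi>_qsd[OF sets.top] \<pi>.prob_space \<pi>_space by simp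
  finally show ?thesis using \<pi>_K by (simp add: field_simps)
qed

text \<open>Induction on the time: on \<open>K\<close> the bound is already known, and outside \<open>K\<close> one step maps the bound at
  time \<open>n\<close> to \<open>\<theta>1\<close> times itself, which is less than \<open>\<theta>0\<close> times itself.\<close>

lemma survival_bound:
  assumes x: "x \<in> space M"
  shows "measure (p n x) (space M) \<le> surv_const * \<theta>0 ^ n * \<phi>1 x"
  using x
proof (induction n arbitrary: x)
  case 0
  then show ?case
    using surv_const_ge \<phi>1_ge[OF 0] subprob_space.subprob_measure_le_1[OF kernel_subprob[OF 0], of 0 "space M"]
      mult_mono[of 1 surv_const 1 "\<phi>1 x"] by simp
next
  case (Suc n)
  note [measurable_cong] = kernel_sets[OF Suc.prems]
  show ?case
  proof (cases "x \<in> K")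
    case True
    have "c3 / measure \<pi> K * \<theta>0 ^ Suc n \<le> surv_const * \<theta>0 ^ Suc n"
      using surv_const_ge const by (intro mult_right_mono) auto
    also have "\<dots> = surv_const * \<theta>0 ^ Suc n * 1" by simp
    also have "\<dots> \<le> surv_const * \<theta>0 ^ Suc n * \<phi>1 x"
      using surv_const_ge const \<phi>1_ge[OF Suc.prems] by (intro mult_left_mono) auto
    finally show ?thesis using survival_K[OF True, of "Suc n"] by simp
  next
    case False
    have "ennreal (measure (p (1 + n) x) (space M)) = emeasure (p (1 + n) x) (space M)"
      by (rule kernel_emeasure[OF Suc.prems, symmetric])
    also have "\<dots> = (\<integral>\<^sup>+y. emeasure (p n y) (space M) \<partial>p 1 x)"
      by (rule emeasure_semigroup[OF _ Suc.prems]) simp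
    also have "\<dots> \<le> (\<integral>\<^sup>+y. ennreal (surv_const * \<theta>0 ^ n) * ennreal (\<phi>1 y) \<partial>p 1 x)"
    proof (rule nn_integral_mono)
      fix y assume "y \<in> space (p 1 x)"
      then have y: "y \<in> space M" using kernel_space[OF Suc.prems] by simp
      show "emeasure (p n y) (space M) \<le> ennreal (surv_const * \<theta>0 ^ n) * ennreal (\<phi>1 y)"
        using Suc.IH[OF y] kernel_emeasure[OF y] surv_const_ge const \<phi>1_pos[OF y]
        by (simp add: ennreal_mult[symmetric] ennreal_leI)
    qed
    also have "\<dots> = ennreal (surv_const * \<theta>0 ^ n) * (\<integral>\<^sup>+y. ennreal (\<phi>1 y) \<partial>p 1 x)"
      by (rule nn_integral_cmult) measurable
    also have "\<dots> \<le> ennreal (surv_const * \<theta>0 ^ n) * ennreal (\<theta>1 * \<phi>1 x)"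
      using lyapunov[OF Suc.prems] False by (intro mult_left_mono) auto
    also have "\<dots> = ennreal (surv_const * \<theta>0 ^ n * (\<theta>1 * \<phi>1 x))"
      using surv_const_ge const \<phi>1_pos[OF Suc.prems] by (simp add: ennreal_mult)
    finally have "measure (p (1 + n) x) (space M) \<le> surv_const * \<theta>0 ^ n * (\<theta>1 * \<phi>1 x)"
      using surv_const_ge const \<phi>1_pos[OF Suc.prems] by (subst (asm) ennreal_le_iff) auto
    also have "\<dots> \<le> surv_const * \<theta>0 ^ n * (\<theta>0 * \<phi>1 x)"
      using surv_const_ge const \<phi>1_pos[OF Suc.prems] rate_less by (intro mult_left_mono mult_right_mono) auto
    finally show ?thesis by (simp add: ac_simps)
  qed
qed

definition surv where "surv n x = measure (p n x) (space M) / \<theta>0 ^ n"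

lemma surv_bounds: "x \<in> space M \<Longrightarrow> 0 \<le> surv n x" "x \<in> space M \<Longrightarrow> surv n x \<le> surv_const * \<phi>1 x"
  using survival_bound[of x n] const by (auto simp: surv_def field_simps)

lemma surv_measurable[measurable]: "surv n \<in> borel_measurable M"
  unfolding surv_def[abs_def] using measure_measurable[OF sets.top] by measurable

lemma surv_lim: "x \<in> space M \<Longrightarrow> (\<lambda>n. surv n x) \<longlonglongrightarrow> \<eta> x"
  using eta_lim by (simp add: surv_def)

lemma eta_measurable[measurable]: "\<eta> \<in> borel_measurable M"
  by (rule borel_measurable_LIMSEQ_real[where u=surv]) (use surv_lim in auto)

lemma eta_nonneg: "x \<in> space M \<Longrightarrow> 0 \<le> \<eta> x"
  by (rule LIMSEQ_le_const[OF surv_lim]) (use surv_bounds in auto)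

lemma eta_bound: "x \<in> space M \<Longrightarrow> \<eta> x \<le> surv_const * \<phi>1 x"
  by (rule LIMSEQ_le_const2[OF surv_lim]) (use surv_bounds in auto)

lemma \<phi>1_iterate:
  assumes x: "x \<in> space M"
  shows "(\<integral>\<^sup>+y. ennreal (\<phi>1 y) \<partial>p n x) \<le> ennreal ((\<theta>1 + c2) ^ n * \<phi>1 x)"
  using x
proof (induction n arbitrary: x)
  case (Suc n)
  note [measurable_cong] = kernel_sets[OF Suc.prems]
  have "(\<integral>\<^sup>+y. ennreal (\<phi>1 y) \<partial>p (1 + n) x) = (\<integral>\<^sup>+y. \<integral>\<^sup>+z. ennreal (\<phi>1 z) \<partial>p n y \<partial>p 1 x)"
    by (rule nn_semigroup) (use Suc.prems in auto)
  also have "\<dots> \<le> (\<integral>\<^sup>+y. ennreal ((\<theta>1 + c2) ^ n * \<phi>1 y) \<partial>p 1 x)"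
    by (rule nn_integral_mono) (use Suc.IH kernel_space[OF Suc.prems] in auto)
  also have "\<dots> = ennreal ((\<theta>1 + c2) ^ n) * (\<integral>\<^sup>+y. ennreal (\<phi>1 y) \<partial>p 1 x)"
    using const by (simp add: ennreal_mult' nn_integral_cmult)
  also have "\<dots> \<le> ennreal ((\<theta>1 + c2) ^ n) * ennreal ((\<theta>1 + c2) * \<phi>1 x)"
  proof (intro mult_left_mono order_trans[OF lyapunov[OF Suc.prems]] ennreal_leI)
    have "c2 * indicator K x \<le> c2 * \<phi>1 x"
      using const \<phi>1_ge[OF Suc.prems] by (intro mult_left_mono) (auto split: split_indicator)
    then show "\<theta>1 * \<phi>1 x + c2 * indicator K x \<le> (\<theta>1 + c2) * \<phi>1 x" by (simp add: algebra_simps)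
  qed simp
  also have "\<dots> = ennreal ((\<theta>1 + c2) ^ Suc n * \<phi>1 x)"
    using const \<phi>1_pos[OF Suc.prems] by (simp add: ennreal_mult[symmetric] ac_simps)
  finally show ?case by simp
qed (use nn_init in simp)

text \<open>The only way in which the limit defining \<open>\<eta>\<close> is used: it may be taken under every measure that integrates
  \<open>\<phi>1\<close>.\<close>

lemma eta_dominated_convergence:
  assumes s[measurable_cong]: "sets R = sets M" and fin: "(\<integral>\<^sup>+x. ennreal (\<phi>1 x) \<partial>R) < \<infinity>"
  shows "(\<lambda>k. \<integral>\<^sup>+y. ennreal (surv k y) \<partial>R) \<longlonglongrightarrow> (\<integral>\<^sup>+y. ennreal (\<eta> y) \<partial>R)"
proof (rule nn_integral_dominated_convergence[where w="\<lambda>y. ennreal surv_const * ennreal (\<phi>1 y)"])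
  have sp: "space R = space M" by (rule sets_eq_imp_space_eq[OF s])
  have "(\<integral>\<^sup>+x. ennreal surv_const * ennreal (\<phi>1 x) \<partial>R) = ennreal surv_const * (\<integral>\<^sup>+x. ennreal (\<phi>1 x) \<partial>R)"
    by (rule nn_integral_cmult) measurable
  also have "\<dots> < \<infinity>" using fin by (auto simp: ennreal_mult_less_top)
  finally show "(\<integral>\<^sup>+x. ennreal surv_const * ennreal (\<phi>1 x) \<partial>R) < \<infinity>" .
  show "AE x in R. ennreal (surv k x) \<le> ennreal surv_const * ennreal (\<phi>1 x)" for k
    using surv_bounds surv_const_ge \<phi>1_pos sp by (auto simp: ennreal_mult'[symmetric] intro!: AE_I2 ennreal_leI)
  show "AE x in R. (\<lambda>k. ennreal (surv k x)) \<longlonglongrightarrow> ennreal (\<eta> x)"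
    using surv_lim sp by (auto intro!: AE_I2 tendsto_ennrealI)
qed auto

text \<open>Integrating the normalised survival probability at time \<open>k\<close> against \<open>p n x\<close> gives, up to the factor \<open>\<theta>0 ^ n\<close>, the one at
  time \<open>n + k\<close> from \<open>x\<close>.\<close>

lemma eta_eigen:
  assumes x: "x \<in> space M"
  shows "(\<integral>\<^sup>+y. ennreal (\<eta> y) \<partial>p n x) = ennreal (\<theta>0 ^ n * \<eta> x)"
proof -
  have "(\<integral>\<^sup>+y. ennreal (surv k y) \<partial>p n x) = ennreal (\<theta>0 ^ n * surv (n + k) x)" for k
  proof -
    note [measurable_cong] = kernel_sets[OF x]
    have "(\<integral>\<^sup>+y. ennreal (surv k y) \<partial>p n x) = (\<integral>\<^sup>+y. emeasure (p k y) (space M) * ennreal (1 / \<theta>0 ^ k) \<partial>p n x)"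
      by (rule nn_integral_cong)
         (use kernel_space[OF x] kernel_emeasure const in \<open>auto simp: surv_def ennreal_mult'[symmetric]\<close>)
    also have "\<dots> = (\<integral>\<^sup>+y. emeasure (p k y) (space M) \<partial>p n x) * ennreal (1 / \<theta>0 ^ k)"
      by (rule nn_integral_multc) (use emeasure_measurable[OF sets.top] in measurable)
    also have "(\<integral>\<^sup>+y. emeasure (p k y) (space M) \<partial>p n x) = emeasure (p (n + k) x) (space M)"
      by (rule emeasure_semigroup[symmetric, OF _ x]) simp
    also have "\<dots> * ennreal (1 / \<theta>0 ^ k) = ennreal (\<theta>0 ^ n * surv (n + k) x)"
      using const by (simp add: kernel_emeasure[OF x] surv_def ennreal_mult'[symmetric] power_add)
    finally show ?thesis .
  qed
  moreover have "(\<lambda>k. \<integral>\<^sup>+y. ennreal (surv k y) \<partial>p n x) \<longlonglongrightarrow> (\<integral>\<^sup>+y. ennreal (\<eta> y) \<partial>p n x)"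
    by (rule eta_dominated_convergence[OF kernel_sets[OF x]])
       (use le_less_trans[OF \<phi>1_iterate[OF x, of n]] in auto)
  moreover have "(\<lambda>k. ennreal (\<theta>0 ^ n * surv (n + k) x)) \<longlonglongrightarrow> ennreal (\<theta>0 ^ n * \<eta> x)"
    using LIMSEQ_ignore_initial_segment[OF surv_lim[OF x], of n]
    by (intro tendsto_ennrealI tendsto_mult tendsto_const) (simp add: add.commute)
  ultimately show ?thesis by (auto intro: LIMSEQ_unique)
qed

lemma \<pi>_eta: "(\<integral>\<^sup>+x. ennreal (\<eta> x) \<partial>\<pi>) = 1"
proof -
  have "(\<integral>\<^sup>+x. ennreal (surv k x) \<partial>\<pi>) = 1" for k
  proof -
    have "(\<integral>\<^sup>+x. ennreal (surv k x) \<partial>\<pi>) = (\<integral>\<^sup>+x. (\<integral>\<^sup>+y. 1 \<partial>p k x) * ennreal (1 / \<theta>0 ^ k) \<partial>\<pi>)"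
      by (rule nn_integral_cong)
         (use \<pi>_space kernel_space kernel_emeasure const in \<open>auto simp: surv_def ennreal_mult'[symmetric]\<close>)
    also have "\<dots> = (\<integral>\<^sup>+x. \<integral>\<^sup>+y. 1 \<partial>p k x \<partial>\<pi>) * ennreal (1 / \<theta>0 ^ k)"
      by (rule nn_integral_multc) (use nn_measurable[of "\<lambda>_. 1" k] in measurable)
    also have "\<dots> = 1"
      using const \<pi>.emeasure_space_1 by (subst qsd_nn) (auto simp: ennreal_mult'[symmetric])
    finally show ?thesis .
  qed
  then show ?thesis
    using eta_dominated_convergence[OF \<pi>_sets \<pi>_\<phi>1] by (simp add: LIMSEQ_const_iff)
qed

lemma eta_harnack:
  assumes "x \<in> K" "y \<in> K"
  shows "\<eta> x \<le> c3 * \<eta> y"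
proof (rule LIMSEQ_le[OF surv_lim[OF K_space[OF assms(1)]] tendsto_mult[OF tendsto_const surv_lim[OF K_space[OF assms(2)]]]])
  show "\<exists>N. \<forall>n\<ge>N. surv n x \<le> c3 * surv n y"
    using harnack[OF assms] const by (auto simp: surv_def divide_right_mono)
qed

text \<open>If \<open>\<eta>\<close> vanished at one point of \<open>K\<close>, it would vanish on \<open>K\<close> by comparison.  The eigenvalue equation then
  improves a bound of \<open>\<eta>\<close> by a multiple of \<open>\<phi>1\<close> by the factor \<open>\<theta>1 / \<theta>0\<close> at each application, so \<open>\<eta>\<close> would vanish
  everywhere, although its \<open>\<pi>\<close>-integral is one.\<close>

lemma eta_pos_K:
  assumes y: "y \<in> K"
  shows "0 < \<eta> y"
proof (rule ccontr)
  assume "\<not> 0 < \<eta> y"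
  then have "\<eta> y = 0" using eta_nonneg[OF K_space[OF y]] by simp
  then have K0: "\<eta> x = 0" if "x \<in> K" for x
    using eta_harnack[OF that y] eta_nonneg[OF K_space[OF that]] by simp
  have decay: "\<eta> x \<le> surv_const * (\<theta>1 / \<theta>0) ^ n * \<phi>1 x" if "x \<in> space M" for n x
    using that
  proof (induction n arbitrary: x)
    case 0
    then show ?case using eta_bound by simp
  next
    case (Suc n)
    note [measurable_cong] = kernel_sets[OF Suc.prems]
    let ?a = "surv_const * (\<theta>1 / \<theta>0) ^ n"
    have a: "0 \<le> ?a" using surv_const_ge const by simp
    show ?case
    proof (cases "x \<in> K")
      case True
      then show ?thesis using K0 surv_const_ge const \<phi>1_pos[OF Suc.prems] by simp
    next
      case False
      have "ennreal (\<theta>0 * \<eta> x) = (\<integral>\<^sup>+y. ennreal (\<eta> y) \<partial>p 1 x)"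
        using eta_eigen[OF Suc.prems, of 1] by simp
      also have "\<dots> \<le> (\<integral>\<^sup>+y. ennreal ?a * ennreal (\<phi>1 y) \<partial>p 1 x)"
        by (rule nn_integral_mono)
           (use Suc.IH kernel_space[OF Suc.prems] a in \<open>auto simp: ennreal_mult'[symmetric] intro!: ennreal_leI\<close>)
      also have "\<dots> = ennreal ?a * (\<integral>\<^sup>+y. ennreal (\<phi>1 y) \<partial>p 1 x)"
        by (rule nn_integral_cmult) measurable
      also have "\<dots> \<le> ennreal ?a * ennreal (\<theta>1 * \<phi>1 x)"
        using lyapunov[OF Suc.prems] False by (intro mult_left_mono) auto
      also have "\<dots> = ennreal (?a * (\<theta>1 * \<phi>1 x))" using a by (simp add: ennreal_mult')
      finally have "\<theta>0 * \<eta> x \<le> ?a * (\<theta>1 * \<phi>1 x)"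
        using a const \<phi>1_pos[OF Suc.prems] by (subst (asm) ennreal_le_iff) auto
      then show ?thesis using const by (simp add: field_simps)
    qed
  qed
  have "\<eta> x = 0" if x: "x \<in> space M" for x
  proof -
    have "(\<lambda>n. surv_const * (\<theta>1 / \<theta>0) ^ n * \<phi>1 x) \<longlonglongrightarrow> surv_const * 0 * \<phi>1 x"
      using const rate_less by (intro tendsto_intros LIMSEQ_power_zero) auto
    then have "\<eta> x \<le> surv_const * 0 * \<phi>1 x"
      by (rule LIMSEQ_le_const) (use decay[OF x] in auto)
    then show ?thesis using eta_nonneg[OF x] by simp
  qed
  then have "(\<integral>\<^sup>+x. ennreal (\<eta> x) \<partial>\<pi>) = (\<integral>\<^sup>+x. 0 \<partial>\<pi>)"
    by (intro nn_integral_cong) (use \<pi>_space in auto)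
  then show False using \<pi>_eta by simp
qed

lemma eta_lower_K: obtains e where "0 < e" "\<And>x. x \<in> K \<Longrightarrow> e \<le> \<eta> x"
proof -
  obtain y where y: "y \<in> K" using \<pi>_K by (cases "K = {}") auto
  show thesis
  proof (rule that)
    show "0 < \<eta> y / c3" using eta_pos_K[OF y] const by simp
    show "\<eta> y / c3 \<le> \<eta> x" if "x \<in> K" for x
      using eta_harnack[OF y that] const by (simp add: field_simps)
  qed
qed

end

section \<open>The tilted kernel\<close>

context qsd_chain
begin

definition E' where "E' = {x \<in> space M. 0 < \<eta> x}"
definition N where "N = restrict_space M E'"
text \<open>The Doob transform on the whole state space.  It charges only \<open>E'\<close>; the restriction \<open>h\<close> is the
  transition kernel of the chain on \<open>E'\<close>.\<close>

definition tilt where "tilt n x = density (p n x) (\<lambda>y. ennreal (\<eta> y / (\<theta>0 ^ n * \<eta> x)))"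
abbreviation tilt_factor where "tilt_factor n x \<equiv> ennreal (1 / (\<theta>0 ^ n * \<eta> x))"
definition h where "h n x = restrict_space (tilt n x) E'"

lemma E'_sets[measurable]: "E' \<in> sets M" unfolding E'_def by measurable

lemma E'D: "x \<in> E' \<Longrightarrow> x \<in> space M" "x \<in> E' \<Longrightarrow> 0 < \<eta> x" by (auto simp: E'_def)

lemma eta_outside: "x \<in> space M \<Longrightarrow> x \<notin> E' \<Longrightarrow> \<eta> x = 0"
  using eta_nonneg by (force simp: E'_def)

lemma space_N: "space N = E'"
  using E'_def by (auto simp: N_def space_restrict_space)

lemma K_E': "x \<in> K \<Longrightarrow> x \<in> E'"
  using K_space eta_pos_K by (auto simp: E'_def)

lemma E'_nonempty: "E' \<noteq> {}"
  using \<pi>_K K_E' by (cases "K = {}") auto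

lemma tilt_sets: "x \<in> space M \<Longrightarrow> sets (tilt n x) = sets M"
  and tilt_space: "x \<in> space M \<Longrightarrow> space (tilt n x) = space M"
  using kernel_sets kernel_space by (auto simp: tilt_def)

lemma nn_tilt:
  assumes x: "x \<in> E'" and g: "g \<in> borel_measurable M"
  shows "(\<integral>\<^sup>+y. g y \<partial>tilt n x) = tilt_factor n x * (\<integral>\<^sup>+y. ennreal (\<eta> y) * g y \<partial>p n x)"
proof -
  note xs = E'D[OF x]
  note [measurable_cong] = kernel_sets[OF xs(1)]
  note g[measurable]
  have "(\<integral>\<^sup>+y. g y \<partial>tilt n x) = (\<integral>\<^sup>+y. ennreal (\<eta> y / (\<theta>0 ^ n * \<eta> x)) * g y \<partial>p n x)"
    unfolding tilt_def by (rule nn_integral_density) measurable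
  also have "\<dots> = (\<integral>\<^sup>+y. tilt_factor n x * (ennreal (\<eta> y) * g y) \<partial>p n x)"
  proof (rule nn_integral_cong)
    fix y assume "y \<in> space (p n x)"
    then have "0 \<le> \<eta> y" using eta_nonneg kernel_space[OF xs(1)] by simp
    then have "ennreal (\<eta> y / (\<theta>0 ^ n * \<eta> x)) = tilt_factor n x * ennreal (\<eta> y)"
      using const xs by (simp add: ennreal_mult[symmetric])
    then show "ennreal (\<eta> y / (\<theta>0 ^ n * \<eta> x)) * g y = tilt_factor n x * (ennreal (\<eta> y) * g y)"
      by (simp add: mult.assoc)
  qed
  also have "\<dots> = tilt_factor n x * (\<integral>\<^sup>+y. ennreal (\<eta> y) * g y \<partial>p n x)"
    by (rule nn_integral_cmult) measurable
  finally show ?thesis .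
qed

lemma emeasure_tilt:
  assumes x: "x \<in> E'" and A: "A \<in> sets M"
  shows "emeasure (tilt n x) A = tilt_factor n x * (\<integral>\<^sup>+y. ennreal (\<eta> y) * indicator A y \<partial>p n x)"
  using nn_tilt[OF x, of "indicator A" n] A tilt_sets[OF E'D(1)[OF x]] by simp

lemma tilt_prob: assumes x: "x \<in> E'" shows "prob_space (tilt n x)"
proof
  have "emeasure (tilt n x) (space M) = tilt_factor n x * (\<integral>\<^sup>+y. ennreal (\<eta> y) * indicator (space M) y \<partial>p n x)"
    by (rule emeasure_tilt[OF x]) simp
  also have "(\<integral>\<^sup>+y. ennreal (\<eta> y) * indicator (space M) y \<partial>p n x) = (\<integral>\<^sup>+y. ennreal (\<eta> y) \<partial>p n x)"
    by (rule nn_integral_cong) (use kernel_space[OF E'D(1)[OF x]] in auto)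
  also have "tilt_factor n x * \<dots> = 1"
    using eta_eigen[OF E'D(1)[OF x], of n] E'D[OF x] const by (simp add: ennreal_mult[symmetric])
  finally show "emeasure (tilt n x) (space (tilt n x)) = 1" using tilt_space[OF E'D(1)[OF x]] by simp
qed

lemma tilt_AE: assumes x: "x \<in> E'" shows "AE y in tilt n x. y \<in> E'"
proof -
  have xs: "x \<in> space M" by (rule E'D[OF x])
  have m: "(\<lambda>y. ennreal (\<eta> y / (\<theta>0 ^ n * \<eta> x))) \<in> borel_measurable (p n x)"
    using eta_measurable by (simp add: measurable_cong_sets[OF kernel_sets[OF xs] refl])
  show ?thesis unfolding tilt_def AE_density[OF m]
    by (rule AE_I2) (use eta_outside kernel_space[OF xs] in force)
qed

lemma tilt_measurable: "tilt n \<in> N \<rightarrow>\<^sub>M prob_algebra M"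
proof (rule measurable_prob_algebraI[OF tilt_prob])
  show "tilt n \<in> N \<rightarrow>\<^sub>M subprob_algebra M"
  proof (rule measurable_subprob_algebra)
    show "subprob_space (tilt n x)" "sets (tilt n x) = sets M" if "x \<in> space N" for x
      using that tilt_prob[of x] tilt_sets[of x] E'D by (auto simp: space_N intro: prob_space_imp_subprob_space)
    fix A assume A[measurable]: "A \<in> sets M"
    have 1: "(\<lambda>x. \<integral>\<^sup>+y. ennreal (\<eta> y) * indicator A y \<partial>p n x) \<in> borel_measurable M"
      by (rule nn_measurable) measurable
    have "(\<lambda>x. tilt_factor n x * (\<integral>\<^sup>+y. ennreal (\<eta> y) * indicator A y \<partial>p n x)) \<in> borel_measurable N"
      unfolding N_def by (rule measurable_restrict_space1) (use 1 in measurable)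
    then show "(\<lambda>x. emeasure (tilt n x) A) \<in> borel_measurable N"
      by (rule measurable_cong[THEN iffD2, rotated]) (use emeasure_tilt[OF _ A] space_N in auto)
  qed
qed (simp add: space_N)

lemma h_sets: "x \<in> E' \<Longrightarrow> sets (h n x) = sets N"
  unfolding h_def N_def by (rule sets_restrict_space_cong) (simp add: tilt_sets E'D)

lemma h_measurable: "h n \<in> N \<rightarrow>\<^sub>M prob_algebra N"
proof (rule measurable_prob_algebraI)
  show "h n \<in> N \<rightarrow>\<^sub>M subprob_algebra N"
    unfolding h_def N_def
    by (rule restrict_space_measurable) (use E'_nonempty measurable_prob_algebraD[OF tilt_measurable] N_def in auto)
  fix x assume "x \<in> space N"
  then have x: "x \<in> E'" by (simp add: space_N)
  interpret prob_space "tilt n x" by (rule tilt_prob[OF x])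
  have "emeasure (tilt n x) E' = 1"
    using tilt_AE[OF x] tilt_sets[OF E'D(1)[OF x]] by (intro emeasure_eq_1_AE) auto
  then show "prob_space (h n x)" unfolding h_def
    using tilt_sets[OF E'D(1)[OF x]] by (intro prob_spaceI) (simp add: emeasure_restrict_space space_restrict_space tilt_space[OF E'D(1)[OF x]] E'_def Int_absorb2 Collect_conj_eq)
qed

lemma N_extend: "g \<in> borel_measurable N \<Longrightarrow> (\<lambda>y. g y * indicator E' y) \<in> borel_measurable M"
  for g :: "'a \<Rightarrow> ennreal"
  unfolding N_def by (subst (asm) borel_measurable_restrict_space_iff_ennreal) auto

lemma nn_h:
  assumes x: "x \<in> E'" and g: "g \<in> borel_measurable N"
  shows "(\<integral>\<^sup>+y. g y \<partial>h n x) = tilt_factor n x * (\<integral>\<^sup>+y. ennreal (\<eta> y) * (g y * indicator E' y) \<partial>p n x)"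
  unfolding h_def using tilt_sets[OF E'D(1)[OF x]]
  by (subst nn_integral_restrict_space) (auto simp: nn_tilt[OF x N_extend[OF g]])

lemma N_setsD: "A \<in> sets N \<Longrightarrow> A \<in> sets M" "A \<in> sets N \<Longrightarrow> A \<subseteq> E'"
  by (auto simp: N_def sets_restrict_space)

lemma N_setsI: "A \<in> sets M \<Longrightarrow> A \<subseteq> E' \<Longrightarrow> A \<in> sets N"
  by (auto simp: N_def sets_restrict_space image_iff)

lemma emeasure_h:
  assumes x: "x \<in> E'" and A: "A \<in> sets N"
  shows "emeasure (h n x) A = tilt_factor n x * (\<integral>\<^sup>+y. ennreal (\<eta> y) * indicator A y \<partial>p n x)"
proof -
  have "emeasure (h n x) A = emeasure (tilt n x) A"
    unfolding h_def using tilt_sets[OF E'D(1)[OF x]] N_setsD[OF A] by (intro emeasure_restrict_space) auto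
  with emeasure_tilt[OF x N_setsD(1)[OF A]] show ?thesis by simp
qed

definition V where "V x = \<phi>1 x / \<eta> x"
definition \<beta> where "\<beta> = density (restrict_space \<pi> E') (\<lambda>x. ennreal (\<eta> x))"

lemma \<beta>_sets: "sets \<beta> = sets N"
  unfolding \<beta>_def N_def by (simp add: sets_restrict_space_cong[OF \<pi>_sets])

lemma nn_\<beta>:
  assumes g: "g \<in> borel_measurable N"
  shows "(\<integral>\<^sup>+x. g x \<partial>\<beta>) = (\<integral>\<^sup>+x. ennreal (\<eta> x) * (g x * indicator E' x) \<partial>\<pi>)"
proof -
  have s: "sets (restrict_space \<pi> E') = sets N" unfolding N_def by (rule sets_restrict_space_cong[OF \<pi>_sets])
  have e: "(\<lambda>x. ennreal (\<eta> x)) \<in> borel_measurable N" unfolding N_def by (rule measurable_restrict_space1) measurable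
  have "(\<integral>\<^sup>+x. g x \<partial>\<beta>) = (\<integral>\<^sup>+x. ennreal (\<eta> x) * g x \<partial>restrict_space \<pi> E')"
    unfolding \<beta>_def by (rule nn_integral_density) (use e g in \<open>auto simp: measurable_cong_sets[OF s refl]\<close>)
  also have "\<dots> = (\<integral>\<^sup>+x. ennreal (\<eta> x) * g x * indicator E' x \<partial>\<pi>)"
    by (rule nn_integral_restrict_space) (simp add: \<pi>_sets)
  finally show ?thesis by (simp add: mult.assoc)
qed

lemma eta_indicator: "x \<in> space M \<Longrightarrow> ennreal (\<eta> x) * (f * indicator E' x) = ennreal (\<eta> x) * f"
  using eta_outside[of x] by (cases "x \<in> E'") auto

text \<open>No mass passes from outside \<open>E'\<close> into \<open>E'\<close>, because \<open>\<eta>\<close> vanishes there together with its image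
  under the kernel.  Hence the restriction to \<open>E'\<close> loses nothing in the semigroup computations.\<close>

lemma eta_vanish:
  assumes x: "x \<in> space M" "x \<notin> E'"
  shows "(\<integral>\<^sup>+y. ennreal (\<eta> y) * indicator A y \<partial>p n x) = 0"
proof -
  have "(\<integral>\<^sup>+y. ennreal (\<eta> y) * indicator A y \<partial>p n x) \<le> (\<integral>\<^sup>+y. ennreal (\<eta> y) \<partial>p n x)"
    by (rule nn_integral_mono) (auto split: split_indicator)
  then show ?thesis using eta_eigen[OF x(1), of n] eta_outside[OF x] by simp
qed

lemma h_semigroup:
  assumes x: "x \<in> E'"
  shows "h (m + n) x = h m x \<bind> h n"
proof (rule measure_eqI)
  have xs: "x \<in> space M" by (rule E'D[OF x])
  have hm: "h m x \<in> space (prob_algebra N)" using measurable_space[OF h_measurable] x by (simp add: space_N)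
  show s: "sets (h (m + n) x) = sets (h m x \<bind> h n)"
    using h_sets[OF x] sets_bind'[OF hm h_measurable] by simp
  fix A assume "A \<in> sets (h (m + n) x)"
  then have A: "A \<in> sets N" using h_sets[OF x] by simp
  have A'[measurable]: "A \<in> sets M" by (rule N_setsD[OF A])
  let ?I = "\<lambda>n x. \<integral>\<^sup>+y. ennreal (\<eta> y) * indicator A y \<partial>p n x"
  have Im: "?I n \<in> borel_measurable M" for n by (rule nn_measurable) measurable
  have "emeasure (h m x \<bind> h n) A = (\<integral>\<^sup>+y. emeasure (h n y) A \<partial>h m x)"
    by (rule emeasure_bind_prob_algebra[OF hm h_measurable A])
  also have "\<dots> = tilt_factor m x * (\<integral>\<^sup>+y. ennreal (\<eta> y) * (emeasure (h n y) A * indicator E' y) \<partial>p m x)"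
    by (rule nn_h[OF x]) (rule measurable_compose[OF measurable_prob_algebraD[OF h_measurable] measurable_emeasure_subprob_algebra[OF A]])
  also have "(\<integral>\<^sup>+y. ennreal (\<eta> y) * (emeasure (h n y) A * indicator E' y) \<partial>p m x) = (\<integral>\<^sup>+y. ennreal (1 / \<theta>0 ^ n) * ?I n y \<partial>p m x)"
  proof (rule nn_integral_cong)
    fix y assume "y \<in> space (p m x)"
    then have y: "y \<in> space M" using kernel_space[OF xs] by simp
    show "ennreal (\<eta> y) * (emeasure (h n y) A * indicator E' y) = ennreal (1 / \<theta>0 ^ n) * ?I n y"
    proof (cases "y \<in> E'")
      case True
      have "ennreal (\<eta> y) * tilt_factor n y = ennreal (1 / \<theta>0 ^ n)"
        using E'D[OF True] const by (simp add: ennreal_mult[symmetric])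
      then show ?thesis using True emeasure_h[OF True A] by (simp add: mult.assoc[symmetric])
    qed (use eta_vanish[OF y] in simp)
  qed
  also have "\<dots> = ennreal (1 / \<theta>0 ^ n) * (\<integral>\<^sup>+y. ?I n y \<partial>p m x)"
    by (rule nn_integral_cmult) (use Im in \<open>simp add: measurable_cong_sets[OF kernel_sets[OF xs] refl]\<close>)
  also have "(\<integral>\<^sup>+y. ?I n y \<partial>p m x) = ?I (m + n) x"
    by (rule nn_semigroup[symmetric]) (use xs in auto)
  also have "tilt_factor m x * (ennreal (1 / \<theta>0 ^ n) * ?I (m + n) x) = emeasure (h (m + n) x) A"
    unfolding emeasure_h[OF x A] mult.assoc[symmetric]
    using E'D[OF x] const by (simp add: ennreal_mult[symmetric] power_add ac_simps)
  finally show "emeasure (h (m + n) x) A = emeasure (h m x \<bind> h n) A" by simp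
qed

lemma h_init: assumes x: "x \<in> E'" shows "h 0 x = return N x"
proof (rule measure_eqI)
  show "sets (h 0 x) = sets (return N x)" using h_sets[OF x] by simp
  fix A assume "A \<in> sets (h 0 x)"
  then have A: "A \<in> sets N" using h_sets[OF x] by simp
  have A'[measurable]: "A \<in> sets M" by (rule N_setsD[OF A])
  show "emeasure (h 0 x) A = emeasure (return N x) A"
    using E'D[OF x] A unfolding emeasure_h[OF x A]
    by (subst nn_init) (auto simp: ennreal_mult[symmetric] split: split_indicator)
qed

lemma V_measurable: "V \<in> borel_measurable N"
  unfolding V_def N_def by (rule measurable_restrict_space1) measurable

lemma V_lower: "x \<in> E' \<Longrightarrow> 1 / surv_const \<le> V x"
  using eta_bound[of x] E'D[of x] surv_const_ge unfolding V_def by (simp add: field_simps)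

lemma eta_V: "x \<in> E' \<Longrightarrow> ennreal (\<eta> x) * ennreal (V x) = ennreal (\<phi>1 x)"
  using E'D[of x] \<phi>1_pos[of x] by (simp add: V_def ennreal_mult[symmetric])

text \<open>The factor \<open>\<eta>\<close> of the tilt cancels the denominator of \<open>V\<close>, so the drift of \<open>\<phi>1\<close> under \<open>p 1\<close> is inherited
  after division by \<open>\<theta>0 * \<eta> x\<close>; on \<open>K\<close> this denominator is bounded away from zero.\<close>

lemma V_drift:
  assumes x: "x \<in> E'" and e: "0 < e" "\<And>x. x \<in> K \<Longrightarrow> e \<le> \<eta> x"
  shows "(\<integral>\<^sup>+y. ennreal (V y) \<partial>h 1 x) \<le> ennreal (\<theta>1 / \<theta>0 * V x + c2 / (\<theta>0 * e) * indicator K x)"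
proof -
  note xs = E'D[OF x]
  have "(\<integral>\<^sup>+y. ennreal (V y) \<partial>h 1 x)
      = ennreal (1 / (\<theta>0 * \<eta> x)) * (\<integral>\<^sup>+y. ennreal (\<eta> y) * (ennreal (V y) * indicator E' y) \<partial>p 1 x)"
    using nn_h[OF x, of "\<lambda>y. ennreal (V y)" 1] V_measurable by simp
  also have "\<dots> \<le> ennreal (1 / (\<theta>0 * \<eta> x)) * (\<integral>\<^sup>+y. ennreal (\<phi>1 y) \<partial>p 1 x)"
    by (intro mult_left_mono nn_integral_mono) (use eta_V in \<open>auto split: split_indicator\<close>)
  also have "\<dots> \<le> ennreal (1 / (\<theta>0 * \<eta> x)) * ennreal (\<theta>1 * \<phi>1 x + c2 * indicator K x)"
    by (intro mult_left_mono lyapunov xs) simp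
  also have "\<dots> = ennreal ((\<theta>1 * \<phi>1 x + c2 * indicator K x) / (\<theta>0 * \<eta> x))"
    using const xs \<phi>1_pos[OF xs(1)] by (subst ennreal_mult[symmetric]) (auto split: split_indicator)
  also have "\<dots> \<le> ennreal (\<theta>1 / \<theta>0 * V x + c2 / (\<theta>0 * e) * indicator K x)"
  proof (rule ennreal_leI)
    have "c2 * indicator K x / (\<theta>0 * \<eta> x) \<le> c2 / (\<theta>0 * e) * indicator K x"
      using e const xs by (auto intro!: divide_left_mono mult_left_mono split: split_indicator)
    then show "(\<theta>1 * \<phi>1 x + c2 * indicator K x) / (\<theta>0 * \<eta> x) \<le> \<theta>1 / \<theta>0 * V x + c2 / (\<theta>0 * e) * indicator K x"
      by (simp add: V_def add_divide_distrib)
  qed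
  finally show ?thesis .
qed

text \<open>The minorizing measure is \<open>c1 * \<nu>\<close> with density \<open>\<eta> / (\<theta>0 ^ n1 * H)\<close>, where \<open>H\<close> is an upper bound of \<open>\<eta>\<close> on \<open>K\<close>.
  It charges \<open>K\<close> because \<open>\<eta>\<close> is positive there.\<close>

lemma h_minorization:
  obtains \<rho> where "sets \<rho> = sets N" "0 < emeasure \<rho> K"
    "\<And>x A. x \<in> K \<Longrightarrow> A \<in> sets N \<Longrightarrow> emeasure \<rho> A \<le> emeasure (h n1 x) A"
proof -
  interpret \<nu>: prob_space \<nu> by (rule \<nu>_prob)
  have sp\<nu>: "space \<nu> = K" using sets_eq_imp_space_eq[OF \<nu>_sets] K_space by (auto simp: space_restrict_space)
  define H where "H = surv_const * h1"
  have etaH: "\<eta> x \<le> H" if "x \<in> K" for x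
  proof -
    have "\<eta> x \<le> surv_const * \<phi>1 x" by (rule eta_bound[OF K_space[OF that]])
    also have "\<dots> \<le> surv_const * h1" using surv_const_ge \<phi>1_K[OF that] by (intro mult_left_mono) auto
    finally show ?thesis by (simp add: H_def)
  qed
  obtain y where "y \<in> K" using \<pi>_K by (cases "K = {}") auto
  then have H: "0 < H" using etaH eta_pos_K by force
  define \<nu>' where "\<nu>' = distr \<nu> M (\<lambda>x. x)"
  have id: "(\<lambda>x. x) \<in> \<nu> \<rightarrow>\<^sub>M M"
    unfolding measurable_cong_sets[OF \<nu>_sets refl] by (rule measurable_restrict_space1) simp
  have s\<nu>'[measurable_cong]: "sets \<nu>' = sets M" by (simp add: \<nu>'_def)
  have em\<nu>': "emeasure \<nu>' A = ennreal (measure \<nu> (A \<inter> K))" if "A \<in> sets M" for A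
    using that id unfolding \<nu>'_def by (subst emeasure_distr) (auto simp: sp\<nu> \<nu>.emeasure_eq_measure)
  define \<rho>0 where "\<rho>0 = density (scale_measure (ennreal c1) \<nu>') (\<lambda>y. ennreal (\<eta> y / (\<theta>0 ^ n1 * H)))"
  have em\<rho>0: "emeasure \<rho>0 A = (\<integral>\<^sup>+y. ennreal (\<eta> y / (\<theta>0 ^ n1 * H)) * indicator A y \<partial>scale_measure (ennreal c1) \<nu>')"
    if "A \<in> sets M" for A
    unfolding \<rho>0_def using that by (subst emeasure_density) (auto simp: s\<nu>')
  define \<rho> where "\<rho> = restrict_space \<rho>0 E'"
  have em\<rho>: "emeasure \<rho> A = emeasure \<rho>0 A" if "A \<in> sets N" for A
    unfolding \<rho>_def using N_setsD[OF that] by (intro emeasure_restrict_space) (auto simp: \<rho>0_def s\<nu>')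
  have KN: "K \<in> sets N" using K_E' by (intro N_setsI) auto
  show thesis
  proof (rule that)
    show "sets \<rho> = sets N" unfolding \<rho>_def N_def by (rule sets_restrict_space_cong) (simp add: \<rho>0_def s\<nu>')
    show "0 < emeasure \<rho> K"
    proof (rule ccontr)
      assume "\<not> ?thesis"
      then have "emeasure \<rho>0 K = 0" using em\<rho>[OF KN] by simp
      then have "(\<integral>\<^sup>+y. ennreal (\<eta> y / (\<theta>0 ^ n1 * H)) * indicator K y \<partial>scale_measure (ennreal c1) \<nu>') = 0"
        using em\<rho>0[OF K_sets] by simp
      then have "ennreal c1 * (\<integral>\<^sup>+y. ennreal (\<eta> y / (\<theta>0 ^ n1 * H)) * indicator K y \<partial>\<nu>') = 0"
        by (subst (asm) nn_integral_scale_measure) auto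
      then have "(\<integral>\<^sup>+y. ennreal (\<eta> y / (\<theta>0 ^ n1 * H)) * indicator K y \<partial>\<nu>') = 0"
        using const by simp
      then have "AE y in \<nu>'. ennreal (\<eta> y / (\<theta>0 ^ n1 * H)) * indicator K y = 0"
        by (subst (asm) nn_integral_0_iff_AE) auto
      moreover have "ennreal (\<eta> y / (\<theta>0 ^ n1 * H)) \<noteq> 0" if "y \<in> K" for y
      proof -
        have "0 < \<eta> y / (\<theta>0 ^ n1 * H)" using eta_pos_K[OF that] H const by simp
        then show ?thesis by (simp add: ennreal_eq_0_iff)
      qed
      ultimately have "AE y in \<nu>'. y \<notin> K"
        by (auto elim!: eventually_mono)
      then have "emeasure \<nu>' K = 0"
        using AE_iff_null_sets[of K \<nu>'] s\<nu>' by (simp add: null_sets_def)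
      then show False using em\<nu>'[OF K_sets] \<nu>.prob_space sp\<nu> by simp
    qed
    fix x A assume x: "x \<in> K" and A: "A \<in> sets N"
    have xE: "x \<in> E'" and xs: "x \<in> space M" using K_E'[OF x] K_space[OF x] by auto
    have A'[measurable]: "A \<in> sets M" by (rule N_setsD[OF A])
    have "emeasure \<rho> A = (\<integral>\<^sup>+y. ennreal (\<eta> y / (\<theta>0 ^ n1 * H)) * indicator A y \<partial>scale_measure (ennreal c1) \<nu>')"
      using em\<rho>[OF A] em\<rho>0[OF A'] by simp
    also have "\<dots> \<le> (\<integral>\<^sup>+y. ennreal (\<eta> y / (\<theta>0 ^ n1 * H)) * indicator A y \<partial>p n1 x)"
    proof (rule nn_integral_mono_measure)
      show s: "sets (scale_measure (ennreal c1) \<nu>') = sets (p n1 x)" using s\<nu>' kernel_sets[OF xs] by simp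
      show "scale_measure (ennreal c1) \<nu>' \<le> p n1 x"
        unfolding le_measure[OF s]
      proof
        fix B assume "B \<in> sets (scale_measure (ennreal c1) \<nu>')"
        then have B: "B \<in> sets M" by (simp add: s\<nu>')
        show "emeasure (scale_measure (ennreal c1) \<nu>') B \<le> emeasure (p n1 x) B"
          using minorization[OF x B] em\<nu>'[OF B] kernel_emeasure[OF xs] const
          by (simp add: ennreal_mult[symmetric] ennreal_leI)
      qed
    qed
    also have "\<dots> \<le> (\<integral>\<^sup>+y. tilt_factor n1 x * (ennreal (\<eta> y) * indicator A y) \<partial>p n1 x)"
    proof (rule nn_integral_mono)
      fix y assume "y \<in> space (p n1 x)"
      then have y: "0 \<le> \<eta> y" using eta_nonneg kernel_space[OF xs] by simp
      have "\<eta> y / (\<theta>0 ^ n1 * H) \<le> \<eta> y / (\<theta>0 ^ n1 * \<eta> x)"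
        using y const E'D[OF xE] etaH[OF x] H by (intro divide_left_mono mult_left_mono) auto
      then show "ennreal (\<eta> y / (\<theta>0 ^ n1 * H)) * indicator A y \<le> tilt_factor n1 x * (ennreal (\<eta> y) * indicator A y)"
        using y const E'D[OF xE] by (auto simp: ennreal_mult[symmetric] intro!: ennreal_leI split: split_indicator)
    qed
    also have "\<dots> = emeasure (h n1 x) A"
      unfolding emeasure_h[OF xE A]
      by (rule nn_integral_cmult) (use kernel_sets[OF xs] in \<open>simp add: measurable_cong_sets[OF kernel_sets[OF xs] refl]\<close>)
    finally show "emeasure \<rho> A \<le> emeasure (h n1 x) A" .
  qed
qed

lemma h_aperiodic:
  assumes x: "x \<in> K"
  shows "\<exists>m. \<forall>n\<ge>m. 0 < emeasure (h n x) K"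
proof -
  obtain e where e: "0 < e" "\<And>x. x \<in> K \<Longrightarrow> e \<le> \<eta> x" using eta_lower_K by blast
  have xE: "x \<in> E'" and xs: "x \<in> space M" using K_E'[OF x] K_space[OF x] by auto
  have KN: "K \<in> sets N" using K_E' by (intro N_setsI) auto
  obtain m where m: "\<And>n. n \<ge> m \<Longrightarrow> 0 < measure (p n x) K" using aperiodic[OF x] by blast
  have "0 < emeasure (h n x) K" if "n \<ge> m" for n
  proof -
    have "0 < ennreal e * emeasure (p n x) K"
      using e(1) m[OF that] kernel_emeasure[OF xs] by (simp add: ennreal_mult[symmetric])
    also have "\<dots> = (\<integral>\<^sup>+y. ennreal e * indicator K y \<partial>p n x)"
      using kernel_sets[OF xs] by (subst nn_integral_cmult_indicator) auto
    also have "\<dots> \<le> (\<integral>\<^sup>+y. ennreal (\<eta> y) * indicator K y \<partial>p n x)"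
      by (rule nn_integral_mono) (use e in \<open>auto intro!: ennreal_leI split: split_indicator\<close>)
    finally show ?thesis
      unfolding emeasure_h[OF xE KN] using E'D[OF xE] const by (simp add: ennreal_zero_less_mult_iff)
  qed
  then show ?thesis by blast
qed

lemma \<beta>_prob: "prob_space \<beta>"
proof
  have "emeasure \<beta> (space \<beta>) = (\<integral>\<^sup>+x. 1 \<partial>\<beta>)" by simp
  also have "\<dots> = (\<integral>\<^sup>+x. ennreal (\<eta> x) * (1 * indicator E' x) \<partial>\<pi>)" by (rule nn_\<beta>) simp
  also have "\<dots> = (\<integral>\<^sup>+x. ennreal (\<eta> x) \<partial>\<pi>)"
    by (rule nn_integral_cong) (use eta_indicator[of _ 1] \<pi>_space in simp)
  finally show "emeasure \<beta> (space \<beta>) = 1" using \<pi>_eta by simp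
qed

lemma \<beta>_invariant: "\<beta> \<bind> h n = \<beta>"
proof (rule measure_eqI)
  have b: "\<beta> \<in> space (prob_algebra N)" using \<beta>_prob \<beta>_sets by (simp add: space_prob_algebra)
  show s: "sets (\<beta> \<bind> h n) = sets \<beta>" using sets_bind'[OF b h_measurable] \<beta>_sets by simp
  fix A assume "A \<in> sets (\<beta> \<bind> h n)"
  then have A: "A \<in> sets N" using s \<beta>_sets by simp
  have A'[measurable]: "A \<in> sets M" by (rule N_setsD[OF A])
  let ?I = "\<lambda>x. \<integral>\<^sup>+y. ennreal (\<eta> y) * indicator A y \<partial>p n x"
  have Im: "?I \<in> borel_measurable M" by (rule nn_measurable) measurable
  have "emeasure (\<beta> \<bind> h n) A = (\<integral>\<^sup>+y. emeasure (h n y) A \<partial>\<beta>)"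
    by (rule emeasure_bind_prob_algebra[OF b h_measurable A])
  also have "\<dots> = (\<integral>\<^sup>+y. ennreal (\<eta> y) * (emeasure (h n y) A * indicator E' y) \<partial>\<pi>)"
    by (rule nn_\<beta>) (rule measurable_compose[OF measurable_prob_algebraD[OF h_measurable] measurable_emeasure_subprob_algebra[OF A]])
  also have "\<dots> = (\<integral>\<^sup>+y. ennreal (1 / \<theta>0 ^ n) * ?I y \<partial>\<pi>)"
  proof (rule nn_integral_cong)
    fix y assume "y \<in> space \<pi>"
    then have y: "y \<in> space M" using \<pi>_space by simp
    show "ennreal (\<eta> y) * (emeasure (h n y) A * indicator E' y) = ennreal (1 / \<theta>0 ^ n) * ?I y"
    proof (cases "y \<in> E'")
      case True
      have "ennreal (\<eta> y) * tilt_factor n y = ennreal (1 / \<theta>0 ^ n)"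
        using E'D[OF True] const by (simp add: ennreal_mult[symmetric])
      then show ?thesis using True emeasure_h[OF True A] by (simp add: mult.assoc[symmetric])
    qed (use eta_vanish[OF y] in simp)
  qed
  also have "\<dots> = ennreal (1 / \<theta>0 ^ n) * (\<integral>\<^sup>+y. ?I y \<partial>\<pi>)"
    by (rule nn_integral_cmult) (use Im in \<open>simp add: measurable_cong_sets[OF \<pi>_sets refl]\<close>)
  also have "(\<integral>\<^sup>+y. ?I y \<partial>\<pi>) = ennreal (\<theta>0 ^ n) * (\<integral>\<^sup>+x. ennreal (\<eta> x) * indicator A x \<partial>\<pi>)"
    by (rule qsd_nn) measurable
  also have "ennreal (1 / \<theta>0 ^ n) * \<dots> = (\<integral>\<^sup>+x. ennreal (\<eta> x) * indicator A x \<partial>\<pi>)"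
    using const by (simp add: mult.assoc[symmetric] ennreal_mult[symmetric])
  also have "\<dots> = (\<integral>\<^sup>+x. ennreal (\<eta> x) * (indicator A x * indicator E' x) \<partial>\<pi>)"
    by (rule nn_integral_cong) (use eta_indicator \<pi>_space in simp)
  also have "\<dots> = (\<integral>\<^sup>+x. indicator A x \<partial>\<beta>)" using A by (intro nn_\<beta>[symmetric]) simp
  also have "\<dots> = emeasure \<beta> A" using A \<beta>_sets by simp
  finally show "emeasure (\<beta> \<bind> h n) A = emeasure \<beta> A" .
qed

lemma \<beta>_V: "(\<integral>\<^sup>+x. ennreal (V x) \<partial>\<beta>) < \<infinity>"
proof -
  have "(\<integral>\<^sup>+x. ennreal (V x) \<partial>\<beta>) = (\<integral>\<^sup>+x. ennreal (\<eta> x) * (ennreal (V x) * indicator E' x) \<partial>\<pi>)"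
    by (rule nn_\<beta>) (use V_measurable in simp)
  also have "\<dots> \<le> (\<integral>\<^sup>+x. ennreal (\<phi>1 x) \<partial>\<pi>)"
    by (rule nn_integral_mono) (use eta_V in \<open>auto split: split_indicator\<close>)
  finally show ?thesis using \<pi>_\<phi>1 by (rule le_less_trans)
qed

theorem tilted_harris_chain: "\<exists>\<gamma> b v \<rho>. harris_chain N h V \<gamma> b v K n1 \<rho> \<beta>"
proof -
  obtain e where e: "0 < e" "\<And>x. x \<in> K \<Longrightarrow> e \<le> \<eta> x" using eta_lower_K by blast
  obtain \<rho> where \<rho>: "sets \<rho> = sets N" "0 < emeasure \<rho> K"
    "\<And>x A. x \<in> K \<Longrightarrow> A \<in> sets N \<Longrightarrow> emeasure \<rho> A \<le> emeasure (h n1 x) A"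
    using h_minorization by blast
  have "harris_chain N h V (\<theta>1 / \<theta>0) (c2 / (\<theta>0 * e)) (1 / surv_const) K n1 \<rho> \<beta>"
  proof (rule harris_chain.intro[OF kernel_semigroup.intro harris_chain_axioms.intro])
    show "h n \<in> N \<rightarrow>\<^sub>M subprob_algebra N" for n by (rule measurable_prob_algebraD[OF h_measurable])
    show "h 0 x = return N x" if "x \<in> space N" for x using h_init that by (simp add: space_N)
    show "h (m + n) x = h m x \<bind> h n" if "x \<in> space N" for x m n
      using h_semigroup that by (simp add: space_N)
    show "prob_space (h n x)" if "x \<in> space N" for x n
      using measurable_space[OF h_measurable that] by (simp add: space_prob_algebra)
    show "V \<in> borel_measurable N" by (rule V_measurable)
    show "0 < 1 / surv_const" using surv_const_ge by simp
    show "1 / surv_const \<le> V x" if "x \<in> space N" for x using V_lower that by (simp add: space_N)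
    show "0 \<le> \<theta>1 / \<theta>0" "\<theta>1 / \<theta>0 < 1" "0 < c2 / (\<theta>0 * e)" using const rate_less e(1) by auto
    show "K \<in> sets N" using K_E' by (intro N_setsI) auto
    show "(\<integral>\<^sup>+y. ennreal (V y) \<partial>h 1 x) \<le> ennreal (\<theta>1 / \<theta>0 * V x + c2 / (\<theta>0 * e) * indicator K x)"
      if "x \<in> space N" for x using V_drift[OF _ e] that by (simp add: space_N)
    show "\<exists>m. \<forall>n\<ge>m. 0 < emeasure (h n x) K" if "x \<in> K" for x by (rule h_aperiodic[OF that])
  qed (fact \<rho> \<beta>_prob \<beta>_sets \<beta>_invariant \<beta>_V)+
  then show ?thesis by blast
qed


lemma eta_tilt:
  assumes y: "y \<in> space M" and A: "A \<in> sets M"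
  shows "(\<integral>\<^sup>+z. ennreal (\<eta> z) * indicator A z \<partial>p t y)
    = ennreal (\<theta>0 ^ t) * (ennreal (\<eta> y) * (indicator E' y * emeasure (tilt t y) A))"
proof (cases "y \<in> E'")
  case True
  have "ennreal (\<theta>0 ^ t) * (ennreal (\<eta> y) * tilt_factor t y) = 1"
    using const E'D[OF True] by (simp add: ennreal_mult[symmetric])
  then show ?thesis
    unfolding emeasure_tilt[OF True A] using True by (simp add: mult.assoc[symmetric])
next
  case False
  then show ?thesis using eta_vanish[OF y False] by simp
qed

lemma tilt_init: assumes x: "x \<in> E'" shows "tilt 0 x = return M x"
proof (rule measure_eqI)
  show "sets (tilt 0 x) = sets (return M x)" using tilt_sets[OF E'D(1)[OF x]] by simp
  fix A assume "A \<in> sets (tilt 0 x)"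
  then have A[measurable]: "A \<in> sets M" using tilt_sets[OF E'D(1)[OF x]] by simp
  show "emeasure (tilt 0 x) A = emeasure (return M x) A"
    using E'D[OF x] A unfolding emeasure_tilt[OF x A]
    by (subst nn_init) (auto simp: ennreal_mult[symmetric] split: split_indicator)
qed

text \<open>The tilted kernel extended to a Markov kernel on the whole state space, so that path laws live on sequences of
  arbitrary states; points outside \<open>E'\<close> are frozen.\<close>

definition \<kappa> where "\<kappa> y = (if y \<in> E' then tilt 1 y else return M y)"

lemma \<kappa>_measurable: "\<kappa> \<in> M \<rightarrow>\<^sub>M prob_algebra M"
  unfolding \<kappa>_def
proof (subst measurable_If_restrict_space_iff)
  show "{x \<in> space M. x \<in> E'} \<in> sets M" by measurable
  have "{x. x \<in> E'} = E'" by simp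
  then show "tilt 1 \<in> restrict_space M {x. x \<in> E'} \<rightarrow>\<^sub>M prob_algebra M \<and>
      return M \<in> restrict_space M {x. x \<notin> E'} \<rightarrow>\<^sub>M prob_algebra M"
    using tilt_measurable by (auto simp: N_def intro!: measurable_restrict_space1)
qed

lemma eta_\<kappa>:
  assumes y: "y \<in> space M" and A: "A \<in> sets M"
  shows "ennreal (\<eta> y) * (indicator E' y * emeasure (tilt 1 y) A) = ennreal (\<eta> y) * emeasure (\<kappa> y) A"
  using eta_outside[OF y] by (simp add: \<kappa>_def indicator_def)

end

section \<open>Markov laws on path space\<close>

text \<open>The theorem of Ionescu-Tulcea for a homogeneous kernel.  Over an arbitrary measurable space it provides a
  measure on sequences as soon as each finite-dimensional law is obtained from the previous one by one step
  of the kernel.\<close>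

lemma markov_law_extends:
  fixes \<kappa> :: "'a \<Rightarrow> 'a measure" and law :: "nat \<Rightarrow> (nat \<Rightarrow> 'a) measure"
  assumes \<kappa>: "\<kappa> \<in> M \<rightarrow>\<^sub>M prob_algebra M" and x: "x \<in> space M"
    and law_0: "law 0 = return (PiM {0..<Suc 0} (\<lambda>_. M)) (\<lambda>i\<in>{0..<Suc 0}. x)"
    and law_Suc: "\<And>m. law (Suc m) = law m \<bind>
      (\<lambda>\<omega>. distr (\<kappa> (\<omega> m)) (PiM {0..<Suc (Suc m)} (\<lambda>_. M)) (fun_upd \<omega> (Suc m)))"
  obtains Q where "prob_space Q" "sets Q = sets (PiM UNIV (\<lambda>_. M))"
    "\<And>m. distr Q (PiM {0..<Suc m} (\<lambda>_. M)) (\<lambda>\<omega>. restrict \<omega> {0..<Suc m}) = law m"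
proof -
  define P where "P i \<omega> = (if i = 0 then return M x else \<kappa> (\<omega> (i - 1)))" for i :: nat and \<omega> :: "nat \<Rightarrow> 'a"
  have \<kappa>_prob: "prob_space (\<kappa> y)" "sets (\<kappa> y) = sets M" if "y \<in> space M" for y
    using measurable_space[OF \<kappa> that] by (auto simp: space_prob_algebra)
  interpret IT: Ionescu_Tulcea P "\<lambda>_. M"
  proof (rule Ionescu_Tulcea.intro)
    show "P i \<in> PiM {0..<i} (\<lambda>_. M) \<rightarrow>\<^sub>M subprob_algebra M" for i
    proof (cases "i = 0")
      case True
      have "return M x \<in> space (subprob_algebra M)"
        using x by (simp add: space_subprob_algebra prob_space_return prob_space_imp_subprob_space)
      then show ?thesis unfolding P_def True by simp
    next
      case False
      have "(\<lambda>\<omega>. \<omega> (i - 1)) \<in> PiM {0..<i} (\<lambda>_. M) \<rightarrow>\<^sub>M M"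
        using False by (intro measurable_component_singleton) auto
      then have "(\<lambda>\<omega>. \<kappa> (\<omega> (i - 1))) \<in> PiM {0..<i} (\<lambda>_. M) \<rightarrow>\<^sub>M subprob_algebra M"
        by (rule measurable_compose[OF _ measurable_prob_algebraD[OF \<kappa>]])
      then show ?thesis unfolding P_def using False by simp
    qed
    show "prob_space (P i \<omega>)" if "\<omega> \<in> space (PiM {0..<i} (\<lambda>_. M))" for i \<omega>
      using that x \<kappa>_prob(1) unfolding P_def by (auto simp: space_PiM PiE_iff prob_space_return)
  qed
  let ?u = "(\<lambda>_. undefined) :: nat \<Rightarrow> 'a"
  have C: "IT.C 0 (Suc m) ?u = law m" for m
  proof (induction m)
    case 0
    have u: "?u \<in> space (PiM {0..<0} (\<lambda>_. M))" by (auto simp: space_PiM PiE_iff extensional_def)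
    have "IT.C 0 (Suc 0) ?u = IT.eP 0 ?u"
      using bind_return[OF IT.measurable_eP u] by simp
    also have "\<dots> = distr (return M x) (PiM {0..<Suc 0} (\<lambda>_. M)) (fun_upd ?u 0)"
      by (simp add: IT.eP_def P_def)
    also have "\<dots> = return (PiM {0..<Suc 0} (\<lambda>_. M)) (fun_upd ?u 0 x)"
    proof (rule distr_return[OF _ x])
      show "fun_upd ?u 0 \<in> M \<rightarrow>\<^sub>M PiM {0..<Suc 0} (\<lambda>_. M)"
        by (rule measurable_fun_upd[where J="{}"]) (auto simp: space_PiM PiE_iff extensional_def)
    qed
    also have "fun_upd ?u 0 x = (\<lambda>i\<in>{0..<Suc 0}. x)" by auto
    finally show ?case unfolding law_0 .
  next
    case (Suc m)
    have "IT.C 0 (Suc (Suc m)) ?u = law m \<bind> IT.eP (Suc m)"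
      using Suc by simp
    also have "IT.eP (Suc m) = (\<lambda>\<omega>. distr (\<kappa> (\<omega> m)) (PiM {0..<Suc (Suc m)} (\<lambda>_. M)) (fun_upd \<omega> (Suc m)))"
      by (auto simp: IT.eP_def P_def fun_eq_iff)
    finally show ?case by (simp add: law_Suc)
  qed
  have up: "IT.up_to {0..<n} = n" for n
    using IT.up_to_iff[of "{0..<n}"] by (metis IT.up_to_iff_Ico antisym_conv atLeastLessThan_subset_iff finite_atLeastLessThan le0 linorder_not_le order_refl subset_refl)
  have u: "?u \<in> space (PiM {0..<0} (\<lambda>_. M))" by (auto simp: space_PiM PiE_iff extensional_def)
  have CI: "IT.CI {0..<Suc m} = law m" for m
    unfolding IT.CI_def up using IT.distr_C[of "Suc m" "Suc m" ?u 0] u C[of m] by simp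
  show thesis
  proof (rule that)
    show "prob_space IT.PF.lim"
    proof (rule prob_space_distrD)
      show "(\<lambda>\<omega>. restrict \<omega> {0..<Suc 0}) \<in> IT.PF.lim \<rightarrow>\<^sub>M PiM {0..<Suc 0} (\<lambda>_. M)"
        by (simp add: measurable_cong_sets[OF IT.PF.sets_lim refl] measurable_restrict_subset)
      show "prob_space (distr IT.PF.lim (PiM {0..<Suc 0} (\<lambda>_. M)) (\<lambda>\<omega>. restrict \<omega> {0..<Suc 0}))"
        unfolding IT.distr_lim[OF finite_atLeastLessThan] CI law_0
        using x by (intro prob_space_return) (auto simp: space_PiM)
    qed
    show "sets IT.PF.lim = sets (PiM UNIV (\<lambda>_. M))" by simp
    show "distr IT.PF.lim (PiM {0..<Suc m} (\<lambda>_. M)) (\<lambda>\<omega>. restrict \<omega> {0..<Suc m}) = law m" for m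
      using IT.distr_lim[of "{0..<Suc m}"] CI[of m] by simp
  qed
qed

section \<open>The cemetery space and natural filtrations\<close>

lemma space_cemetery: "space (cemetery_space M) = insert None (Some ` space M)"
  unfolding cemetery_space_def by (rule space_measure_of) (use sets.sets_into_space in fastforce)

lemma sets_cemetery: "sets (cemetery_space M) = sigma_sets (insert None (Some ` space M)) (insert {None} ((`) Some ` sets M))"
  unfolding cemetery_space_def by (rule sets_measure_of) (use sets.sets_into_space in fastforce)

lemma cemetery_sets_None: "{None} \<in> sets (cemetery_space M)"
  unfolding sets_cemetery by auto

lemma cemetery_sets_Some: "A \<in> sets M \<Longrightarrow> Some ` A \<in> sets (cemetery_space M)"
  unfolding sets_cemetery by auto

lemma measurable_Some: "Some \<in> M \<rightarrow>\<^sub>M cemetery_space M"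
proof -
  have a: "insert {None} ((`) Some ` sets M) \<subseteq> Pow (insert None (Some ` space M))"
    using sets.sets_into_space[of _ M] by blast
  have b: "Some \<in> space M \<rightarrow> insert None (Some ` space M)" by auto
  have c: "Some -` A \<inter> space M \<in> sets M" if "A \<in> insert {None} ((`) Some ` sets M)" for A
  proof -
    from that consider "A = {None}" | B where "B \<in> sets M" "A = Some ` B" by blast
    then show ?thesis
    proof cases
      case 1
      have "Some -` A \<inter> space M = {}" unfolding 1 by blast
      then show ?thesis by simp
    next
      case 2
      have "Some -` A = B" unfolding 2(2) by blast
      with 2(1) show ?thesis by simp
    qed
  qed
  show ?thesis unfolding cemetery_space_def by (rule measurable_measure_of[OF a b c])
qed

lemma measurable_case_cemetery:
  assumes f: "f \<in> M \<rightarrow>\<^sub>M L" and a: "a \<in> space L"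
  shows "(\<lambda>z. case z of None \<Rightarrow> a | Some y \<Rightarrow> f y) \<in> cemetery_space M \<rightarrow>\<^sub>M L"
proof (rule measurableI)
  fix z assume "z \<in> space (cemetery_space M)"
  then show "(case z of None \<Rightarrow> a | Some y \<Rightarrow> f y) \<in> space L"
    using a measurable_space[OF f] by (auto simp: space_cemetery)
next
  fix B assume B: "B \<in> sets L"
  have "(\<lambda>z. case z of None \<Rightarrow> a | Some y \<Rightarrow> f y) -` B \<inter> space (cemetery_space M)
      = Some ` (f -` B \<inter> space M) \<union> (if a \<in> B then {None} else {})"
    by (auto simp: space_cemetery split: option.splits)
  also have "\<dots> \<in> sets (cemetery_space M)"
  proof (cases "a \<in> B")
    case True
    show ?thesis
      unfolding if_P[OF True]
      by (rule sets.Un[OF cemetery_sets_Some[OF measurable_sets[OF f B]] cemetery_sets_None])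
  next
    case False
    then show ?thesis using cemetery_sets_Some[OF measurable_sets[OF f B]] by simp
  qed
  finally show "(\<lambda>z. case z of None \<Rightarrow> a | Some y \<Rightarrow> f y) -` B \<inter> space (cemetery_space M) \<in> sets (cemetery_space M)" .
qed

lemma space_natural_filtration: 
  assumes "\<And>u. u \<in> T \<Longrightarrow> X u \<in> \<Omega> \<rightarrow>\<^sub>M S"
  shows "space (natural_filtration T S \<Omega> X t) = space \<Omega>"
  unfolding natural_filtration_def by (rule space_measure_of) auto

lemma sets_natural_filtration_le:
  assumes "\<And>u. u \<in> T \<Longrightarrow> X u \<in> \<Omega> \<rightarrow>\<^sub>M S"
  shows "sets (natural_filtration T S \<Omega> X t) \<subseteq> sets \<Omega>"
  unfolding natural_filtration_def
  by (subst sets_measure_of) (use assms measurable_sets in \<open>auto intro!: sets.sigma_sets_subset\<close>)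

lemma measurable_natural_filtration:
  assumes m: "\<And>u. u \<in> T \<Longrightarrow> X u \<in> \<Omega> \<rightarrow>\<^sub>M S" and u: "u \<in> T" "u \<le> t"
  shows "X u \<in> natural_filtration T S \<Omega> X t \<rightarrow>\<^sub>M S"
proof (rule measurableI)
  show "X u w \<in> space S" if "w \<in> space (natural_filtration T S \<Omega> X t)" for w
    using that measurable_space[OF m[OF u(1)]] space_natural_filtration[where t=t, OF m] by auto
  fix A assume A: "A \<in> sets S"
  have "X u -` A \<inter> space \<Omega> \<in> sets (natural_filtration T S \<Omega> X t)"
    unfolding natural_filtration_def
    by (subst sets_measure_of) (use A u in \<open>auto intro!: sigma_sets.Basic\<close>)
  then show "X u -` A \<inter> space (natural_filtration T S \<Omega> X t) \<in> sets (natural_filtration T S \<Omega> X t)"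
    using space_natural_filtration[where t=t, OF m] by simp
qed

text \<open>Events of the canonical filtration depend only on the first coordinates, in a measurable way.  This is what
  gives a meaning to the set of finite trajectories that defines an event.\<close>

lemma canonical_filtration_cylinder:
  assumes A: "A \<in> sets (canonical_filtration M m)"
  obtains C where "C \<in> sets (PiM {0..<Suc m} (\<lambda>_. M))"
    "A = {\<omega> \<in> space (path_space M). restrict \<omega> {0..<Suc m} \<in> C}"
proof -
  let ?S = "space (path_space M)"
  let ?r = "\<lambda>\<omega>::nat \<Rightarrow> 'a. restrict \<omega> {0..<Suc m}"
  let ?P = "PiM {0..<Suc m} (\<lambda>_. M)"
  let ?V = "vimage_algebra ?S ?r ?P"
  have r: "?r \<in> ?S \<rightarrow> space ?P" by (auto simp: path_space_def space_PiM PiE_iff)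
  have "sets (canonical_filtration M m) = sigma_sets ?S
      {coordinate u -` A \<inter> ?S | u A. u \<in> UNIV \<and> u \<le> m \<and> A \<in> sets M}"
    unfolding canonical_filtration_def natural_filtration_def by (rule sets_measure_of) auto
  also have "\<dots> \<subseteq> sets ?V"
  proof -
    have "coordinate u -` A \<inter> ?S \<in> sets ?V" if u: "u \<le> m" and A: "A \<in> sets M" for u A
    proof -
      have um: "u \<in> {0..<Suc m}" using u by simp
      have "{\<zeta> \<in> space ?P. \<zeta> u \<in> A} \<in> sets ?P"
        using measurable_sets[OF measurable_component_singleton[OF um, of "\<lambda>_. M"] A]
        by (simp add: vimage_def Int_def conj_commute)
      moreover have "coordinate u -` A \<inter> ?S = ?r -` {\<zeta> \<in> space ?P. \<zeta> u \<in> A} \<inter> ?S"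
        using r u by (auto simp: coordinate_def)
      ultimately show ?thesis unfolding sets_vimage_algebra2[OF r] by blast
    qed
    then show ?thesis
      using sets.sigma_sets_subset[of "{coordinate u -` A \<inter> ?S | u A. u \<in> UNIV \<and> u \<le> m \<and> A \<in> sets M}" ?V]
      by (auto simp: space_vimage_algebra)
  qed
  finally have "A \<in> sets ?V" using A by blast
  then obtain C where "C \<in> sets ?P" "A = ?r -` C \<inter> ?S"
    unfolding sets_vimage_algebra2[OF r] by blast
  then show thesis by (intro that[of C]) auto
qed

lemma measurable_coordinate: "coordinate n \<in> path_space M \<rightarrow>\<^sub>M M"
  unfolding path_space_def coordinate_def[abs_def] by measurable

section \<open>The killed kernel of an absorbed Markov process\<close>

locale absorbed_process =
  fixes T :: "real set" and M :: "'a measure" and \<Omega> :: "'w measure"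
    and X :: "real \<Rightarrow> 'w \<Rightarrow> 'a option" and P :: "'a option \<Rightarrow> 'w measure"
  assumes process: "absorbed_markov_process T M \<Omega> X P" and M_nonempty: "space M \<noteq> {}"
begin

abbreviation "S \<equiv> cemetery_space M"
abbreviation "F s \<equiv> natural_filtration T S \<Omega> X (real s)"

lemma markov_process: "homogeneous_markov_process T S (space S) \<Omega> X P"
  using process by (simp add: absorbed_markov_process_def)

lemma markov_property:
  assumes "x \<in> space S" "s \<in> T" "t \<in> T" "B \<in> sets (natural_filtration T S \<Omega> X s)" "A \<in> sets S"
  shows "measure (P x) {w \<in> B. X (s + t) w \<in> A} =
    (LINT w:{w \<in> B. X s w \<in> space S}|P x. measure (P (X s w)) {v \<in> space \<Omega>. X t v \<in> A})"
proof -
  have "\<forall>x\<in>space S. \<forall>s\<in>T. \<forall>t\<in>T. \<forall>B\<in>sets (natural_filtration T S \<Omega> X s). \<forall>A\<in>sets S.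
      measure (P x) {w \<in> B. X (s + t) w \<in> A} =
      (LINT w:{w \<in> B. X s w \<in> space S}|P x. measure (P (X s w)) {v \<in> space \<Omega>. X t v \<in> A})"
    using markov_process unfolding homogeneous_markov_process_def by (elim conjE)
  from this[rule_format, OF assms] show ?thesis .
qed

lemma nat_in_T: "real n \<in> T"
proof -
  consider "T = {0..}" | k :: nat where "k \<ge> 1" "T = range (\<lambda>j::nat. real j / real k)"
    using process unfolding absorbed_markov_process_def by blast
  then show ?thesis
  proof cases
    case 2
    then have "real n = real (n * k) / real k" by simp
    then show ?thesis using 2(2) by blast
  qed simp
qed

lemma X_measurable: "t \<in> T \<Longrightarrow> X t \<in> \<Omega> \<rightarrow>\<^sub>M S"
  using markov_process by (simp add: homogeneous_markov_process_def)

lemma X_nat_measurable[measurable]: "X (real n) \<in> \<Omega> \<rightarrow>\<^sub>M S"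
  by (rule X_measurable[OF nat_in_T])

lemma P_measurable: "(\<lambda>x. P (Some x)) \<in> M \<rightarrow>\<^sub>M prob_algebra \<Omega>"
proof -
  have "P \<in> restrict_space S (space S) \<rightarrow>\<^sub>M prob_algebra \<Omega>"
    using markov_process by (simp add: homogeneous_markov_process_def)
  moreover have "sets (restrict_space S (space S)) = sets S"
    by (simp add: sets_restrict_space_iff sets_restrict_space set_eq_iff image_iff)
  ultimately have "P \<in> S \<rightarrow>\<^sub>M prob_algebra \<Omega>"
    using measurable_cong_sets[of "restrict_space S (space S)" S "prob_algebra \<Omega>" "prob_algebra \<Omega>"] by simp
  then show ?thesis by (rule measurable_compose[OF measurable_Some])
qed

lemma P_prob: "x \<in> space M \<Longrightarrow> prob_space (P (Some x))"
  and P_sets: "x \<in> space M \<Longrightarrow> sets (P (Some x)) = sets \<Omega>"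
  using measurable_space[OF P_measurable] by (auto simp: space_prob_algebra)

lemma P_space: "x \<in> space M \<Longrightarrow> space (P (Some x)) = space \<Omega>"
  by (rule sets_eq_imp_space_eq[OF P_sets])

lemma P_start: "x \<in> space M \<Longrightarrow> distr (P (Some x)) S (X 0) = return S (Some x)"
  using markov_process by (simp add: homogeneous_markov_process_def space_cemetery)

lemma Some_in_S: "x \<in> space M \<Longrightarrow> Some x \<in> space S" by (simp add: space_cemetery)

text \<open>Almost sure absorption makes survival at integer times visible in the value of the process at that time, although
  the absorption time itself may fail to be measurable.\<close>

lemma alive_iff_AE:
  assumes x: "x \<in> space M"
  shows "AE w in P (Some x). \<forall>n. w \<in> alive T \<Omega> X n \<longleftrightarrow> X (real n) w \<noteq> None"
proof -
  have "AE w in P (Some x). \<forall>t\<in>T. absorption_time T X w \<le> ereal t \<longrightarrow> X t w = None"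
    using process Some_in_S[OF x] unfolding absorbed_markov_process_def by blast
  moreover have "AE w in P (Some x). w \<in> space \<Omega>"
    using AE_space[of "P (Some x)"] P_space[OF x] by simp
  ultimately show ?thesis
  proof eventually_elim
    case (elim w)
    show ?case
    proof (intro allI iffI)
      fix n assume "w \<in> alive T \<Omega> X n"
      then have "ereal (real n) < absorption_time T X w" by (simp add: alive_def)
      moreover have "absorption_time T X w \<le> ereal (real n)" if "X (real n) w = None"
        unfolding absorption_time_def using that nat_in_T by (intro Inf_lower) auto
      ultimately show "X (real n) w \<noteq> None" by (auto simp: not_less[symmetric])
    next
      fix n assume "X (real n) w \<noteq> None"
      then have "\<not> absorption_time T X w \<le> ereal (real n)" using elim(1) nat_in_T[of n] by auto
      then show "w \<in> alive T \<Omega> X n" using elim by (simp add: alive_def not_le)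
    qed
  qed
qed

lemma alive_antimono: "m \<le> n \<Longrightarrow> alive T \<Omega> X n \<subseteq> alive T \<Omega> X m"
  unfolding alive_def by (auto intro: le_less_trans[of _ "ereal (real n)"])

lemma absorbed_AE:
  assumes x: "x \<in> space M"
  shows "AE w in P (Some x). \<forall>m n. m \<le> n \<longrightarrow> X (real n) w \<noteq> None \<longrightarrow> X (real m) w \<noteq> None"
  using alive_iff_AE[OF x]
proof eventually_elim
  case (elim w)
  show ?case
  proof (intro allI impI)
    fix m n :: nat assume "m \<le> n" "X (real n) w \<noteq> None"
    then show "X (real m) w \<noteq> None" using elim alive_antimono[OF \<open>m \<le> n\<close>] by (metis subsetD)
  qed
qed

definition a0 where "a0 = (SOME y. y \<in> space M)"
text \<open>The trajectory at integer times as a path in the state space.  After absorption it is continued by an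
  arbitrary point \<open>a0\<close>; such values are always cut off by the indicator of \<open>live\<close>.\<close>

definition W where "W w n = (case X (real n) w of None \<Rightarrow> a0 | Some y \<Rightarrow> y)"
definition live where "live n = {w \<in> space \<Omega>. X (real n) w \<noteq> None}"

lemma a0: "a0 \<in> space M" unfolding a0_def using M_nonempty by (simp add: some_in_eq)

lemma F_space: "space (F s) = space \<Omega>"
  by (rule space_natural_filtration[OF X_measurable])

lemma F_sets: "B \<in> sets (F s) \<Longrightarrow> B \<in> sets \<Omega>"
  by (rule subsetD[OF sets_natural_filtration_le[OF X_measurable]])

lemma X_F: "k \<le> s \<Longrightarrow> X (real k) \<in> F s \<rightarrow>\<^sub>M S"
  by (rule measurable_natural_filtration[OF X_measurable nat_in_T]) auto

lemma W_F: "k \<le> s \<Longrightarrow> (\<lambda>w. W w k) \<in> F s \<rightarrow>\<^sub>M M"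
  unfolding W_def by (rule measurable_compose[OF X_F measurable_case_cemetery]) (auto simp: a0)

lemma W_measurable[measurable]: "(\<lambda>w. W w k) \<in> \<Omega> \<rightarrow>\<^sub>M M"
  unfolding W_def by (rule measurable_compose[OF X_nat_measurable measurable_case_cemetery]) (auto simp: a0)

lemma W_space: "w \<in> space \<Omega> \<Longrightarrow> W w k \<in> space M"
  by (rule measurable_space[OF W_measurable])

lemma live_F: "k \<le> s \<Longrightarrow> live k \<in> sets (F s)"
proof -
  assume k: "k \<le> s"
  have "live k = space (F s) - (X (real k) -` {None} \<inter> space (F s))"
    by (auto simp: live_def F_space)
  also have "\<dots> \<in> sets (F s)"
    by (rule sets.compl_sets[OF measurable_sets[OF X_F[OF k] cemetery_sets_None]])
  finally show ?thesis .
qed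

lemma live_sets[measurable]: "live k \<in> sets \<Omega>" using F_sets[OF live_F[of k k]] by simp

lemma live_eq: "w \<in> live k \<Longrightarrow> X (real k) w = Some (W w k)"
  by (auto simp: live_def W_def)

lemma hit_iff: "w \<in> space \<Omega> \<Longrightarrow> X (real k) w \<in> Some ` A \<longleftrightarrow> w \<in> live k \<and> W w k \<in> A"
  by (cases "X (real k) w") (auto simp: live_def W_def)

text \<open>The law of \<open>X n\<close> on survival, read on the state space without the cemetery.\<close>

definition p where
  "p n x = distr (density (P (Some x)) (\<lambda>w. ennreal (indicator (live n) w))) M (\<lambda>w. W w n)"

lemma p_sets: "sets (p n x) = sets M" by (simp add: p_def)

lemma nn_p:
  assumes x: "x \<in> space M" and f: "f \<in> borel_measurable M"
  shows "(\<integral>\<^sup>+y. f y \<partial>p n x) = (\<integral>\<^sup>+w. indicator (live n) w * f (W w n) \<partial>P (Some x))"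
proof -
  note [measurable_cong] = P_sets[OF x]
  note f[measurable]
  have "(\<integral>\<^sup>+y. f y \<partial>p n x) = (\<integral>\<^sup>+w. f (W w n) \<partial>density (P (Some x)) (\<lambda>w. ennreal (indicator (live n) w)))"
    unfolding p_def by (rule nn_integral_distr) measurable
  also have "\<dots> = (\<integral>\<^sup>+w. ennreal (indicator (live n) w) * f (W w n) \<partial>P (Some x))"
    by (rule nn_integral_density) measurable
  finally show ?thesis by (simp only: ennreal_indicator)
qed

lemma hit_sets: "A \<in> sets M \<Longrightarrow> {w \<in> space \<Omega>. X (real n) w \<in> Some ` A} \<in> sets \<Omega>"
  using measurable_sets[OF X_nat_measurable cemetery_sets_Some, of A n]
  by (simp add: vimage_def Int_def conj_commute)

lemma emeasure_p:
  assumes x: "x \<in> space M" and A: "A \<in> sets M"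
  shows "emeasure (p n x) A = emeasure (P (Some x)) {w \<in> space \<Omega>. X (real n) w \<in> Some ` A}"
proof -
  have "emeasure (p n x) A = (\<integral>\<^sup>+y. indicator A y \<partial>p n x)"
    by (rule nn_integral_indicator[symmetric]) (simp add: p_sets A)
  also have "\<dots> = (\<integral>\<^sup>+w. indicator (live n) w * indicator A (W w n) \<partial>P (Some x))"
    by (rule nn_p[OF x borel_measurable_indicator[OF A]])
  also have "\<dots> = (\<integral>\<^sup>+w. indicator {w \<in> space \<Omega>. X (real n) w \<in> Some ` A} w \<partial>P (Some x))"
    by (rule nn_integral_cong) (use hit_iff P_space[OF x] in \<open>simp add: indicator_def\<close>)
  also have "\<dots> = emeasure (P (Some x)) {w \<in> space \<Omega>. X (real n) w \<in> Some ` A}"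
    by (rule nn_integral_indicator) (simp add: P_sets[OF x] hit_sets[OF A])
  finally show ?thesis .
qed

lemma p_subprob: assumes x: "x \<in> space M" shows "subprob_space (p n x)"
proof
  interpret prob_space "P (Some x)" by (rule P_prob[OF x])
  show "space (p n x) \<noteq> {}" using M_nonempty by (simp add: p_def)
  have "emeasure (p n x) (space M) \<le> 1" unfolding emeasure_p[OF x sets.top] by (rule emeasure_le_1)
  then show "emeasure (p n x) (space (p n x)) \<le> 1" by (simp add: p_def)
qed

lemma p_measurable: "p n \<in> M \<rightarrow>\<^sub>M subprob_algebra M"
proof (rule measurable_subprob_algebra)
  fix A assume A: "A \<in> sets M"
  have "(\<lambda>x. emeasure (P (Some x)) {w \<in> space \<Omega>. X (real n) w \<in> Some ` A}) \<in> borel_measurable M"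
    by (rule measurable_compose[OF measurable_prob_algebraD[OF P_measurable] measurable_emeasure_subprob_algebra[OF hit_sets[OF A]]])
  then show "(\<lambda>x. emeasure (p n x) A) \<in> borel_measurable M"
    by (rule measurable_cong[THEN iffD2, rotated]) (rule emeasure_p[OF _ A])
qed (use p_subprob p_sets in auto)

text \<open>On \<open>live s\<close> the Markov property of the process restarts it from a state of the space, so the process after time \<open>s\<close>
  is governed by the killed kernel.\<close>

lemma markov_sets:
  assumes x: "x \<in> space M" and B: "B \<in> sets (F s)" and BL: "B \<subseteq> live s" and A: "A \<in> sets M"
  shows "emeasure (P (Some x)) {w \<in> B. X (real (s + t)) w \<in> Some ` A}
    = (\<integral>\<^sup>+w. indicator B w * emeasure (p t (W w s)) A \<partial>P (Some x))"
proof -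
  interpret prob_space "P (Some x)" by (rule P_prob[OF x])
  note [measurable_cong] = P_sets[OF x]
  have B'[measurable]: "B \<in> sets \<Omega>" by (rule F_sets[OF B])
  have BS: "B \<subseteq> space \<Omega>" using sets.sets_into_space[OF B'] .
  have e: "{w \<in> B. X (real s) w \<in> space S} = B"
    using BS measurable_space[OF X_nat_measurable] by blast
  have m: "(\<lambda>w. emeasure (p t (W w s)) A) \<in> borel_measurable \<Omega>"
    by (rule measurable_compose[OF W_measurable measurable_compose[OF p_measurable measurable_emeasure_subprob_algebra[OF A]]])
  have mm: "(\<lambda>w. measure (p t (W w s)) A) \<in> borel_measurable \<Omega>"
    by (rule measurable_compose[OF W_measurable measurable_compose[OF p_measurable measurable_measure_subprob_algebra[OF A]]])
  have pm: "measure (P (Some y)) {v \<in> space \<Omega>. X (real t) v \<in> Some ` A} = measure (p t y) A" if "y \<in> space M" for y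
    using emeasure_p[OF that A, of t] by (simp add: measure_def)
  have "measure (P (Some x)) {w \<in> B. X (real s + real t) w \<in> Some ` A}
     = (LINT w:{w \<in> B. X (real s) w \<in> space S}|P (Some x). measure (P (X (real s) w)) {v \<in> space \<Omega>. X (real t) v \<in> Some ` A})"
    by (rule markov_property[OF Some_in_S[OF x] nat_in_T nat_in_T B cemetery_sets_Some[OF A]])
  also have "\<dots> = (LINT w|P (Some x). indicator B w * measure (p t (W w s)) A)"
    unfolding e set_lebesgue_integral_def
  proof (rule Bochner_Integration.integral_cong[OF refl])
    fix w assume "w \<in> space (P (Some x))"
    show "indicator B w *\<^sub>R measure (P (X (real s) w)) {v \<in> space \<Omega>. X (real t) v \<in> Some ` A} = indicator B w * measure (p t (W w s)) A"
    proof (cases "w \<in> B")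
      case True
      then have "w \<in> space \<Omega>" "X (real s) w = Some (W w s)" using BS BL live_eq by blast+
      then show ?thesis using pm[OF W_space, of w s] by simp
    qed simp
  qed
  finally have "emeasure (P (Some x)) {w \<in> B. X (real (s + t)) w \<in> Some ` A}
     = ennreal (LINT w|P (Some x). indicator B w * measure (p t (W w s)) A)"
    by (simp add: emeasure_eq_measure)
  also have "\<dots> = (\<integral>\<^sup>+w. ennreal (indicator B w * measure (p t (W w s)) A) \<partial>P (Some x))"
  proof (rule nn_integral_eq_integral[symmetric])
    show "integrable (P (Some x)) (\<lambda>w. indicator B w * measure (p t (W w s)) A)"
      by (rule integrable_const_bound[where B=1])
         (use mm subprob_space.subprob_measure_le_1[OF p_subprob[OF W_space]] P_space[OF x]
           in \<open>auto simp: abs_mult split: split_indicator intro!: AE_I2\<close>)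
  qed auto
  also have "\<dots> = (\<integral>\<^sup>+w. indicator B w * emeasure (p t (W w s)) A \<partial>P (Some x))"
    by (rule nn_integral_cong)
       (use P_space[OF x] finite_measure.emeasure_eq_measure[OF subprob_space.axioms(1)[OF p_subprob[OF W_space]]]
         in \<open>auto split: split_indicator\<close>)
  finally show ?thesis .
qed

lemma markov_nn:
  assumes x: "x \<in> space M" and B: "B \<in> sets (F s)" and BL: "B \<subseteq> live s" and f: "f \<in> borel_measurable M"
  shows "(\<integral>\<^sup>+w. indicator B w * (indicator (live (s + t)) w * f (W w (s + t))) \<partial>P (Some x))
    = (\<integral>\<^sup>+w. indicator B w * (\<integral>\<^sup>+y. f y \<partial>p t (W w s)) \<partial>P (Some x))"
proof -
  interpret prob_space "P (Some x)" by (rule P_prob[OF x])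
  note [measurable_cong] = P_sets[OF x]
  note f[measurable]
  have B'[measurable]: "B \<in> sets \<Omega>" by (rule F_sets[OF B])
  define L where "L = distr (density (P (Some x)) (indicator (B \<inter> live (s + t)))) M (\<lambda>w. W w (s + t))"
  define L0 where "L0 = distr (density (P (Some x)) (indicator B)) M (\<lambda>w. W w s)"
  have L0s: "sets L0 = sets M" "space L0 = space M" by (auto simp: L0_def)
  have k: "p t \<in> L0 \<rightarrow>\<^sub>M subprob_algebra M" using p_measurable by (simp add: measurable_cong_sets[OF L0s(1) refl])
  have nnL0: "(\<integral>\<^sup>+y. g y \<partial>L0) = (\<integral>\<^sup>+w. indicator B w * g (W w s) \<partial>P (Some x))" if [measurable]: "g \<in> borel_measurable M" for g
    unfolding L0_def by (subst nn_integral_distr) (auto simp: nn_integral_density)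
  have nnL: "(\<integral>\<^sup>+y. g y \<partial>L) = (\<integral>\<^sup>+w. indicator (B \<inter> live (s + t)) w * g (W w (s + t)) \<partial>P (Some x))"
    if [measurable]: "g \<in> borel_measurable M" for g
    unfolding L_def by (subst nn_integral_distr) (auto simp: nn_integral_density)
  have "L = L0 \<bind> p t"
  proof (rule measure_eqI)
    show s: "sets L = sets (L0 \<bind> p t)"
      using sets_bind[of L0 "p t" M] p_sets M_nonempty L0s by (simp add: L_def)
    fix A assume "A \<in> sets L"
    then have A[measurable]: "A \<in> sets M" by (simp add: L_def)
    have "emeasure L A = (\<integral>\<^sup>+y. indicator A y \<partial>L)" using A by (simp add: L_def)
    also have "\<dots> = (\<integral>\<^sup>+w. indicator (B \<inter> live (s + t)) w * indicator A (W w (s + t)) \<partial>P (Some x))"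
      by (rule nnL) measurable
    also have "\<dots> = (\<integral>\<^sup>+w. indicator {w \<in> B. X (real (s + t)) w \<in> Some ` A} w \<partial>P (Some x))"
    proof (rule nn_integral_cong)
      fix w assume "w \<in> space (P (Some x))"
      then show "indicator (B \<inter> live (s + t)) w * indicator A (W w (s + t)) = (indicator {w \<in> B. X (real (s + t)) w \<in> Some ` A} w :: ennreal)"
        using hit_iff[of w "s + t" A] P_space[OF x] by (simp add: indicator_def)
    qed
    also have "\<dots> = emeasure (P (Some x)) {w \<in> B. X (real (s + t)) w \<in> Some ` A}"
    proof (rule nn_integral_indicator)
      have "{w \<in> B. X (real (s + t)) w \<in> Some ` A} = B \<inter> {w \<in> space \<Omega>. X (real (s + t)) w \<in> Some ` A}"
        using sets.sets_into_space[OF B'] by auto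
      then show "{w \<in> B. X (real (s + t)) w \<in> Some ` A} \<in> sets (P (Some x))"
        using hit_sets[OF A, of "s + t"] P_sets[OF x] by auto
    qed
    also have "\<dots> = (\<integral>\<^sup>+w. indicator B w * emeasure (p t (W w s)) A \<partial>P (Some x))"
      by (rule markov_sets[OF x B BL A])
    also have "\<dots> = (\<integral>\<^sup>+y. emeasure (p t y) A \<partial>L0)"
      by (rule nnL0[symmetric]) (rule measurable_compose[OF p_measurable measurable_emeasure_subprob_algebra[OF A]])
    also have "\<dots> = emeasure (L0 \<bind> p t) A"
      by (rule emeasure_bind[symmetric, OF _ k A]) (use L0s M_nonempty in simp)
    finally show "emeasure L A = emeasure (L0 \<bind> p t) A" .
  qed
  then have "(\<integral>\<^sup>+y. f y \<partial>L) = (\<integral>\<^sup>+y. \<integral>\<^sup>+z. f z \<partial>p t y \<partial>L0)"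
    using nn_integral_bind[OF f k] by simp
  also have "\<dots> = (\<integral>\<^sup>+w. indicator B w * (\<integral>\<^sup>+y. f y \<partial>p t (W w s)) \<partial>P (Some x))"
    by (rule nnL0) (rule measurable_compose[OF p_measurable nn_integral_measurable_subprob_algebra[OF f]])
  finally show ?thesis unfolding nnL[OF f] by (simp add: indicator_inter_arith mult.assoc)
qed

lemma p_init: assumes x: "x \<in> space M" shows "p 0 x = return M x"
proof (rule measure_eqI)
  fix A assume "A \<in> sets (p 0 x)"
  then have A: "A \<in> sets M" by (simp add: p_sets)
  have "emeasure (p 0 x) A = emeasure (P (Some x)) (X 0 -` (Some ` A) \<inter> space (P (Some x)))"
    unfolding emeasure_p[OF x A] by (rule arg_cong[where f="emeasure _"]) (auto simp: P_space[OF x])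
  also have "\<dots> = emeasure (distr (P (Some x)) S (X 0)) (Some ` A)"
    using X_nat_measurable[of 0] cemetery_sets_Some[OF A]
    by (intro emeasure_distr[symmetric]) (auto simp: measurable_cong_sets[OF P_sets[OF x] refl])
  also have "\<dots> = indicator (Some ` A) (Some x)" using P_start[OF x] cemetery_sets_Some[OF A] by simp
  also have "\<dots> = emeasure (return M x) A" using A by (auto split: split_indicator)
  finally show "emeasure (p 0 x) A = emeasure (return M x) A" .
qed (simp add: p_sets)

text \<open>Survival up to the later time entails survival up to the earlier one, so inserting the indicator of the latter is
  harmless and the Markov property applies.\<close>

lemma p_semigroup: assumes x: "x \<in> space M" shows "p (m + n) x = p m x \<bind> p n"
proof (rule measure_eqI)
  interpret prob_space "P (Some x)" by (rule P_prob[OF x])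
  note [measurable_cong] = P_sets[OF x]
  have k: "p n \<in> p m x \<rightarrow>\<^sub>M subprob_algebra M" using p_measurable by (simp add: measurable_cong_sets[OF p_sets refl])
  have ne: "space (p m x) \<noteq> {}" using M_nonempty by (simp add: p_def)
  show "sets (p (m + n) x) = sets (p m x \<bind> p n)"
    using sets_bind[of "p m x" "p n" M] p_sets ne by simp
  fix A assume "A \<in> sets (p (m + n) x)"
  then have A[measurable]: "A \<in> sets M" by (simp add: p_sets)
  have "emeasure (p (m + n) x) A = (\<integral>\<^sup>+y. indicator A y \<partial>p (m + n) x)" using A p_sets by simp
  also have "\<dots> = (\<integral>\<^sup>+w. indicator (live (m + n)) w * indicator A (W w (m + n)) \<partial>P (Some x))"
    by (rule nn_p[OF x]) measurable
  also have "\<dots> = (\<integral>\<^sup>+w. indicator (live m) w * (indicator (live (m + n)) w * indicator A (W w (m + n))) \<partial>P (Some x))"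
  proof (rule nn_integral_cong_AE)
    show "AE w in P (Some x). indicator (live (m + n)) w * indicator A (W w (m + n))
        = (indicator (live m) w * (indicator (live (m + n)) w * indicator A (W w (m + n))) :: ennreal)"
      using absorbed_AE[OF x]
    proof eventually_elim
      case (elim w)
      then have "w \<in> live (m + n) \<Longrightarrow> w \<in> live m" unfolding live_def by (blast intro: le_add1)
      then show ?case by (auto split: split_indicator)
    qed
  qed
  also have "\<dots> = (\<integral>\<^sup>+w. indicator (live m) w * (\<integral>\<^sup>+y. indicator A y \<partial>p n (W w m)) \<partial>P (Some x))"
    by (rule markov_nn[OF x live_F]) auto
  also have "\<dots> = (\<integral>\<^sup>+y. \<integral>\<^sup>+z. indicator A z \<partial>p n y \<partial>p m x)"
    by (rule nn_p[symmetric, OF x]) (rule measurable_compose[OF p_measurable nn_integral_measurable_subprob_algebra], measurable)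
  also have "\<dots> = (\<integral>\<^sup>+y. indicator A y \<partial>(p m x \<bind> p n))"
    by (rule nn_integral_bind[symmetric, OF _ k]) measurable
  also have "\<dots> = emeasure (p m x \<bind> p n) A"
    using sets_bind[of "p m x" "p n" M] p_sets ne A by simp
  finally show "emeasure (p (m + n) x) A = emeasure (p m x \<bind> p n) A" .
qed

sublocale kernel_semigroup M p
  by standard (use p_measurable p_init p_semigroup in auto)

text \<open>Events that involve the absorption time are measurable only for the completion; replacing them by almost surely
  equal measurable events brings all probabilities back to the original law.\<close>

lemma prob_from_AE:
  assumes x: "x \<in> space M" and B: "B \<subseteq> space \<Omega>" and D: "D \<in> sets \<Omega>"
    and ae: "AE w in P (Some x). w \<in> B \<longleftrightarrow> w \<in> D"
  shows "prob_from P x B = measure (P (Some x)) D" "B \<in> sets (completion (P (Some x)))"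
proof -
  let ?C = "completion (P (Some x))"
  have D': "D \<in> sets (P (Some x))" using D P_sets[OF x] by simp
  have "AE w in P (Some x). w \<notin> (B - D)" "AE w in P (Some x). w \<notin> (D - B)" using ae by auto
  moreover have sp: "space ?C = space \<Omega>" using P_space[OF x] by simp
  ultimately have n: "{w \<in> space \<Omega>. w \<in> B - D} \<in> sets ?C" "{w \<in> space \<Omega>. w \<in> D - B} \<in> sets ?C"
    using sets_completion_AE[where M="P (Some x)" and P="\<lambda>w. w \<in> B - D"] sets_completion_AE[where M="P (Some x)" and P="\<lambda>w. w \<in> D - B"]
    by (auto simp: pred_def)
  have DS: "D \<subseteq> space \<Omega>" using sets.sets_into_space[OF D] .
  have "B = (D - {w \<in> space \<Omega>. w \<in> D - B}) \<union> {w \<in> space \<Omega>. w \<in> B - D}" using B DS by auto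
  also have "\<dots> \<in> sets ?C" using n D' by (intro sets.Un sets.Diff) auto
  finally show B': "B \<in> sets ?C" .
  have "measure ?C B = measure ?C D"
    by (rule measure_eq_AE) (use AE_completion[OF ae] B' D' in auto)
  then show "prob_from P x B = measure (P (Some x)) D"
    using D' by (simp add: prob_from_def)
qed

lemma alive_live_AE:
  assumes x: "x \<in> space M"
  shows "AE w in P (Some x). w \<in> alive T \<Omega> X n \<longleftrightarrow> w \<in> live n"
proof -
  have "AE w in P (Some x). w \<in> space \<Omega>" using AE_space[of "P (Some x)"] P_space[OF x] by simp
  with alive_iff_AE[OF x] show ?thesis by eventually_elim (simp add: live_def)
qed

lemma alive_space: "alive T \<Omega> X n \<subseteq> space \<Omega>" by (auto simp: alive_def)

lemma measure_p:
  assumes x: "x \<in> space M" and A: "A \<in> sets M"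
  shows "measure (p n x) A = measure (P (Some x)) {w \<in> space \<Omega>. X (real n) w \<in> Some ` A}"
  using emeasure_p[OF x A] by (simp add: measure_def)

lemma measure_p_space: "x \<in> space M \<Longrightarrow> measure (p n x) (space M) = measure (P (Some x)) (live n)"
proof -
  assume x: "x \<in> space M"
  have "{w \<in> space \<Omega>. X (real n) w \<in> Some ` space M} = live n"
    using hit_iff[of _ n "space M"] W_space by (auto simp: live_def)
  then show ?thesis using measure_p[OF x sets.top, of n] by simp
qed

lemma prob_from_alive: "x \<in> space M \<Longrightarrow> prob_from P x (alive T \<Omega> X n) = measure (p n x) (space M)"
  using prob_from_AE(1)[OF _ alive_space live_sets alive_live_AE, of x n] measure_p_space by simp

lemma prob_from_visit:
  assumes x: "x \<in> space M" and A: "A \<in> sets M"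
  shows "prob_from P x (visit \<Omega> X n A) = measure (p n x) A"
  unfolding measure_p[OF x A]
  by (rule prob_from_AE(1)[OF x]) (auto simp: visit_def hit_sets[OF A])

lemma prob_from_visit_alive:
  assumes x: "x \<in> space M" and A: "A \<in> sets M"
  shows "prob_from P x (visit \<Omega> X n A \<inter> alive T \<Omega> X n) = measure (p n x) A"
  unfolding measure_p[OF x A]
proof (rule prob_from_AE(1)[OF x])
  show "AE w in P (Some x). w \<in> visit \<Omega> X n A \<inter> alive T \<Omega> X n \<longleftrightarrow> w \<in> {w \<in> space \<Omega>. X (real n) w \<in> Some ` A}"
    using alive_live_AE[OF x, of n]
  proof eventually_elim
    case (elim w)
    then show ?case using hit_iff[of w n A] by (auto simp: visit_def)
  qed
qed (use alive_space hit_sets[OF A] in auto)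

lemma p_integral:
  assumes x: "x \<in> space M" and f: "f \<in> borel_measurable M"
  shows "integrable (p n x) f \<longleftrightarrow> integrable (P (Some x)) (\<lambda>w. indicator (live n) w * f (W w n))"
    "(LINT y|p n x. f y) = (LINT w|P (Some x). indicator (live n) w * f (W w n) :: real)"
proof -
  note [measurable_cong] = P_sets[OF x]
  note f[measurable]
  show "integrable (p n x) f \<longleftrightarrow> integrable (P (Some x)) (\<lambda>w. indicator (live n) w * f (W w n))"
    unfolding p_def by (subst integrable_distr_eq, measurable) (subst integrable_density, auto)
  show "(LINT y|p n x. f y) = (LINT w|P (Some x). indicator (live n) w * f (W w n))"
    unfolding p_def by (subst integral_distr, measurable) (subst integral_density, auto)
qed

lemma killed_value_AE:
  assumes x: "x \<in> space M" and f': "\<And>y. y \<in> space M \<Longrightarrow> f y = f' y"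
  shows "AE w in P (Some x). killed_value T \<Omega> X n f w = indicator (live n) w * f' (W w n)"
proof -
  have "AE w in P (Some x). w \<in> space \<Omega>" using AE_space[of "P (Some x)"] P_space[OF x] by simp
  with alive_live_AE[OF x, of n] show ?thesis
  proof eventually_elim
    case (elim w)
    show ?case
    proof (cases "w \<in> live n")
      case True
      then show ?thesis using elim live_eq[OF True] f'[OF W_space[of w n]] by (simp add: killed_value_def)
    next
      case False
      then show ?thesis using elim by (simp add: killed_value_def)
    qed
  qed
qed

lemma killed_value_measurable:
  assumes x: "x \<in> space M" and f: "f' \<in> borel_measurable M" and f': "\<And>y. y \<in> space M \<Longrightarrow> f y = f' y"
  shows "killed_value T \<Omega> X n f \<in> borel_measurable (completion (P (Some x)))"
proof -
  note [measurable_cong] = P_sets[OF x]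
  have al: "alive T \<Omega> X n \<in> sets (completion (P (Some x)))"
    by (rule prob_from_AE(2)[OF x alive_space live_sets alive_live_AE[OF x]])
  have "(\<lambda>w. case X (real n) w of None \<Rightarrow> 0 | Some y \<Rightarrow> f' y) \<in> borel_measurable \<Omega>"
    by (rule measurable_compose[OF X_nat_measurable measurable_case_cemetery[OF f]]) simp
  then have "(\<lambda>w. case X (real n) w of None \<Rightarrow> 0 | Some y \<Rightarrow> f' y) \<in> borel_measurable (completion (P (Some x)))"
    by (intro measurable_completion) (simp add: measurable_cong_sets[OF P_sets[OF x] refl])
  then have "(\<lambda>w. (case X (real n) w of None \<Rightarrow> 0 | Some y \<Rightarrow> f' y) * indicator (alive T \<Omega> X n) w) \<in> borel_measurable (completion (P (Some x)))"
    using al by (intro borel_measurable_times borel_measurable_indicator)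
  then show ?thesis
  proof (rule measurable_cong[THEN iffD1, rotated])
    fix w assume "w \<in> space (completion (P (Some x)))"
    then have w: "w \<in> space \<Omega>" using P_space[OF x] by simp
    have "X (real n) w \<in> space S" by (rule measurable_space[OF X_nat_measurable w])
    then show "(case X (real n) w of None \<Rightarrow> 0 | Some y \<Rightarrow> f' y) * indicator (alive T \<Omega> X n) w = killed_value T \<Omega> X n f w"
      using f' by (auto simp: killed_value_def space_cemetery)
  qed
qed

lemma killed_iff:
  assumes x: "x \<in> space M" and f: "f' \<in> borel_measurable M" and f': "\<And>y. y \<in> space M \<Longrightarrow> f y = f' y"
  shows "killed_integrable T \<Omega> X P n f x \<longleftrightarrow> integrable (p n x) f'"
    "killed_semigroup T \<Omega> X P n f x = (LINT y|p n x. f' y)"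
proof -
  note [measurable_cong] = P_sets[OF x]
  note f[measurable]
  let ?g = "\<lambda>w. indicator (live n) w * f' (W w n) :: real"
  have g: "?g \<in> borel_measurable (P (Some x))" by measurable
  have kv: "killed_value T \<Omega> X n f \<in> borel_measurable (completion (P (Some x)))"
    by (rule killed_value_measurable[OF x f f'])
  have ae: "AE w in completion (P (Some x)). killed_value T \<Omega> X n f w = ?g w"
    by (rule AE_completion[OF killed_value_AE[OF x f']])
  show "killed_integrable T \<Omega> X P n f x \<longleftrightarrow> integrable (p n x) f'"
    unfolding killed_integrable_def p_integral(1)[OF x f] integrable_cong_AE[OF kv measurable_completion[OF g] ae]
    by (rule integrable_completion[OF g])
  show "killed_semigroup T \<Omega> X P n f x = (LINT y|p n x. f' y)"
    unfolding killed_semigroup_def p_integral(2)[OF x f] integral_cong_AE[OF kv measurable_completion[OF g] ae]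
    by (rule integral_completion[OF g])
qed

lemma W_path: "w \<in> space \<Omega> \<Longrightarrow> W w \<in> space (path_space M)"
  by (auto simp: path_space_def space_PiM W_space)

definition cylinder_event where
  "cylinder_event m C = {w \<in> space \<Omega>. (\<forall>k\<le>m. w \<in> live k) \<and> restrict (W w) {0..<Suc m} \<in> C}"

lemma cylinder_event_F:
  assumes C: "C \<in> sets (PiM {0..<Suc m} (\<lambda>_. M))"
  shows "cylinder_event m C \<in> sets (F m)"
proof -
  have 1: "(\<lambda>w. restrict (W w) {0..<Suc m}) \<in> F m \<rightarrow>\<^sub>M PiM {0..<Suc m} (\<lambda>_. M)"
    by (rule measurable_restrict) (rule W_F, simp)
  have "cylinder_event m C = (\<Inter>k\<in>{..m}. live k) \<inter> ((\<lambda>w. restrict (W w) {0..<Suc m}) -` C \<inter> space (F m))"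
    unfolding cylinder_event_def F_space by (auto simp: live_def)
  also have "\<dots> \<in> sets (F m)"
    by (intro sets.Int sets.finite_INT measurable_sets[OF 1 C]) (auto intro: live_F)
  finally show ?thesis .
qed

lemma cylinder_event_live: "cylinder_event m C \<subseteq> live m" "cylinder_event m C \<subseteq> space \<Omega>"
  by (auto simp: cylinder_event_def)

text \<open>For an event that depends on the first coordinates only, the existential over paths can be replaced
  by the trajectory itself.\<close>

lemma trajectory_cylinder:
  assumes A: "A = {\<omega> \<in> space (path_space M). restrict \<omega> {0..<Suc m} \<in> C}"
  shows "trajectory_in \<Omega> X m A = cylinder_event m C"
proof (intro equalityI subsetI)
  fix w assume "w \<in> trajectory_in \<Omega> X m A"
  then obtain \<omega> where w: "w \<in> space \<Omega>" "\<omega> \<in> A" "\<And>k. k \<le> m \<Longrightarrow> X (real k) w = Some (\<omega> k)"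
    by (auto simp: trajectory_in_def)
  then have "restrict (W w) {0..<Suc m} = restrict \<omega> {0..<Suc m}" by (auto simp: W_def restrict_def fun_eq_iff)
  then show "w \<in> cylinder_event m C" using w A by (auto simp: cylinder_event_def live_def)
next
  fix w assume w: "w \<in> cylinder_event m C"
  then have "W w \<in> A" using A W_path by (auto simp: cylinder_event_def)
  moreover have "X (real k) w = Some (W w k)" if "k \<le> m" for k
    using w that live_eq by (auto simp: cylinder_event_def)
  ultimately show "w \<in> trajectory_in \<Omega> X m A"
    using w by (auto simp: trajectory_in_def cylinder_event_def)
qed

text \<open>The numerator of the conditional path probabilities: after time \<open>m\<close> only the survival probability from the current
  state matters.\<close>

lemma prob_from_cylinder:
  assumes x: "x \<in> space M" and C: "C \<in> sets (PiM {0..<Suc m} (\<lambda>_. M))"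
  shows "ennreal (prob_from P x (cylinder_event m C \<inter> alive T \<Omega> X (m + t)))
    = (\<integral>\<^sup>+w. indicator (cylinder_event m C) w * emeasure (p t (W w m)) (space M) \<partial>P (Some x))"
proof -
  interpret prob_space "P (Some x)" by (rule P_prob[OF x])
  note B = cylinder_event_F[OF C]
  have D: "cylinder_event m C \<inter> live (m + t) \<in> sets \<Omega>" using F_sets[OF B] live_sets by auto
  have ae: "AE w in P (Some x). w \<in> cylinder_event m C \<inter> alive T \<Omega> X (m + t) \<longleftrightarrow> w \<in> cylinder_event m C \<inter> live (m + t)"
    using alive_live_AE[OF x, of "m + t"] by eventually_elim auto
  have sub: "cylinder_event m C \<inter> alive T \<Omega> X (m + t) \<subseteq> space \<Omega>" using alive_space by auto
  have "ennreal (prob_from P x (cylinder_event m C \<inter> alive T \<Omega> X (m + t)))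
      = emeasure (P (Some x)) (cylinder_event m C \<inter> live (m + t))"
    unfolding prob_from_AE(1)[OF x sub D ae] by (simp add: emeasure_eq_measure)
  also have "\<dots> = (\<integral>\<^sup>+w. indicator (cylinder_event m C \<inter> live (m + t)) w \<partial>P (Some x))"
    by (rule nn_integral_indicator[symmetric]) (simp add: P_sets[OF x] D)
  also have "\<dots> = (\<integral>\<^sup>+w. indicator (cylinder_event m C) w * (indicator (live (m + t)) w * 1) \<partial>P (Some x))"
    by (simp add: indicator_inter_arith)
  also have "\<dots> = (\<integral>\<^sup>+w. indicator (cylinder_event m C) w * (\<integral>\<^sup>+y. 1 \<partial>p t (W w m)) \<partial>P (Some x))"
    by (rule markov_nn[OF x B cylinder_event_live(1)]) simp
  also have "\<dots> = (\<integral>\<^sup>+w. indicator (cylinder_event m C) w * emeasure (p t (W w m)) (space M) \<partial>P (Some x))"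
    by (simp add: sets_eq_imp_space_eq[OF p_sets])
  finally show ?thesis .
qed

lemma live_all_AE:
  assumes x: "x \<in> space M"
  shows "AE w in P (Some x). w \<in> live n \<longrightarrow> (\<forall>k\<le>n. w \<in> live k)"
  using absorbed_AE[OF x] by eventually_elim (auto simp: live_def)

end

section \<open>The Q-process\<close>

text \<open>An absorbed process whose killed kernel satisfies the standing hypotheses.\<close>

locale q_process = absorbed_process T M \<Omega> X P
  for T :: "real set" and M :: "'a measure" and \<Omega> :: "'w measure"
    and X :: "real \<Rightarrow> 'w \<Rightarrow> 'a option" and P :: "'a option \<Rightarrow> 'w measure" +
  fixes n1 :: nat and \<theta>0 \<theta>1 \<theta>2 c1 c2 c3 h1 :: real and \<phi>1 \<phi>2 \<eta> :: "'a \<Rightarrow> real"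
    and K :: "'a set" and \<nu> \<pi> :: "'a measure"
  assumes qsd: "qsd_chain M p n1 \<theta>0 \<theta>1 \<theta>2 c1 c2 c3 h1 \<phi>1 \<phi>2 \<eta> K \<nu> \<pi>"
begin

sublocale qsd_chain M p n1 \<theta>0 \<theta>1 \<theta>2 c1 c2 c3 h1 \<phi>1 \<phi>2 \<eta> K \<nu> \<pi>
  by (rule qsd)

abbreviation "PM n \<equiv> PiM {0..<n} (\<lambda>_. M)"
definition all_live where "all_live m = {w \<in> space \<Omega>. \<forall>k\<le>m. w \<in> live k}"

lemma all_live_sets[measurable]: "all_live m \<in> sets \<Omega>" unfolding all_live_def by measurable

lemma restrict_W_measurable[measurable]: "(\<lambda>w. restrict (W w) {0..<m}) \<in> \<Omega> \<rightarrow>\<^sub>M PM m"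
  by (rule measurable_restrict) simp

lemma cylinder_event_eq: "w \<in> space \<Omega> \<Longrightarrow> indicator (cylinder_event m C) w = (indicator (all_live m) w * indicator C (restrict (W w) {0..<Suc m}) :: ennreal)"
  by (auto simp: cylinder_event_def all_live_def split: split_indicator)

text \<open>The Markov property with the weight \<open>\<eta>\<close> at the later time: by the eigenvalue equation the weight can be moved to the
  earlier time at the price of the factor \<open>\<theta>0 ^ t\<close>, and the transition becomes the tilted one.\<close>

lemma markov_tilt:
  assumes x: "x \<in> space M" and B: "B \<in> sets (F s)" "B \<subseteq> live s" and A: "A \<in> sets M"
  shows "(\<integral>\<^sup>+w. indicator B w * (indicator (live (s + t)) w * (ennreal (\<eta> (W w (s + t))) * indicator A (W w (s + t)))) \<partial>P (Some x))
    = ennreal (\<theta>0 ^ t) * (\<integral>\<^sup>+w. indicator B w * (ennreal (\<eta> (W w s)) * (indicator E' (W w s) * emeasure (tilt t (W w s)) A)) \<partial>P (Some x))"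
proof -
  let ?l = "\<lambda>w. indicator B w * (indicator (live (s + t)) w * (ennreal (\<eta> (W w (s + t))) * indicator A (W w (s + t))))"
    and ?r = "\<lambda>w. indicator B w * (ennreal (\<eta> (W w s)) * (indicator E' (W w s) * emeasure (tilt t (W w s)) A))"
  note [measurable_cong] = P_sets[OF x]
  note A[measurable]
  have B'[measurable]: "B \<in> sets \<Omega>" by (rule F_sets[OF B(1)])
  have "(\<lambda>y. emeasure (tilt t y) A * indicator E' y) \<in> borel_measurable M"
    by (rule N_extend) (rule measurable_compose[OF measurable_prob_algebraD[OF tilt_measurable] measurable_emeasure_subprob_algebra[OF A]])
  then have [measurable]: "(\<lambda>y. indicator E' y * emeasure (tilt t y) A) \<in> borel_measurable M"
    by (simp add: mult.commute)
  have [measurable]: "(\<lambda>w. indicator E' (W w s) * emeasure (tilt t (W w s)) A) \<in> borel_measurable \<Omega>"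
    by (rule measurable_compose[OF W_measurable, of "\<lambda>y. indicator E' y * emeasure (tilt t y) A"]) measurable
  have "(\<integral>\<^sup>+w. ?l w \<partial>P (Some x))
      = (\<integral>\<^sup>+w. indicator B w * (\<integral>\<^sup>+y. ennreal (\<eta> y) * indicator A y \<partial>p t (W w s)) \<partial>P (Some x))"
    by (rule markov_nn[OF x B]) measurable
  also have "\<dots> = (\<integral>\<^sup>+w. ennreal (\<theta>0 ^ t) * ?r w \<partial>P (Some x))"
  proof (rule nn_integral_cong)
    fix w assume "w \<in> space (P (Some x))"
    then have "W w s \<in> space M" using P_space[OF x] W_space by simp
    then show "indicator B w * (\<integral>\<^sup>+y. ennreal (\<eta> y) * indicator A y \<partial>p t (W w s)) =
      ennreal (\<theta>0 ^ t) * ?r w"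
      by (simp only: eta_tilt[OF _ A] mult.left_commute)
  qed
  also have "\<dots> = ennreal (\<theta>0 ^ t) * (\<integral>\<^sup>+w. ?r w \<partial>P (Some x))"
    by (rule nn_integral_cmult) measurable
  finally show ?thesis .
qed

text \<open>The candidate for the law of the first \<open>m + 1\<close> states of the \<open>Q\<close>-process, which is the limit of the conditional laws.\<close>

definition qlaw where
  "qlaw m x = distr (density (P (Some x)) (\<lambda>w. indicator (all_live m) w * ennreal (\<eta> (W w m) / (\<theta>0 ^ m * \<eta> x))))
     (PM (Suc m)) (\<lambda>w. restrict (W w) {0..<Suc m})"

lemma qlaw_sets: "sets (qlaw m x) = sets (PM (Suc m))" by (simp add: qlaw_def)

lemma nn_qlaw:
  assumes x: "x \<in> E'" and f: "f \<in> borel_measurable (PM (Suc m))"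
  shows "(\<integral>\<^sup>+\<omega>. f \<omega> \<partial>qlaw m x) = tilt_factor m x *
    (\<integral>\<^sup>+w. indicator (all_live m) w * (ennreal (\<eta> (W w m)) * f (restrict (W w) {0..<Suc m})) \<partial>P (Some x))"
proof -
  note xs = E'D[OF x]
  note [measurable_cong] = P_sets[OF xs(1)]
  note f[measurable]
  have "(\<integral>\<^sup>+\<omega>. f \<omega> \<partial>qlaw m x) = (\<integral>\<^sup>+w. f (restrict (W w) {0..<Suc m}) \<partial>density (P (Some x)) (\<lambda>w. indicator (all_live m) w * ennreal (\<eta> (W w m) / (\<theta>0 ^ m * \<eta> x))))"
    unfolding qlaw_def by (rule nn_integral_distr) measurable
  also have "\<dots> = (\<integral>\<^sup>+w. (indicator (all_live m) w * ennreal (\<eta> (W w m) / (\<theta>0 ^ m * \<eta> x))) * f (restrict (W w) {0..<Suc m}) \<partial>P (Some x))"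
    by (rule nn_integral_density) measurable
  also have "\<dots> = (\<integral>\<^sup>+w. tilt_factor m x * (indicator (all_live m) w * (ennreal (\<eta> (W w m)) * f (restrict (W w) {0..<Suc m}))) \<partial>P (Some x))"
  proof (rule nn_integral_cong)
    fix w assume "w \<in> space (P (Some x))"
    then have "0 \<le> \<eta> (W w m)" using eta_nonneg W_space P_space[OF xs(1)] by simp
    then have e: "ennreal (\<eta> (W w m) / (\<theta>0 ^ m * \<eta> x)) = tilt_factor m x * ennreal (\<eta> (W w m))"
      using const xs by (simp add: ennreal_mult[symmetric])
    show "(indicator (all_live m) w * ennreal (\<eta> (W w m) / (\<theta>0 ^ m * \<eta> x))) * f (restrict (W w) {0..<Suc m})
      = tilt_factor m x * (indicator (all_live m) w * (ennreal (\<eta> (W w m)) * f (restrict (W w) {0..<Suc m})))"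
      unfolding e by (simp only: ac_simps)
  qed
  also have "\<dots> = tilt_factor m x * (\<integral>\<^sup>+w. indicator (all_live m) w * (ennreal (\<eta> (W w m)) * f (restrict (W w) {0..<Suc m})) \<partial>P (Some x))"
    by (rule nn_integral_cmult) measurable
  finally show ?thesis .
qed

lemma emeasure_qlaw:
  assumes x: "x \<in> E'" and C: "C \<in> sets (PM (Suc m))"
  shows "emeasure (qlaw m x) C = tilt_factor m x *
    (\<integral>\<^sup>+w. indicator (cylinder_event m C) w * ennreal (\<eta> (W w m)) \<partial>P (Some x))"
proof -
  have "emeasure (qlaw m x) C = (\<integral>\<^sup>+\<omega>. indicator C \<omega> \<partial>qlaw m x)"
    by (rule nn_integral_indicator[symmetric]) (simp only: qlaw_sets C)
  also have "\<dots> = tilt_factor m x *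
    (\<integral>\<^sup>+w. indicator (all_live m) w * (ennreal (\<eta> (W w m)) * indicator C (restrict (W w) {0..<Suc m})) \<partial>P (Some x))"
    by (rule nn_qlaw[OF x borel_measurable_indicator[OF C]])
  also have "(\<integral>\<^sup>+w. indicator (all_live m) w * (ennreal (\<eta> (W w m)) * indicator C (restrict (W w) {0..<Suc m})) \<partial>P (Some x))
    = (\<integral>\<^sup>+w. indicator (cylinder_event m C) w * ennreal (\<eta> (W w m)) \<partial>P (Some x))"
    by (rule nn_integral_cong) (simp add: cylinder_event_eq P_space[OF E'D(1)[OF x]] ac_simps)
  finally show ?thesis .
qed

lemma live_weight:
  assumes x: "x \<in> space M" and f[measurable]: "f \<in> borel_measurable M"
  shows "(\<integral>\<^sup>+w. indicator (all_live m) w * f (W w m) \<partial>P (Some x)) = (\<integral>\<^sup>+y. f y \<partial>p m x)"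
  unfolding nn_p[OF x f]
proof (rule nn_integral_cong_AE)
  have "AE w in P (Some x). w \<in> space \<Omega>" using AE_space[of "P (Some x)"] P_space[OF x] by simp
  with live_all_AE[OF x, of m]
  show "AE w in P (Some x). indicator (all_live m) w * f (W w m) = indicator (live m) w * f (W w m)"
  proof eventually_elim
    case (elim w)
    then have "w \<in> all_live m \<longleftrightarrow> w \<in> live m" by (auto simp: all_live_def)
    then show ?case by (simp add: indicator_def)
  qed
qed

lemma qlaw_prob: assumes x: "x \<in> E'" shows "prob_space (qlaw m x)"
proof
  have "emeasure (qlaw m x) (space (qlaw m x)) = (\<integral>\<^sup>+\<omega>. 1 \<partial>qlaw m x)" by simp
  also have "\<dots> = tilt_factor m x * (\<integral>\<^sup>+y. ennreal (\<eta> y) \<partial>p m x)"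
    using nn_qlaw[OF x, of "\<lambda>_. 1" m] live_weight[OF E'D(1)[OF x], of "\<lambda>y. ennreal (\<eta> y)" m] by simp
  also have "\<dots> = 1"
    using eta_eigen[OF E'D(1)[OF x], of m] E'D[OF x] const by (simp add: ennreal_mult[symmetric])
  finally show "emeasure (qlaw m x) (space (qlaw m x)) = 1" .
qed

lemma qlaw_0:
  assumes x: "x \<in> E'"
  shows "qlaw 0 x = return (PM (Suc 0)) (\<lambda>i\<in>{0..<Suc 0}. x)"
proof (rule measure_eqI)
  note xs = E'D[OF x]
  let ?z = "\<lambda>y. \<lambda>i\<in>{0..<Suc 0}. y :: 'a"
  have z: "?z \<in> M \<rightarrow>\<^sub>M PM (Suc 0)" by (rule measurable_restrict) simp
  fix C assume "C \<in> sets (qlaw 0 x)"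
  then have C[measurable]: "C \<in> sets (PM (Suc 0))" unfolding qlaw_sets .
  have m: "(\<lambda>y. ennreal (\<eta> y) * indicator C (?z y)) \<in> borel_measurable M"
    by (rule borel_measurable_times_ennreal[OF _ measurable_compose[OF z borel_measurable_indicator[OF C]]]) measurable
  have r: "restrict (W w) {0..<Suc 0} = ?z (W w 0)" for w by (auto simp: restrict_def)
  have "emeasure (qlaw 0 x) C = (\<integral>\<^sup>+\<omega>. indicator C \<omega> \<partial>qlaw 0 x)"
    by (rule nn_integral_indicator[symmetric]) (simp only: qlaw_sets C)
  also have "\<dots> = tilt_factor 0 x *
    (\<integral>\<^sup>+w. indicator (all_live 0) w * (ennreal (\<eta> (W w 0)) * indicator C (?z (W w 0))) \<partial>P (Some x))"
    unfolding r[symmetric] by (rule nn_qlaw[OF x borel_measurable_indicator[OF C]])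
  also have "(\<integral>\<^sup>+w. indicator (all_live 0) w * (ennreal (\<eta> (W w 0)) * indicator C (?z (W w 0))) \<partial>P (Some x))
      = ennreal (\<eta> x) * indicator C (?z x)"
    using live_weight[OF xs(1) m, of 0] nn_init[OF xs(1) m] by simp
  also have "tilt_factor 0 x * \<dots> = indicator C (?z x)"
    using xs by (simp add: mult.assoc[symmetric] ennreal_mult[symmetric])
  also have "\<dots> = emeasure (return (PM (Suc 0)) (?z x)) C" by (simp only: emeasure_return[OF C])
  finally show "emeasure (qlaw 0 x) C = emeasure (return (PM (Suc 0)) (?z x)) C" .
qed (simp add: qlaw_sets)

definition extend where
  "extend m \<omega> = distr (\<kappa> (\<omega> m)) (PM (Suc (Suc m))) (fun_upd \<omega> (Suc m))"

lemma extend_measurable: "extend m \<in> PM (Suc m) \<rightarrow>\<^sub>M prob_algebra (PM (Suc (Suc m)))"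
  unfolding extend_def[abs_def]
proof (rule measurable_distr_prob_space2)
  show "(\<lambda>\<omega>. \<kappa> (\<omega> m)) \<in> PM (Suc m) \<rightarrow>\<^sub>M prob_algebra M"
  proof (rule measurable_compose[OF _ \<kappa>_measurable])
    show "(\<lambda>\<omega>. \<omega> m) \<in> PM (Suc m) \<rightarrow>\<^sub>M M" by (rule measurable_component_singleton) simp
  qed
  show "(\<lambda>(\<omega>, y). fun_upd \<omega> (Suc m) y) \<in> PM (Suc m) \<Otimes>\<^sub>M M \<rightarrow>\<^sub>M PM (Suc (Suc m))"
    unfolding measurable_split_conv
    by (rule measurable_fun_upd[where J="{0..<Suc m}"]) auto
qed

lemma emeasure_extend:
  assumes \<omega>: "\<omega> \<in> space (PM (Suc m))" and A: "\<And>i. i \<in> {0..<Suc (Suc m)} \<Longrightarrow> A i \<in> sets M"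
  shows "emeasure (extend m \<omega>) (Pi\<^sub>E {0..<Suc (Suc m)} A)
    = indicator (Pi\<^sub>E {0..<Suc m} A) \<omega> * emeasure (\<kappa> (\<omega> m)) (A (Suc m))"
proof -
  have m: "\<omega> m \<in> space M" using \<omega> by (auto simp: space_PiM PiE_iff)
  have s: "sets (\<kappa> (\<omega> m)) = sets M" using measurable_space[OF \<kappa>_measurable m] by (simp add: space_prob_algebra)
  have sp: "space (\<kappa> (\<omega> m)) = space M" by (rule sets_eq_imp_space_eq[OF s])
  have R: "Pi\<^sub>E {0..<Suc (Suc m)} A \<in> sets (PM (Suc (Suc m)))" using A by (intro sets_PiM_I_finite) auto
  have u: "fun_upd \<omega> (Suc m) \<in> \<kappa> (\<omega> m) \<rightarrow>\<^sub>M PM (Suc (Suc m))"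
    unfolding measurable_cong_sets[OF s refl]
    by (rule measurable_fun_upd[where J="{0..<Suc m}"]) (use \<omega> in auto)
  have ext: "\<omega> \<in> extensional {0..<Suc m}" using \<omega> by (auto simp: space_PiM PiE_iff)
  have pre: "fun_upd \<omega> (Suc m) -` Pi\<^sub>E {0..<Suc (Suc m)} A \<inter> space M = (if \<omega> \<in> Pi\<^sub>E {0..<Suc m} A then A (Suc m) else {})"
  proof -
    have "fun_upd \<omega> (Suc m) y \<in> Pi\<^sub>E {0..<Suc (Suc m)} A \<longleftrightarrow> \<omega> \<in> Pi\<^sub>E {0..<Suc m} A \<and> y \<in> A (Suc m)" for y
      using ext by (auto simp: PiE_iff extensional_def less_Suc_eq)
    moreover have "A (Suc m) \<subseteq> space M" using A[of "Suc m"] sets.sets_into_space by auto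
    ultimately show ?thesis by auto
  qed
  show ?thesis
    unfolding extend_def emeasure_distr[OF u R] sp pre by simp
qed

text \<open>Finite-dimensional laws are determined on rectangles; on these the recursion is the weighted Markov property
  over one step.\<close>

lemma qlaw_Suc:
  assumes x: "x \<in> E'"
  shows "qlaw (Suc m) x = qlaw m x \<bind> extend m"
proof (rule measure_eqI_PiM_finite[where I="{0..<Suc (Suc m)}" and M="\<lambda>_. M" and A="\<lambda>_. Pi\<^sub>E {0..<Suc (Suc m)} (\<lambda>_. space M)"])
  note xs = E'D[OF x]
  have q: "qlaw m x \<in> space (prob_algebra (PM (Suc m)))" using qlaw_prob[OF x] qlaw_sets by (simp add: space_prob_algebra)
  show "finite {0..<Suc (Suc m)}" by simp
  show "sets (qlaw (Suc m) x) = sets (PM (Suc (Suc m)))" by (rule qlaw_sets)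
  show "sets (qlaw m x \<bind> extend m) = sets (PM (Suc (Suc m)))" by (rule sets_bind'[OF q extend_measurable])
  show "range (\<lambda>_::nat. Pi\<^sub>E {0..<Suc (Suc m)} (\<lambda>_. space M)) \<subseteq> prod_algebra {0..<Suc (Suc m)} (\<lambda>_. M)"
    by (auto intro!: prod_algebraI_finite)
  show "(\<Union>i::nat. Pi\<^sub>E {0..<Suc (Suc m)} (\<lambda>_. space M)) = space (PM (Suc (Suc m)))" by (simp add: space_PiM)
  interpret q: prob_space "qlaw (Suc m) x" by (rule qlaw_prob[OF x])
  show "emeasure (qlaw (Suc m) x) (Pi\<^sub>E {0..<Suc (Suc m)} (\<lambda>_. space M)) \<noteq> \<infinity>" for i :: nat
    by simp
  fix A :: "nat \<Rightarrow> 'a set" assume A: "\<And>i. i \<in> {0..<Suc (Suc m)} \<Longrightarrow> A i \<in> sets M"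
  let ?R = "Pi\<^sub>E {0..<Suc (Suc m)} A" and ?R' = "Pi\<^sub>E {0..<Suc m} A"
  let ?f = "\<lambda>\<omega>. indicator ?R' \<omega> * emeasure (\<kappa> (\<omega> m)) (A (Suc m))"
  let ?l = "\<lambda>w. indicator (cylinder_event m ?R') w * (ennreal (\<eta> (W w m)) * (indicator E' (W w m) * emeasure (tilt 1 (W w m)) (A (Suc m))))"
    and ?r = "\<lambda>w. indicator (all_live m) w * (ennreal (\<eta> (W w m)) * (indicator ?R' (restrict (W w) {0..<Suc m}) * emeasure (\<kappa> (restrict (W w) {0..<Suc m} m)) (A (Suc m))))"
  have R: "?R \<in> sets (PM (Suc (Suc m)))" using A by (intro sets_PiM_I_finite) auto
  have R': "?R' \<in> sets (PM (Suc m))" using A by (intro sets_PiM_I_finite) auto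
  have Am: "A (Suc m) \<in> sets M" using A by simp
  have cyl: "indicator (cylinder_event (Suc m) ?R) w = (indicator (cylinder_event m ?R') w *
      (indicator (live (m + 1)) w * indicator (A (Suc m)) (W w (m + 1))) :: ennreal)" for w
    by (auto simp: cylinder_event_def PiE_iff le_Suc_eq less_Suc_eq split: split_indicator)
  have "emeasure (qlaw (Suc m) x) ?R = tilt_factor (Suc m) x *
      (\<integral>\<^sup>+w. indicator (cylinder_event m ?R') w * (indicator (live (m + 1)) w * (ennreal (\<eta> (W w (m + 1))) * indicator (A (Suc m)) (W w (m + 1)))) \<partial>P (Some x))"
    unfolding emeasure_qlaw[OF x R] cyl by (simp only: ac_simps Suc_eq_plus1)
  also have "\<dots> = tilt_factor (Suc m) x * (ennreal (\<theta>0 ^ 1) *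
      (\<integral>\<^sup>+w. ?l w \<partial>P (Some x)))"
    unfolding markov_tilt[OF xs(1) cylinder_event_F[OF R'] cylinder_event_live(1) Am] ..
  also have "\<dots> = tilt_factor m x *
      (\<integral>\<^sup>+w. ?l w \<partial>P (Some x))"
    unfolding mult.assoc[symmetric] using const xs by (simp add: ennreal_mult[symmetric])
  also have "(\<integral>\<^sup>+w. ?l w \<partial>P (Some x))
     = (\<integral>\<^sup>+w. ?r w \<partial>P (Some x))"
  proof (rule nn_integral_cong)
    fix w assume "w \<in> space (P (Some x))"
    then have w: "w \<in> space \<Omega>" using P_space[OF xs(1)] by simp
    have r: "restrict (W w) {0..<Suc m} m = W w m" by simp
    show "?l w
      = ?r w"
      unfolding r eta_\<kappa>[OF W_space[OF w] Am] cylinder_event_eq[OF w] by (simp only: ac_simps)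
  qed
  also have "tilt_factor m x * \<dots> = (\<integral>\<^sup>+\<omega>. ?f \<omega> \<partial>qlaw m x)"
  proof (rule nn_qlaw[OF x, symmetric])
    have "(\<lambda>\<omega>. \<omega> m) \<in> PM (Suc m) \<rightarrow>\<^sub>M M" by (rule measurable_component_singleton) simp
    then have "(\<lambda>\<omega>. emeasure (\<kappa> (\<omega> m)) (A (Suc m))) \<in> borel_measurable (PM (Suc m))"
      by (rule measurable_compose[OF _ measurable_compose[OF measurable_prob_algebraD[OF \<kappa>_measurable] measurable_emeasure_subprob_algebra[OF Am]]])
    then show "(\<lambda>\<omega>. ?f \<omega>) \<in> borel_measurable (PM (Suc m))"
      using R' by measurable
  qed
  also have "\<dots> = (\<integral>\<^sup>+\<omega>. emeasure (extend m \<omega>) ?R \<partial>qlaw m x)"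
    by (rule nn_integral_cong) (use emeasure_extend[OF _ A] sets_eq_imp_space_eq[OF qlaw_sets] in auto)
  also have "\<dots> = emeasure (qlaw m x \<bind> extend m) ?R"
    by (rule emeasure_bind_prob_algebra[symmetric, OF q extend_measurable R])
  finally show "emeasure (qlaw (Suc m) x) ?R = emeasure (qlaw m x \<bind> extend m) ?R" .
qed

abbreviation "paths \<equiv> path_space M"

text \<open>Any measure on path space with the prescribed finite-dimensional laws; such a measure is unique.\<close>

definition Q where
  "Q x = (SOME R. prob_space R \<and> sets R = sets paths \<and>
     (\<forall>m. distr R (PM (Suc m)) (\<lambda>\<omega>. restrict \<omega> {0..<Suc m}) = qlaw m x))"

lemma Q_spec:
  assumes x: "x \<in> E'"
  shows "prob_space (Q x) \<and> sets (Q x) = sets paths \<and>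
     (\<forall>m. distr (Q x) (PM (Suc m)) (\<lambda>\<omega>. restrict \<omega> {0..<Suc m}) = qlaw m x)"
  unfolding Q_def
proof (rule someI_ex)
  have rec: "qlaw (Suc m) x = qlaw m x \<bind> (\<lambda>\<omega>. distr (\<kappa> (\<omega> m)) (PM (Suc (Suc m))) (fun_upd \<omega> (Suc m)))" for m
    using qlaw_Suc[OF x, of m] unfolding extend_def[abs_def] .
  obtain R where "prob_space R" "sets R = sets (PiM UNIV (\<lambda>_. M))"
    "\<And>m. distr R (PM (Suc m)) (\<lambda>\<omega>. restrict \<omega> {0..<Suc m}) = qlaw m x"
    using markov_law_extends[where law="\<lambda>m. qlaw m x", OF \<kappa>_measurable E'D(1)[OF x] qlaw_0[OF x] rec] by blast
  then show "\<exists>R. prob_space R \<and> sets R = sets paths \<and>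
     (\<forall>m. distr R (PM (Suc m)) (\<lambda>\<omega>. restrict \<omega> {0..<Suc m}) = qlaw m x)"
    unfolding path_space_def by blast
qed

lemma Q_prob: "x \<in> E' \<Longrightarrow> prob_space (Q x)"
  and Q_sets: "x \<in> E' \<Longrightarrow> sets (Q x) = sets paths"
  and Q_distr: "x \<in> E' \<Longrightarrow> distr (Q x) (PM (Suc m)) (\<lambda>\<omega>. restrict \<omega> {0..<Suc m}) = qlaw m x"
  using Q_spec by blast+

lemma Q_space: "x \<in> E' \<Longrightarrow> space (Q x) = space paths"
  by (rule sets_eq_imp_space_eq[OF Q_sets])

lemma restrict_paths: "(\<lambda>\<omega>. restrict \<omega> {0..<m}) \<in> paths \<rightarrow>\<^sub>M PM m"
  unfolding path_space_def by (rule measurable_restrict_subset) simp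

lemma nn_Q:
  assumes x: "x \<in> E'" and f: "f \<in> borel_measurable (PM (Suc m))"
  shows "(\<integral>\<^sup>+\<omega>. f (restrict \<omega> {0..<Suc m}) \<partial>Q x) = (\<integral>\<^sup>+\<omega>. f \<omega> \<partial>qlaw m x)"
proof -
  have r: "(\<lambda>\<omega>. restrict \<omega> {0..<Suc m}) \<in> Q x \<rightarrow>\<^sub>M PM (Suc m)"
    unfolding measurable_cong_sets[OF Q_sets[OF x] refl] by (rule restrict_paths)
  show ?thesis unfolding Q_distr[OF x, of m, symmetric] by (rule nn_integral_distr[OF r, symmetric]) (simp add: f)
qed

lemma emeasure_Q_cylinder:
  assumes x: "x \<in> E'" and C: "C \<in> sets (PM (Suc m))"
  shows "emeasure (Q x) {\<omega> \<in> space paths. restrict \<omega> {0..<Suc m} \<in> C} = tilt_factor m x *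
    (\<integral>\<^sup>+w. indicator (cylinder_event m C) w * ennreal (\<eta> (W w m)) \<partial>P (Some x))"
proof -
  have r: "(\<lambda>\<omega>. restrict \<omega> {0..<Suc m}) \<in> Q x \<rightarrow>\<^sub>M PM (Suc m)"
    unfolding measurable_cong_sets[OF Q_sets[OF x] refl] by (rule restrict_paths)
  have e: "{\<omega> \<in> space paths. restrict \<omega> {0..<Suc m} \<in> C} = (\<lambda>\<omega>. restrict \<omega> {0..<Suc m}) -` C \<inter> space (Q x)"
    using Q_space[OF x] by auto
  show ?thesis
    unfolding e emeasure_distr[OF r C, symmetric] Q_distr[OF x] by (rule emeasure_qlaw[OF x C])
qed

lemma cylinder_sets: "C \<in> sets (PM (Suc m)) \<Longrightarrow> {\<omega> \<in> space paths. restrict \<omega> {0..<Suc m} \<in> C} \<in> sets paths"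
  using measurable_sets[OF restrict_paths, of C "Suc m"] by (simp add: vimage_def Int_def conj_commute)

lemma Q_marginal:
  assumes x: "x \<in> E'"
  shows "distr (Q x) M (coordinate n) = tilt n x"
proof (rule measure_eqI)
  note xs = E'D[OF x]
  show "sets (distr (Q x) M (coordinate n)) = sets (tilt n x)" using tilt_sets[OF xs(1)] by simp
  fix A assume "A \<in> sets (distr (Q x) M (coordinate n))"
  then have A[measurable]: "A \<in> sets M" by simp
  define C where "C = {\<zeta> \<in> space (PM (Suc n)). \<zeta> n \<in> A}"
  have nn: "(\<lambda>\<zeta>. \<zeta> n) \<in> PM (Suc n) \<rightarrow>\<^sub>M M" by (rule measurable_component_singleton) simp
  have C: "C \<in> sets (PM (Suc n))"
    using measurable_sets[OF nn A] by (simp add: C_def vimage_def Int_def conj_commute)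
  have co: "coordinate n \<in> Q x \<rightarrow>\<^sub>M M"
    unfolding measurable_cong_sets[OF Q_sets[OF x] refl] by (rule measurable_coordinate)
  have e: "coordinate n -` A \<inter> space (Q x) = {\<omega> \<in> space paths. restrict \<omega> {0..<Suc n} \<in> C}"
    using Q_space[OF x] measurable_space[OF restrict_paths[of "Suc n"]] by (auto simp: C_def coordinate_def)
  have "emeasure (distr (Q x) M (coordinate n)) A = tilt_factor n x *
    (\<integral>\<^sup>+w. indicator (cylinder_event n C) w * ennreal (\<eta> (W w n)) \<partial>P (Some x))"
    unfolding emeasure_distr[OF co A] e by (rule emeasure_Q_cylinder[OF x C])
  also have "(\<integral>\<^sup>+w. indicator (cylinder_event n C) w * ennreal (\<eta> (W w n)) \<partial>P (Some x))
      = (\<integral>\<^sup>+w. indicator (all_live n) w * (ennreal (\<eta> (W w n)) * indicator A (W w n)) \<partial>P (Some x))"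
  proof (rule nn_integral_cong)
    fix w assume "w \<in> space (P (Some x))"
    then have w: "w \<in> space \<Omega>" using P_space[OF xs(1)] by simp
    have "restrict (W w) {0..<Suc n} \<in> space (PM (Suc n))" using W_space[OF w] by (auto simp: space_PiM)
    then have "indicator C (restrict (W w) {0..<Suc n}) = (indicator A (W w n) :: ennreal)"
      by (auto simp: C_def split: split_indicator)
    then show "indicator (cylinder_event n C) w * ennreal (\<eta> (W w n)) = indicator (all_live n) w * (ennreal (\<eta> (W w n)) * indicator A (W w n))"
      unfolding cylinder_event_eq[OF w] by (simp only: ac_simps)
  qed
  also have "\<dots> = (\<integral>\<^sup>+y. ennreal (\<eta> y) * indicator A y \<partial>p n x)"
    by (rule live_weight[OF xs(1)]) measurable
  finally show "emeasure (distr (Q x) M (coordinate n)) A = emeasure (tilt n x) A"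
    unfolding emeasure_tilt[OF x A] .
qed

lemma Q_kernel: "x \<in> E' \<Longrightarrow> transition_kernel M E' coordinate Q n x = h n x"
  by (simp add: transition_kernel_def Q_marginal h_def)

lemma Q_coordinate_measure:
  assumes x: "x \<in> E'" and A: "A \<in> sets M"
  shows "measure (Q x) {v \<in> space paths. coordinate n v \<in> A} = measure (tilt n x) A"
proof -
  have co: "coordinate n \<in> Q x \<rightarrow>\<^sub>M M"
    unfolding measurable_cong_sets[OF Q_sets[OF x] refl] by (rule measurable_coordinate)
  have e: "{v \<in> space paths. coordinate n v \<in> A} = coordinate n -` A \<inter> space (Q x)"
    using Q_space[OF x] by auto
  show ?thesis unfolding e measure_distr[OF co A, symmetric] Q_marginal[OF x] ..
qed

lemma Q_stays_AE:
  assumes x: "x \<in> E'"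
  shows "AE w in Q x. \<forall>t\<in>UNIV. coordinate t w \<in> E'"
proof -
  have "AE w in Q x. coordinate t w \<in> E'" for t
  proof -
    have co: "coordinate t \<in> Q x \<rightarrow>\<^sub>M M"
      unfolding measurable_cong_sets[OF Q_sets[OF x] refl] by (rule measurable_coordinate)
    have "{y \<in> space M. y \<in> E'} \<in> sets M" by measurable
    from AE_distr_iff[OF co this, unfolded Q_marginal[OF x]] tilt_AE[OF x, of t]
    show ?thesis by (rule iffD1)
  qed
  then show ?thesis by (simp add: AE_all_countable)
qed

text \<open>Both sides are reduced to expectations under the original process by the finite-dimensional laws; there the weighted
  Markov property over \<open>t\<close> steps identifies them.\<close>

lemma Q_markov:
  assumes x: "x \<in> E'" and B: "B \<in> sets (canonical_filtration M s)" and A: "A \<in> sets M"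
  shows "measure (Q x) {w \<in> B. coordinate (s + t) w \<in> A} =
    (LINT w:{w \<in> B. coordinate s w \<in> E'}|Q x. measure (Q (coordinate s w)) {v \<in> space paths. coordinate t v \<in> A})"
proof -
  note xs = E'D[OF x]
  note A[measurable]
  interpret prob_space "Q x" by (rule Q_prob[OF x])
  obtain C where C[measurable]: "C \<in> sets (PM (Suc s))" and BC: "B = {\<omega> \<in> space paths. restrict \<omega> {0..<Suc s} \<in> C}"
    using canonical_filtration_cylinder[OF B] by blast
  define D where "D = {\<zeta> \<in> space (PM (Suc (s + t))). restrict \<zeta> {0..<Suc s} \<in> C \<and> \<zeta> (s + t) \<in> A}"
  have D: "D \<in> sets (PM (Suc (s + t)))"
  proof -
    have 1: "(\<lambda>\<zeta>. restrict \<zeta> {0..<Suc s}) \<in> PM (Suc (s + t)) \<rightarrow>\<^sub>M PM (Suc s)"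
      by (rule measurable_restrict_subset) auto
    have 2: "(\<lambda>\<zeta>. \<zeta> (s + t)) \<in> PM (Suc (s + t)) \<rightarrow>\<^sub>M M" by (rule measurable_component_singleton) simp
    have "D = ((\<lambda>\<zeta>. restrict \<zeta> {0..<Suc s}) -` C \<inter> space (PM (Suc (s + t)))) \<inter> ((\<lambda>\<zeta>. \<zeta> (s + t)) -` A \<inter> space (PM (Suc (s + t))))"
      by (auto simp: D_def)
    then show ?thesis using measurable_sets[OF 1 C] measurable_sets[OF 2 A] by simp
  qed
  have rr: "restrict (restrict f {0..<Suc (s + t)}) {0..<Suc s} = restrict f {0..<Suc s}" for f :: "nat \<Rightarrow> 'a"
    by (auto simp: restrict_def fun_eq_iff)
  have e: "{w \<in> B. coordinate (s + t) w \<in> A} = {\<omega> \<in> space paths. restrict \<omega> {0..<Suc (s + t)} \<in> D}"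
    using measurable_space[OF restrict_paths[of "Suc (s + t)"]]
    by (auto simp: D_def BC rr coordinate_def)
  let ?g = "\<lambda>y. indicator E' y * emeasure (tilt t y) A"
  let ?f = "\<lambda>\<omega>. indicator {w \<in> B. coordinate s w \<in> E'} \<omega> * measure (Q (coordinate s \<omega>)) {v \<in> space paths. coordinate t v \<in> A} :: real"
  let ?a = "\<lambda>w. indicator (cylinder_event s C) w * (ennreal (\<eta> (W w s)) * ?g (W w s))"
    and ?b = "\<lambda>w. indicator (all_live s) w * (ennreal (\<eta> (W w s)) * (indicator C (restrict (W w) {0..<Suc s}) * ?g (restrict (W w) {0..<Suc s} s)))"
    and ?c = "\<lambda>w. indicator (cylinder_event s C) w * (indicator (live (s + t)) w * (ennreal (\<eta> (W w (s + t))) * indicator A (W w (s + t))))"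
  have gm: "?g \<in> borel_measurable M"
  proof -
    have "(\<lambda>y. emeasure (tilt t y) A * indicator E' y) \<in> borel_measurable M"
      by (rule N_extend) (rule measurable_compose[OF measurable_prob_algebraD[OF tilt_measurable] measurable_emeasure_subprob_algebra[OF A]])
    then show ?thesis by (simp add: mult.commute)
  qed
  have ss: "(\<lambda>\<zeta>. \<zeta> s) \<in> PM (Suc s) \<rightarrow>\<^sub>M M" by (rule measurable_component_singleton) simp
  have "ennreal (measure (Q x) {w \<in> B. coordinate (s + t) w \<in> A}) = emeasure (Q x) {\<omega> \<in> space paths. restrict \<omega> {0..<Suc (s + t)} \<in> D}"
    unfolding e by (simp add: emeasure_eq_measure)
  also have "\<dots> = tilt_factor (s + t) x *
    (\<integral>\<^sup>+w. indicator (cylinder_event (s + t) D) w * ennreal (\<eta> (W w (s + t))) \<partial>P (Some x))"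
    by (rule emeasure_Q_cylinder[OF x D])
  also have "(\<integral>\<^sup>+w. indicator (cylinder_event (s + t) D) w * ennreal (\<eta> (W w (s + t))) \<partial>P (Some x))
     = (\<integral>\<^sup>+w. ?c w \<partial>P (Some x))"
  proof (rule nn_integral_cong_AE)
    have "AE w in P (Some x). w \<in> space \<Omega>" using AE_space[of "P (Some x)"] P_space[OF xs(1)] by simp
    with live_all_AE[OF xs(1), of "s + t"]
    show "AE w in P (Some x). indicator (cylinder_event (s + t) D) w * ennreal (\<eta> (W w (s + t)))
        = ?c w"
    proof eventually_elim
      case (elim w)
      have "restrict (W w) {0..<Suc (s + t)} \<in> space (PM (Suc (s + t)))" using W_space[OF elim(2)] by (auto simp: space_PiM)
      then have "restrict (W w) {0..<Suc (s + t)} \<in> D \<longleftrightarrow> restrict (W w) {0..<Suc s} \<in> C \<and> W w (s + t) \<in> A"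
        unfolding D_def mem_Collect_eq rr by simp
      then have "w \<in> cylinder_event (s + t) D \<longleftrightarrow> w \<in> cylinder_event s C \<and> w \<in> live (s + t) \<and> W w (s + t) \<in> A"
        using elim by (auto simp: cylinder_event_def)
      then show ?case by (simp add: indicator_def)
    qed
  qed
  also have "\<dots> = ennreal (\<theta>0 ^ t) * (\<integral>\<^sup>+w. ?a w \<partial>P (Some x))"
    by (rule markov_tilt[OF xs(1) cylinder_event_F[OF C] cylinder_event_live(1) A])
  also have "tilt_factor (s + t) x * \<dots> = tilt_factor s x *
      (\<integral>\<^sup>+w. ?a w \<partial>P (Some x))"
    unfolding mult.assoc[symmetric] using const xs by (simp add: ennreal_mult[symmetric] power_add)
  also have "(\<integral>\<^sup>+w. ?a w \<partial>P (Some x))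
     = (\<integral>\<^sup>+w. ?b w \<partial>P (Some x))"
  proof (rule nn_integral_cong)
    fix w assume "w \<in> space (P (Some x))"
    then have w: "w \<in> space \<Omega>" using P_space[OF xs(1)] by simp
    have r: "restrict (W w) {0..<Suc s} s = W w s" by simp
    show "?a w =
      ?b w"
      unfolding r cylinder_event_eq[OF w] by (simp only: ac_simps)
  qed
  also have "tilt_factor s x * \<dots> = (\<integral>\<^sup>+\<omega>. indicator C \<omega> * ?g (\<omega> s) \<partial>qlaw s x)"
    by (rule nn_qlaw[OF x, symmetric])
       (rule borel_measurable_times_ennreal[OF borel_measurable_indicator[OF C] measurable_compose[OF ss gm]])
  also have "\<dots> = (\<integral>\<^sup>+\<omega>. indicator C (restrict \<omega> {0..<Suc s}) * ?g (restrict \<omega> {0..<Suc s} s) \<partial>Q x)"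
    by (rule nn_Q[OF x, symmetric])
       (rule borel_measurable_times_ennreal[OF borel_measurable_indicator[OF C] measurable_compose[OF ss gm]])
  also have "\<dots> = (\<integral>\<^sup>+\<omega>. ennreal (?f \<omega>) \<partial>Q x)"
  proof (rule nn_integral_cong)
    fix \<omega> assume "\<omega> \<in> space (Q x)"
    then have \<omega>: "\<omega> \<in> space paths" using Q_space[OF x] by simp
    show "indicator C (restrict \<omega> {0..<Suc s}) * ?g (restrict \<omega> {0..<Suc s} s) =
      ennreal (?f \<omega>)"
    proof (cases "\<omega> s \<in> E'")
      case True
      interpret t: prob_space "tilt t (\<omega> s)" by (rule tilt_prob[OF True])
      show ?thesis
        using True \<omega> Q_coordinate_measure[OF True A, of t] t.emeasure_eq_measure[of A]
        by (simp add: BC coordinate_def indicator_def)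
    next
      case False
      then show ?thesis by (simp add: coordinate_def)
    qed
  qed
  also have "\<dots> = ennreal (LINT \<omega>|Q x. ?f \<omega>)"
  proof (rule nn_integral_eq_integral)
    have B': "B \<in> sets paths" unfolding BC by (rule cylinder_sets[OF C])
    have m: "(\<lambda>y. indicator E' y *\<^sub>R measure (tilt t y) A) \<in> borel_measurable M"
    proof (rule borel_measurable_restrict_space_iff[THEN iffD1])
      show "(\<lambda>y. measure (tilt t y) A) \<in> borel_measurable (restrict_space M E')"
        unfolding N_def[symmetric]
        by (rule measurable_compose[OF measurable_prob_algebraD[OF tilt_measurable] measurable_measure_subprob_algebra[OF A]])
    qed measurable
    have "(\<lambda>\<omega>. indicator B \<omega> * (indicator E' (coordinate s \<omega>) *\<^sub>R measure (tilt t (coordinate s \<omega>)) A) :: real) \<in> borel_measurable paths"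
      by (rule borel_measurable_times[OF borel_measurable_indicator[OF B'] measurable_compose[OF measurable_coordinate m]])
    then have "(?f) \<in> borel_measurable paths"
    proof (rule measurable_cong[THEN iffD1, rotated])
      fix \<omega> assume "\<omega> \<in> space paths"
      show "indicator B \<omega> * (indicator E' (coordinate s \<omega>) *\<^sub>R measure (tilt t (coordinate s \<omega>)) A)
        = ?f \<omega>"
        by (cases "coordinate s \<omega> \<in> E'") (simp_all add: Q_coordinate_measure[OF _ A] indicator_def)
    qed
    then have fm: "(?f) \<in> borel_measurable (Q x)"
      by (simp add: measurable_cong_sets[OF Q_sets[OF x] refl])
    show "integrable (Q x) (?f)"
    proof (rule integrable_const_bound[where B=1, OF AE_I2 fm])
      fix \<omega> assume "\<omega> \<in> space (Q x)"
      show "norm (?f \<omega> :: real) \<le> 1"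
        using prob_space.prob_le_1[OF Q_prob, of "coordinate s \<omega>" "{v \<in> space paths. coordinate t v \<in> A}"]
        by (simp add: indicator_def)
    qed
  qed auto
  finally show ?thesis
    unfolding set_lebesgue_integral_def
    by (subst (asm) ennreal_inj) (auto intro!: integral_nonneg_AE)
qed

text \<open>On cylinders \<open>Q x\<close> is an explicit expectation under \<open>P (Some x)\<close>, which depends measurably on \<open>x\<close>.\<close>

lemma Q_measurable: "Q \<in> restrict_space M E' \<rightarrow>\<^sub>M prob_algebra paths"
proof (rule measurable_prob_algebra_generated[OF _ Int_stable_prod_algebra prod_algebra_sets_into_space])
  show "sets paths = sigma_sets (\<Pi>\<^sub>E i\<in>UNIV. space M) (prod_algebra UNIV (\<lambda>_. M))"
    unfolding path_space_def by (rule sets_PiM)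
  show "prob_space (Q x)" "sets (Q x) = sets paths" if "x \<in> space (restrict_space M E')" for x
    using that Q_prob Q_sets by (auto simp: space_restrict_space)
  fix A assume "A \<in> prod_algebra UNIV (\<lambda>_::nat. M)"
  then obtain J G where A: "A = prod_emb UNIV (\<lambda>_. M) J (Pi\<^sub>E J G)" and J: "finite J" "\<And>i. i \<in> J \<Longrightarrow> G i \<in> sets M"
    by (rule prod_algebraE) auto
  obtain m where m: "J \<subseteq> {0..<Suc m}"
    using finite_nat_bounded[OF J(1)] by (metis atLeast0LessThan lessThan_subset_iff less_imp_le_nat lessI order_trans)
  define C where "C = prod_emb {0..<Suc m} (\<lambda>_. M) J (Pi\<^sub>E J G)"
  have C: "C \<in> sets (PM (Suc m))"
    unfolding C_def by (rule sets_PiM_I[OF J(1) m]) (use J in auto)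
  have AC: "A = {\<omega> \<in> space paths. restrict \<omega> {0..<Suc m} \<in> C}"
  proof -
    have "restrict (restrict \<omega> {0..<Suc m}) J = restrict \<omega> J" for \<omega> :: "nat \<Rightarrow> 'a"
      using m by (auto simp: restrict_def fun_eq_iff)
    then show ?thesis
      unfolding A C_def prod_emb_def path_space_def space_PiM by (auto simp: PiE_iff)
  qed
  have 1: "(\<lambda>x. \<integral>\<^sup>+w. indicator (cylinder_event m C) w * ennreal (\<eta> (W w m)) \<partial>P (Some x)) \<in> borel_measurable M"
  proof (rule measurable_compose[OF measurable_prob_algebraD[OF P_measurable] nn_integral_measurable_subprob_algebra])
    have [measurable]: "cylinder_event m C \<in> sets \<Omega>" by (rule F_sets[OF cylinder_event_F[OF C]])
    show "(\<lambda>w. indicator (cylinder_event m C) w * ennreal (\<eta> (W w m))) \<in> borel_measurable \<Omega>" by measurable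
  qed
  have "(\<lambda>x. tilt_factor m x * (\<integral>\<^sup>+w. indicator (cylinder_event m C) w * ennreal (\<eta> (W w m)) \<partial>P (Some x))) \<in> borel_measurable (restrict_space M E')"
    by (rule measurable_restrict_space1) (use 1 in measurable)
  then show "(\<lambda>x. emeasure (Q x) A) \<in> borel_measurable (restrict_space M E')"
    by (rule measurable_cong[THEN iffD2, rotated])
       (simp add: space_restrict_space AC emeasure_Q_cylinder[OF _ C] del: restrict_apply)
qed

lemma Q_homogeneous_markov: "homogeneous_markov_process UNIV M E' paths coordinate Q"
  unfolding homogeneous_markov_process_def
proof (intro conjI ballI)
  show "E' \<in> sets M" by (rule E'_sets)
  show "coordinate t \<in> paths \<rightarrow>\<^sub>M M" for t by (rule measurable_coordinate)
  show "Q \<in> restrict_space M E' \<rightarrow>\<^sub>M prob_algebra paths" by (rule Q_measurable)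
  fix x assume x: "x \<in> E'"
  show "distr (Q x) M (coordinate 0) = return M x" using Q_marginal[OF x, of 0] tilt_init[OF x] by simp
  show "AE w in Q x. \<forall>t\<in>UNIV. coordinate t w \<in> E'" by (rule Q_stays_AE[OF x])
  show "measure (Q x) {w \<in> B. coordinate (s + t) w \<in> A} =
    (LINT w:{w \<in> B. coordinate s w \<in> E'}|Q x. measure (Q (coordinate s w)) {v \<in> space paths. coordinate t v \<in> A})"
    if "B \<in> sets (natural_filtration UNIV M paths coordinate s)" "A \<in> sets M" for s t B A
    by (rule Q_markov[OF x _ that(2)]) (use that(1) in \<open>simp add: canonical_filtration_def\<close>)
qed

text \<open>Numerator and denominator of the conditional probability are normalised by \<open>\<theta>0 ^ k\<close>.  The limit of the numerator is
  taken under the law \<open>R\<close> of \<open>X m\<close> on the event, which integrates \<open>\<phi>1\<close>.\<close>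

lemma Q_limit:
  assumes x: "x \<in> E'" and A: "A \<in> sets (canonical_filtration M m)"
  shows "(\<lambda>n. conditional_path_prob T \<Omega> X P x m A n) \<longlonglongrightarrow> measure (Q x) A"
proof -
  note xs = E'D[OF x]
  note [measurable_cong] = P_sets[OF xs(1)]
  interpret prob_space "Q x" by (rule Q_prob[OF x])
  obtain C where C[measurable]: "C \<in> sets (PM (Suc m))" and AC: "A = {\<omega> \<in> space paths. restrict \<omega> {0..<Suc m} \<in> C}"
    using canonical_filtration_cylinder[OF A] by blast
  let ?B = "cylinder_event m C"
  have B[measurable]: "?B \<in> sets \<Omega>" by (rule F_sets[OF cylinder_event_F[OF C]])
  define R where "R = distr (density (P (Some x)) (indicator ?B)) M (\<lambda>w. W w m)"
  have Rs: "sets R = sets M" by (simp add: R_def)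
  have nnR: "(\<integral>\<^sup>+y. g y \<partial>R) = (\<integral>\<^sup>+w. indicator ?B w * g (W w m) \<partial>P (Some x))" if [measurable]: "g \<in> borel_measurable M" for g
    unfolding R_def by (subst nn_integral_distr) (auto simp: nn_integral_density)
  have "(\<integral>\<^sup>+y. ennreal (\<phi>1 y) \<partial>R) \<le> (\<integral>\<^sup>+y. ennreal (\<phi>1 y) \<partial>p m x)"
  proof -
    have "(\<integral>\<^sup>+y. ennreal (\<phi>1 y) \<partial>R) = (\<integral>\<^sup>+w. indicator ?B w * ennreal (\<phi>1 (W w m)) \<partial>P (Some x))" by (rule nnR) measurable
    also have "\<dots> \<le> (\<integral>\<^sup>+w. indicator (live m) w * ennreal (\<phi>1 (W w m)) \<partial>P (Some x))"
      by (rule nn_integral_mono) (use cylinder_event_live(1)[of m C] in \<open>auto split: split_indicator\<close>)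
    also have "\<dots> = (\<integral>\<^sup>+y. ennreal (\<phi>1 y) \<partial>p m x)" by (rule nn_p[symmetric, OF xs(1)]) measurable
    finally show ?thesis .
  qed
  also have "\<dots> < \<infinity>" by (rule le_less_trans[OF \<phi>1_iterate[OF xs(1)]]) simp
  finally have fin: "(\<integral>\<^sup>+y. ennreal (\<phi>1 y) \<partial>R) < \<infinity>" .
  have QA: "ennreal (measure (Q x) A) = tilt_factor m x * (\<integral>\<^sup>+y. ennreal (\<eta> y) \<partial>R)"
    using emeasure_Q_cylinder[OF x C] unfolding AC[symmetric] nnR[OF measurable_compose[OF eta_measurable measurable_ennreal]]
    by (simp add: emeasure_eq_measure)
  have lim: "(\<lambda>k. \<integral>\<^sup>+y. ennreal (surv k y) \<partial>R) \<longlonglongrightarrow> (\<integral>\<^sup>+y. ennreal (\<eta> y) \<partial>R)"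
    by (rule eta_dominated_convergence[OF Rs fin])
  have "ennreal (\<theta>0 ^ m * \<eta> x) * ennreal (measure (Q x) A) = (\<integral>\<^sup>+y. ennreal (\<eta> y) \<partial>R)"
    unfolding QA mult.assoc[symmetric] using const xs by (simp add: ennreal_mult[symmetric])
  then have Reta: "(\<integral>\<^sup>+y. ennreal (\<eta> y) \<partial>R) = ennreal (\<theta>0 ^ m * \<eta> x * measure (Q x) A)"
    using const xs by (simp add: ennreal_mult)
  have num: "(\<integral>\<^sup>+y. ennreal (surv k y) \<partial>R) = ennreal (prob_from P x (?B \<inter> alive T \<Omega> X (m + k)) / \<theta>0 ^ k)" for k
  proof -
    have "(\<integral>\<^sup>+y. ennreal (surv k y) \<partial>R) = (\<integral>\<^sup>+w. indicator ?B w * ennreal (surv k (W w m)) \<partial>P (Some x))"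
      by (rule nnR) measurable
    also have "\<dots> = (\<integral>\<^sup>+w. ennreal (1 / \<theta>0 ^ k) * (indicator ?B w * emeasure (p k (W w m)) (space M)) \<partial>P (Some x))"
    proof (rule nn_integral_cong)
      fix w assume "w \<in> space (P (Some x))"
      then have w: "W w m \<in> space M" using P_space[OF xs(1)] W_space by simp
      have "ennreal (surv k (W w m)) = ennreal (1 / \<theta>0 ^ k) * emeasure (p k (W w m)) (space M)"
        using const unfolding kernel_emeasure[OF w] surv_def by (simp add: ennreal_mult[symmetric])
      then show "indicator ?B w * ennreal (surv k (W w m)) = ennreal (1 / \<theta>0 ^ k) * (indicator ?B w * emeasure (p k (W w m)) (space M))"
        by (simp only: ac_simps)
    qed
    also have "\<dots> = ennreal (1 / \<theta>0 ^ k) * (\<integral>\<^sup>+w. indicator ?B w * emeasure (p k (W w m)) (space M) \<partial>P (Some x))"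
    proof (rule nn_integral_cmult)
      have [measurable]: "(\<lambda>w. emeasure (p k (W w m)) (space M)) \<in> borel_measurable \<Omega>"
        by (rule measurable_compose[OF W_measurable emeasure_measurable]) simp
      show "(\<lambda>w. indicator ?B w * emeasure (p k (W w m)) (space M)) \<in> borel_measurable (P (Some x))" by measurable
    qed
    also have "\<dots> = ennreal (prob_from P x (?B \<inter> alive T \<Omega> X (m + k)) / \<theta>0 ^ k)"
      unfolding prob_from_cylinder[OF xs(1) C, symmetric]
      using const by (simp add: ennreal_mult[symmetric] prob_from_def)
    finally show ?thesis .
  qed
  have "(\<lambda>k. ennreal (prob_from P x (?B \<inter> alive T \<Omega> X (m + k)) / \<theta>0 ^ k)) \<longlonglongrightarrow> ennreal (\<theta>0 ^ m * \<eta> x * measure (Q x) A)"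
    using lim unfolding num Reta .
  then have 1: "(\<lambda>k. prob_from P x (?B \<inter> alive T \<Omega> X (m + k)) / \<theta>0 ^ k) \<longlonglongrightarrow> \<theta>0 ^ m * \<eta> x * measure (Q x) A"
    by (rule tendsto_ennrealD) (use const xs in \<open>auto simp: prob_from_def intro!: always_eventually\<close>)
  have 2: "(\<lambda>k. surv (k + m) x) \<longlonglongrightarrow> \<eta> x" by (rule LIMSEQ_ignore_initial_segment[OF surv_lim[OF xs(1)]])
  have "(\<lambda>k. (prob_from P x (?B \<inter> alive T \<Omega> X (m + k)) / \<theta>0 ^ k) / (\<theta>0 ^ m * surv (k + m) x))
      \<longlonglongrightarrow> (\<theta>0 ^ m * \<eta> x * measure (Q x) A) / (\<theta>0 ^ m * \<eta> x)"
    by (rule tendsto_divide[OF 1 tendsto_mult[OF tendsto_const 2]]) (use const xs in simp)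
  moreover have "(\<theta>0 ^ m * \<eta> x * measure (Q x) A) / (\<theta>0 ^ m * \<eta> x) = measure (Q x) A" using const xs by simp
  moreover have "(prob_from P x (?B \<inter> alive T \<Omega> X (m + k)) / \<theta>0 ^ k) / (\<theta>0 ^ m * surv (k + m) x)
      = conditional_path_prob T \<Omega> X P x m A (k + m)" for k
    unfolding conditional_path_prob_def trajectory_cylinder[OF AC] surv_def prob_from_alive[OF xs(1)]
    using const by (simp add: power_add add.commute mult.commute)
  ultimately have "(\<lambda>k. conditional_path_prob T \<Omega> X P x m A (k + m)) \<longlonglongrightarrow> measure (Q x) A" by simp
  then show ?thesis by (rule LIMSEQ_offset)
qed

text \<open>The factor \<open>\<eta>\<close> makes the values of \<open>\<phi>\<close> outside \<open>E'\<close> irrelevant, so that \<open>\<phi>\<close> may be replaced by its extension \<open>\<psi>\<close> by zero.\<close>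

lemma Q_semigroup:
  assumes \<phi>: "\<phi> \<in> borel_measurable (restrict_space M E')" and b: "bounded (\<phi> ` E')" and x: "x \<in> E'"
  shows "killed_integrable T \<Omega> X P n (\<lambda>y. \<eta> y * \<phi> y) x"
    "(LINT y|transition_kernel M E' coordinate Q n x. \<phi> y) =
      inverse (\<theta>0 ^ n) / \<eta> x * killed_semigroup T \<Omega> X P n (\<lambda>y. \<eta> y * \<phi> y) x"
proof -
  note xs = E'D[OF x]
  note [measurable_cong] = kernel_sets[OF xs(1)]
  define \<psi> where "\<psi> y = indicator E' y * \<phi> y" for y
  have \<psi>[measurable]: "\<psi> \<in> borel_measurable M"
    using \<phi> unfolding \<psi>_def by (subst (asm) borel_measurable_restrict_space_iff) auto
  have e: "\<eta> y * \<phi> y = \<eta> y * \<psi> y" if "y \<in> space M" for y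
    using eta_outside[OF that] by (auto simp: \<psi>_def indicator_def)
  obtain c where c: "\<And>y. y \<in> E' \<Longrightarrow> \<bar>\<phi> y\<bar> \<le> c" using b unfolding bounded_iff by auto
  have m: "(\<lambda>y. \<eta> y * \<psi> y) \<in> borel_measurable M" by measurable
  have "integrable (p n x) \<eta>"
    by (rule integrableI_nonneg) (use eta_eigen[OF xs(1), of n] eta_nonneg kernel_space[OF xs(1)] in auto)
  then have i0: "integrable (p n x) (\<lambda>y. \<eta> y * c)" by simp
  have i: "integrable (p n x) (\<lambda>y. \<eta> y * \<psi> y)"
  proof (rule Bochner_Integration.integrable_bound[OF i0])
    show "AE y in p n x. norm (\<eta> y * \<psi> y) \<le> norm (\<eta> y * c)"
    proof (rule AE_I2)
      fix y assume "y \<in> space (p n x)"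
      have "\<bar>\<psi> y\<bar> \<le> \<bar>c\<bar>" using c[of y] by (auto simp: \<psi>_def indicator_def)
      then show "norm (\<eta> y * \<psi> y) \<le> norm (\<eta> y * c)" by (simp add: abs_mult mult_left_mono)
    qed
  qed measurable
  then show "killed_integrable T \<Omega> X P n (\<lambda>y. \<eta> y * \<phi> y) x"
    using killed_iff(1)[OF xs(1) m e] by simp
  have "(LINT y|transition_kernel M E' coordinate Q n x. \<phi> y) = (LINT y|tilt n x. indicator E' y *\<^sub>R \<phi> y)"
    unfolding Q_kernel[OF x] h_def using tilt_sets[OF xs(1)]
    by (subst integral_restrict_space) (auto simp: set_lebesgue_integral_def)
  also have "\<dots> = (LINT y|tilt n x. \<psi> y)" by (simp add: \<psi>_def)
  also have "\<dots> = (LINT y|p n x. (\<eta> y / (\<theta>0 ^ n * \<eta> x)) *\<^sub>R \<psi> y)"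
    unfolding tilt_def
    by (rule integral_density) (use eta_nonneg kernel_space[OF xs(1)] const xs in \<open>auto intro!: AE_I2 divide_nonneg_nonneg\<close>)
  also have "\<dots> = (LINT y|p n x. (inverse (\<theta>0 ^ n) / \<eta> x) * (\<eta> y * \<psi> y))"
    by (rule Bochner_Integration.integral_cong) (auto simp: field_simps)
  also have "\<dots> = inverse (\<theta>0 ^ n) / \<eta> x * (LINT y|p n x. \<eta> y * \<psi> y)" by (rule integral_mult_right_zero)
  finally show "(LINT y|transition_kernel M E' coordinate Q n x. \<phi> y) =
      inverse (\<theta>0 ^ n) / \<eta> x * killed_semigroup T \<Omega> X P n (\<lambda>y. \<eta> y * \<phi> y) x"
    using killed_iff(2)[OF xs(1) m e] by simp
qed

end

section \<open>Existence, semigroup and ergodicity of the Q-process\<close>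

lemma ennreal_le_mult_of_divide_le:
  fixes a b c :: ennreal
  assumes "a / b \<le> c" "b \<noteq> 0" "b \<noteq> \<top>"
  shows "a \<le> c * b"
proof -
  have "a = (a * b) / b" using assms by (simp add: mult_divide_eq_ennreal)
  also have "\<dots> = (a / b) * b" by (simp add: ennreal_times_divide mult.commute)
  also have "\<dots> \<le> c * b" by (rule mult_right_mono[OF assms(1)]) simp
  finally show ?thesis .
qed

context absorbed_process begin

lemma p_bounded_integrable:
  assumes x: "x \<in> space M" and f: "f \<in> borel_measurable M" "\<And>y. y \<in> space M \<Longrightarrow> \<bar>f y\<bar> \<le> 1"
  shows "integrable (p n x) (f :: 'a \<Rightarrow> real)"
proof -
  interpret subprob_space "p n x" by (rule p_subprob[OF x])
  show ?thesis
    by (rule integrable_const_bound[where B=1])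
       (use f kernel_space[OF x] in \<open>auto simp: measurable_cong_sets[OF p_sets refl]\<close>)
qed

text \<open>The transfer from the process to its kernel.  The delicate point is the quotient of survival probabilities in
  extended reals: its bound yields a product inequality only if the infimum is neither zero nor infinite, and it is
  positive because \<open>\<phi>2\<close> is bounded below on \<open>K\<close> and grows at the rate \<open>\<theta>2\<close>.\<close>

lemma qsd_chain_of_assumption_E:
  assumes E: "assumption_E T M \<Omega> X P n1 \<theta>1 \<theta>2 c1 c2 c3 \<phi>1 \<phi>2 K \<nu>"
    and qs: "quasi_stationary T M \<Omega> X P \<pi>"
      "(\<integral>\<^sup>+x. ennreal (\<phi>1 x) \<partial>\<pi>) < \<infinity>" "(LINT x|\<pi>. \<phi>2 x) > 0"
    and theta0: "0 < \<theta>0" "\<forall>n\<ge>1. prob_init P \<pi> (alive T \<Omega> X n) = \<theta>0 ^ n"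
    and eta: "\<forall>x\<in>space M. (\<lambda>n. prob_from P x (alive T \<Omega> X n) / \<theta>0 ^ n) \<longlonglongrightarrow> \<eta> x"
  shows "\<exists>h1. qsd_chain M p n1 \<theta>0 \<theta>1 \<theta>2 c1 c2 c3 h1 \<phi>1 \<phi>2 \<eta> K \<nu> \<pi>"
proof -
  from E have pos: "0 < \<theta>1" "0 < \<theta>2" "0 < c1" "0 < c2" "0 < c3" "\<theta>1 < \<theta>2"
    and \<phi>m[measurable]: "\<phi>1 \<in> borel_measurable M" "\<phi>2 \<in> borel_measurable M"
    and \<phi>nn: "\<And>x. x \<in> space M \<Longrightarrow> 0 \<le> \<phi>1 x" "\<And>x. x \<in> space M \<Longrightarrow> 0 \<le> \<phi>2 x"
    and K: "K \<in> sets M" and \<nu>: "prob_space \<nu>" "sets \<nu> = sets (restrict_space M K)"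
    and E1: "\<And>x A. x \<in> K \<Longrightarrow> A \<in> sets M \<Longrightarrow> prob_from P x (visit \<Omega> X n1 A) \<ge> c1 * measure \<nu> (A \<inter> K)"
    and \<phi>1: "\<And>x. x \<in> space M \<Longrightarrow> 1 \<le> \<phi>1 x" "bdd_above (\<phi>1 ` K)"
    and \<phi>2: "0 < (INF x\<in>K. \<phi>2 x)" "\<And>x. x \<in> space M \<Longrightarrow> \<phi>2 x \<le> 1"
    and L1: "\<And>x. x \<in> space M \<Longrightarrow> killed_integrable T \<Omega> X P 1 \<phi>1 x"
      "\<And>x. x \<in> space M \<Longrightarrow> killed_semigroup T \<Omega> X P 1 \<phi>1 x \<le> \<theta>1 * \<phi>1 x + c2 * indicator K x"
    and L2: "\<And>x. x \<in> space M \<Longrightarrow> killed_semigroup T \<Omega> X P 1 \<phi>2 x \<ge> \<theta>2 * \<phi>2 x"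
    and E3: "(SUP n. (SUP y\<in>K. ennreal (prob_from P y (alive T \<Omega> X n))) /
             (INF y\<in>K. ennreal (prob_from P y (alive T \<Omega> X n)))) \<le> ennreal c3"
    and E4: "\<And>x. x \<in> K \<Longrightarrow> \<exists>n4. \<forall>n\<ge>n4. prob_from P x (visit \<Omega> X n K) > 0"
    unfolding assumption_E_def by auto
  have KM: "x \<in> space M" if "x \<in> K" for x using sets.sets_into_space[OF K] that by auto
  have \<pi>: "prob_space \<pi>" "sets \<pi> = sets M" using qs(1) by (auto simp: quasi_stationary_def)
  interpret \<pi>: prob_space \<pi> by (rule \<pi>(1))
  have sp\<pi>: "space \<pi> = space M" by (rule sets_eq_imp_space_eq[OF \<pi>(2)])
  obtain h1 where h1: "\<And>x. x \<in> K \<Longrightarrow> \<phi>1 x \<le> h1" using \<phi>1(2) unfolding bdd_above_def by auto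
  have lyap: "(\<integral>\<^sup>+y. ennreal (\<phi>1 y) \<partial>p 1 x) \<le> ennreal (\<theta>1 * \<phi>1 x + c2 * indicator K x)" if x: "x \<in> space M" for x
  proof -
    have i: "integrable (p 1 x) \<phi>1" using L1(1)[OF x] killed_iff(1)[OF x \<phi>m(1), of \<phi>1 1] by simp
    have "(\<integral>\<^sup>+y. ennreal (\<phi>1 y) \<partial>p 1 x) = ennreal (LINT y|p 1 x. \<phi>1 y)"
      by (rule nn_integral_eq_integral[OF i]) (use \<phi>nn(1) kernel_space[OF x] in auto)
    then show ?thesis using L1(2)[OF x] killed_iff(2)[OF x \<phi>m(1), of \<phi>1 1] by (simp add: ennreal_leI)
  qed
  have growth: "ennreal (\<theta>2 * \<phi>2 x) \<le> (\<integral>\<^sup>+y. ennreal (\<phi>2 y) \<partial>p 1 x)" if x: "x \<in> space M" for x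
  proof -
    have "integrable (p 1 x) \<phi>2" by (rule p_bounded_integrable[OF x \<phi>m(2)]) (use \<phi>nn(2) \<phi>2(2) in auto)
    then have "(\<integral>\<^sup>+y. ennreal (\<phi>2 y) \<partial>p 1 x) = ennreal (LINT y|p 1 x. \<phi>2 y)"
      by (rule nn_integral_eq_integral) (use \<phi>nn(2) kernel_space[OF x] in auto)
    then show ?thesis using L2[OF x] killed_iff(2)[OF x \<phi>m(2), of \<phi>2 1] by (simp add: ennreal_leI)
  qed
  have harnack: "measure (p n x) (space M) \<le> c3 * measure (p n y) (space M)" if x: "x \<in> K" and y: "y \<in> K" for n x y
  proof -
    define d where "d = (INF x\<in>K. \<phi>2 x)"
    let ?s = "\<lambda>y. ennreal (measure (p n y) (space M))"
    have lower: "ennreal (\<theta>2 ^ n * d) \<le> ?s z" if z: "z \<in> K" for z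
    proof -
      have "d \<le> \<phi>2 z" unfolding d_def
        by (rule cINF_lower[OF _ z]) (use \<phi>nn(2) KM in \<open>auto intro!: bdd_belowI2[where m=0]\<close>)
      then have "ennreal (\<theta>2 ^ n * d) \<le> ennreal (\<theta>2 ^ n * \<phi>2 z)" using pos by (intro ennreal_leI mult_left_mono) auto
      also have "\<dots> \<le> (\<integral>\<^sup>+y. ennreal (\<phi>2 y) \<partial>p n z)"
        by (rule subharmonic_iterate[OF \<phi>m(2) \<phi>nn(2) _ growth KM[OF z]]) (use pos in auto)
      also have "\<dots> \<le> (\<integral>\<^sup>+y. 1 \<partial>p n z)"
        by (rule nn_integral_mono) (use \<phi>2(2) kernel_space[OF KM[OF z]] in \<open>auto simp: ennreal_le_1\<close>)
      also have "\<dots> = ?s z" using kernel_emeasure[OF KM[OF z]] kernel_space[OF KM[OF z]] by simp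
      finally show ?thesis .
    qed
    have d: "0 < \<theta>2 ^ n * d" using pos \<phi>2(1) by (simp add: d_def)
    have e: "(SUP y\<in>K. ennreal (prob_from P y (alive T \<Omega> X n))) = (SUP y\<in>K. ?s y)"
      "(INF y\<in>K. ennreal (prob_from P y (alive T \<Omega> X n))) = (INF y\<in>K. ?s y)"
      using prob_from_alive KM by auto
    have "(SUP y\<in>K. ?s y) / (INF y\<in>K. ?s y) \<le> ennreal c3"
      using order_trans[OF SUP_upper[of n UNIV] E3] unfolding e by simp
    moreover have "ennreal (\<theta>2 ^ n * d) \<le> (INF y\<in>K. ?s y)" by (rule INF_greatest) (rule lower)
    then have "(INF y\<in>K. ?s y) \<noteq> 0" using d by (metis ennreal_eq_0_iff le_zero_eq not_le)
    moreover have le: "(INF y\<in>K. ?s y) \<le> ?s y" by (rule INF_lower[OF y])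
    then have "(INF y\<in>K. ?s y) \<noteq> \<top>" by (auto simp: top_unique)
    ultimately have "(SUP y\<in>K. ?s y) \<le> ennreal c3 * (INF y\<in>K. ?s y)" by (rule ennreal_le_mult_of_divide_le)
    also have "\<dots> \<le> ennreal c3 * ?s y" by (rule mult_left_mono[OF le]) simp
    finally have "(SUP y\<in>K. ?s y) \<le> ennreal c3 * ?s y" .
    then have "?s x \<le> ennreal c3 * ?s y" by (rule order_trans[OF SUP_upper[OF x]])
    then show ?thesis using pos by (simp add: ennreal_mult[symmetric])
  qed
  have init1: "prob_init P \<pi> (alive T \<Omega> X n) = \<theta>0 ^ n" for n
  proof (cases "n = 0")
    case True
    have "prob_from P x (alive T \<Omega> X 0) = 1" if x: "x \<in> space M" for x
      using x prob_from_alive[OF x, of 0] init[OF x] prob_space.prob_space[OF prob_space_return[OF x]] by simp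
    then have "prob_init P \<pi> (alive T \<Omega> X 0) = (LINT x|\<pi>. 1)"
      unfolding prob_init_def using sp\<pi> by (intro Bochner_Integration.integral_cong) auto
    then show ?thesis using True \<pi>.prob_space by simp
  qed (use theta0(2) in simp)
  have qsd: "(LINT x|\<pi>. measure (p n x) A) = \<theta>0 ^ n * measure \<pi> A" if A: "A \<in> sets M" for n A
  proof -
    have "prob_init P \<pi> (visit \<Omega> X n A \<inter> alive T \<Omega> X n) = (LINT x|\<pi>. measure (p n x) A)"
      unfolding prob_init_def by (rule Bochner_Integration.integral_cong) (use sp\<pi> prob_from_visit_alive[OF _ A] in auto)
    moreover have "prob_init P \<pi> (visit \<Omega> X n A \<inter> alive T \<Omega> X n) / prob_init P \<pi> (alive T \<Omega> X n) = measure \<pi> A"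
      using qs(1) A by (simp add: quasi_stationary_def)
    ultimately show ?thesis using theta0(1) unfolding init1 by (simp add: field_simps)
  qed
  have "qsd_chain M p n1 \<theta>0 \<theta>1 \<theta>2 c1 c2 c3 h1 \<phi>1 \<phi>2 \<eta> K \<nu> \<pi>"
  proof (rule qsd_chain.intro[OF kernel_semigroup_axioms qsd_chain_axioms.intro])
    show "c1 * measure \<nu> (A \<inter> K) \<le> measure (p n1 x) A" if "x \<in> K" "A \<in> sets M" for x A
      using E1[OF that] prob_from_visit[OF KM[OF that(1)] that(2)] by simp
    show "\<exists>m. \<forall>n\<ge>m. 0 < measure (p n x) K" if "x \<in> K" for x
      using E4[OF that] prob_from_visit[OF KM[OF that] K] by simp
    show "(\<lambda>n. measure (p n x) (space M) / \<theta>0 ^ n) \<longlonglongrightarrow> \<eta> x" if "x \<in> space M" for x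
      using eta[rule_format, OF that] unfolding prob_from_alive[OF that] .
  qed (fact pos theta0(1) \<phi>m \<phi>1(1) h1 \<phi>nn(2) \<phi>2(2) K lyap growth harnack \<nu> \<pi> qsd qs(2,3))+
  then show ?thesis by blast
qed

end

context q_process begin

lemma bind_Q_kernel:
  assumes "space \<mu> = E'"
  shows "\<mu> \<bind> transition_kernel M E' coordinate Q n = \<mu> \<bind> h n"
  by (rule bind_cong_All) (use assms Q_kernel in auto)

lemma distribution_space: "distribution_on (restrict_space M E') \<mu> \<Longrightarrow> space \<mu> = E'"
  using sets_eq_imp_space_eq[of \<mu> "restrict_space M E'"] space_N unfolding distribution_on_def N_def by simp

lemma invariant_iff:
  "invariant_distribution (restrict_space M E') (transition_kernel M E' coordinate Q) \<mu>
    \<longleftrightarrow> invariant_distribution N h \<mu>"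
  using bind_Q_kernel distribution_space unfolding invariant_distribution_def N_def[symmetric] by fastforce

end

theorem theorem2p3:
  fixes M :: "'a measure" and T :: "real set" and \<Omega> :: "'w measure"
    and X :: "real \<Rightarrow> 'w \<Rightarrow> 'a option" and P :: "'a option \<Rightarrow> 'w measure"
    and n1 :: nat and \<theta>1 \<theta>2 c1 c2 c3 \<theta>0 :: real and \<phi>1 \<phi>2 \<eta> :: "'a \<Rightarrow> real"
    and K E' :: "'a set" and \<nu> \<nu>QSD \<beta> :: "'a measure"
  assumes process: "absorbed_markov_process T M \<Omega> X P"
    and E: "assumption_E T M \<Omega> X P n1 \<theta>1 \<theta>2 c1 c2 c3 \<phi>1 \<phi>2 K \<nu>"
    and qsd: "quasi_stationary T M \<Omega> X P \<nu>QSD"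
      "(\<integral>\<^sup>+x. ennreal (\<phi>1 x) \<partial>\<nu>QSD) < \<infinity>" "(LINT x|\<nu>QSD. \<phi>2 x) > 0"
    and theta0: "0 < \<theta>0" "\<theta>0 \<le> 1" "\<forall>n\<ge>1. prob_init P \<nu>QSD (alive T \<Omega> X n) = \<theta>0 ^ n"
    and eta: "\<forall>x\<in>space M. (\<lambda>n. prob_from P x (alive T \<Omega> X n) / \<theta>0 ^ n) \<longlonglongrightarrow> \<eta> x"
    and E'_def: "E' = {x \<in> space M. \<eta> x > 0}"
    and \<beta>_def: "\<beta> = density (restrict_space \<nu>QSD E') (\<lambda>x. ennreal (\<eta> x))"
  shows "\<exists>Q :: 'a \<Rightarrow> (nat \<Rightarrow> 'a) measure.
    \<comment> \<open>(i)\<close>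
    (\<forall>x\<in>E'. prob_space (Q x) \<and> sets (Q x) = sets (path_space M) \<and>
       (\<forall>m. \<forall>A\<in>sets (canonical_filtration M m).
          (\<lambda>n. conditional_path_prob T \<Omega> X P x m A n) \<longlonglongrightarrow> measure (Q x) A)) \<and>
    homogeneous_markov_process UNIV M E' (path_space M) coordinate Q \<and>
    \<comment> \<open>(ii)\<close>
    (\<forall>\<phi> \<in> borel_measurable (restrict_space M E'). bounded (\<phi> ` E') \<longrightarrow>
       (\<forall>n. \<forall>x\<in>E'. killed_integrable T \<Omega> X P n (\<lambda>y. \<eta> y * \<phi> y) x \<and>
          (LINT y|transition_kernel M E' coordinate Q n x. \<phi> y) =
          inverse (\<theta>0 ^ n) / \<eta> x * killed_semigroup T \<Omega> X P n (\<lambda>y. \<eta> y * \<phi> y) x)) \<and>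
    \<comment> \<open>(iii)\<close>
    invariant_distribution (restrict_space M E') (transition_kernel M E' coordinate Q) \<beta> \<and>
    (\<forall>\<mu>. invariant_distribution (restrict_space M E') (transition_kernel M E' coordinate Q) \<mu>
       \<longrightarrow> \<mu> = \<beta>) \<and>
    (\<exists>C \<alpha> :: real. 0 < C \<and> 0 < \<alpha> \<and> \<alpha> < 1 \<and>
       (\<forall>\<mu>. distribution_on (restrict_space M E') \<mu> \<and>
            (\<integral>\<^sup>+x. ennreal (\<phi>1 x / \<eta> x) \<partial>\<mu>) < \<infinity> \<longrightarrow>
          (\<forall>n. weighted_TV (restrict_space M E') (\<lambda>x. \<phi>1 x / \<eta> x)
                 (\<mu> \<bind> transition_kernel M E' coordinate Q n) \<beta>
               \<le> ennreal (C * \<alpha> ^ n) * (\<integral>\<^sup>+x. ennreal (\<phi>1 x / \<eta> x) \<partial>\<mu>)))) \<and>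
    (\<forall>\<mu>. distribution_on (restrict_space M E') \<mu> \<longrightarrow>
       (\<lambda>n. weighted_TV (restrict_space M E') (\<lambda>_. 1)
              (\<mu> \<bind> transition_kernel M E' coordinate Q n) \<beta>) \<longlonglongrightarrow> 0)"
proof -
  have "prob_space \<nu>" "sets \<nu> = sets (restrict_space M K)"
    using E by (simp_all add: assumption_E_def)
  then have "space (restrict_space M K) \<noteq> {}"
    using prob_space.not_empty[of \<nu>] sets_eq_imp_space_eq[of \<nu> "restrict_space M K"] by simp
  then have "space M \<noteq> {}" by (auto simp: space_restrict_space)
  with process interpret A: absorbed_process T M \<Omega> X P by (rule absorbed_process.intro)
  obtain h1 where qc: "qsd_chain M A.p n1 \<theta>0 \<theta>1 \<theta>2 c1 c2 c3 h1 \<phi>1 \<phi>2 \<eta> K \<nu> \<nu>QSD"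
    using A.qsd_chain_of_assumption_E[OF E qsd theta0(1,3) eta] by blast
  interpret q: q_process T M \<Omega> X P n1 \<theta>0 \<theta>1 \<theta>2 c1 c2 c3 h1 \<phi>1 \<phi>2 \<eta> K \<nu> \<nu>QSD
    by (rule q_process.intro[OF A.absorbed_process_axioms q_process_axioms.intro[OF qc]])
  have E'q: "E' = q.E'" by (simp add: E'_def q.E'_def)
  then have \<beta>q: "\<beta> = q.\<beta>" by (simp add: \<beta>_def q.\<beta>_def)
  obtain \<gamma> b v \<rho> where "harris_chain q.N q.h q.V \<gamma> b v K n1 \<rho> q.\<beta>" using q.tilted_harris_chain by blast
  then interpret H: harris_chain q.N q.h q.V \<gamma> b v K n1 \<rho> q.\<beta> .
  have V: "q.V = (\<lambda>x. \<phi>1 x / \<eta> x)" by (simp add: q.V_def fun_eq_iff)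
  have inv: "invariant_distribution q.N q.h q.\<beta>"
    unfolding invariant_distribution_def distribution_on_def using q.\<beta>_prob q.\<beta>_sets q.\<beta>_invariant by blast
  obtain C a where C: "0 < C" "0 < a" "a < 1"
    "\<And>\<mu> n. distribution_on q.N \<mu> \<Longrightarrow> (\<integral>\<^sup>+x. ennreal (q.V x) \<partial>\<mu>) < \<infinity> \<Longrightarrow>
      weighted_TV q.N q.V (\<mu> \<bind> q.h n) q.\<beta> \<le> ennreal (C * a ^ n) * (\<integral>\<^sup>+x. ennreal (q.V x) \<partial>\<mu>)"
    using H.weighted_convergence by blast
  have bk: "\<mu> \<bind> transition_kernel M q.E' coordinate q.Q n = \<mu> \<bind> q.h n" if "distribution_on (restrict_space M q.E') \<mu>" for \<mu> n
    by (rule q.bind_Q_kernel[OF q.distribution_space[OF that]])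
  show ?thesis
    unfolding E'q \<beta>q
  proof (intro exI[of _ q.Q] conjI ballI allI impI)
    fix x assume x: "x \<in> q.E'"
    show "prob_space (q.Q x)" "sets (q.Q x) = sets (path_space M)" using q.Q_prob[OF x] q.Q_sets[OF x] by auto
    show "(\<lambda>n. conditional_path_prob T \<Omega> X P x m A n) \<longlonglongrightarrow> measure (q.Q x) A"
      if "A \<in> sets (canonical_filtration M m)" for m A by (rule q.Q_limit[OF x that])
  next
    show "homogeneous_markov_process UNIV M q.E' (path_space M) coordinate q.Q" by (rule q.Q_homogeneous_markov)
  next
    fix \<phi> :: "'a \<Rightarrow> real" and n x
    assume \<phi>: "\<phi> \<in> borel_measurable (restrict_space M q.E')" "bounded (\<phi> ` q.E')" and x: "x \<in> q.E'"
    show "killed_integrable T \<Omega> X P n (\<lambda>y. \<eta> y * \<phi> y) x"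
      "(LINT y|transition_kernel M q.E' coordinate q.Q n x. \<phi> y) =
          inverse (\<theta>0 ^ n) / \<eta> x * killed_semigroup T \<Omega> X P n (\<lambda>y. \<eta> y * \<phi> y) x"
      by (rule q.Q_semigroup[OF \<phi> x])+
  next
    show "invariant_distribution (restrict_space M q.E') (transition_kernel M q.E' coordinate q.Q) q.\<beta>"
      unfolding q.invariant_iff by (rule inv)
    show "\<mu> = q.\<beta>" if "invariant_distribution (restrict_space M q.E') (transition_kernel M q.E' coordinate q.Q) \<mu>" for \<mu>
      using that unfolding q.invariant_iff by (rule H.invariant_unique)
  next
    show "\<exists>C \<alpha> :: real. 0 < C \<and> 0 < \<alpha> \<and> \<alpha> < 1 \<and>
       (\<forall>\<mu>. distribution_on (restrict_space M q.E') \<mu> \<and>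
            (\<integral>\<^sup>+x. ennreal (\<phi>1 x / \<eta> x) \<partial>\<mu>) < \<infinity> \<longrightarrow>
          (\<forall>n. weighted_TV (restrict_space M q.E') (\<lambda>x. \<phi>1 x / \<eta> x)
                 (\<mu> \<bind> transition_kernel M q.E' coordinate q.Q n) q.\<beta>
               \<le> ennreal (C * \<alpha> ^ n) * (\<integral>\<^sup>+x. ennreal (\<phi>1 x / \<eta> x) \<partial>\<mu>)))"
      using C unfolding q.N_def[symmetric] V by (intro exI[of _ C] exI[of _ a]) (auto simp: bk[unfolded q.N_def[symmetric]])
  next
    fix \<mu> assume \<mu>: "distribution_on (restrict_space M q.E') \<mu>"
    show "(\<lambda>n. weighted_TV (restrict_space M q.E') (\<lambda>_. 1)
              (\<mu> \<bind> transition_kernel M q.E' coordinate q.Q n) q.\<beta>) \<longlonglongrightarrow> 0"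
      unfolding bk[OF \<mu>] using H.total_variation_convergence[of \<mu>] \<mu> unfolding q.N_def by simp
  qed
qed

end
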